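(* Let $j\in\{1,\dots,p\}$ with $p$ fixed. Assume that $X$ is a Gaussian vector in $\mathbb{R}^p$ with invertible covariance matrix, that $y=X\beta+\epsilon$ with $\beta\in\mathbb{R}^p$ and $\epsilon\sim\mathcal{N}(0,\sigma^2)$ independent of $X$ (i.i.d. across observations), and that $X^j$ is independent of $y$ conditionally on $X^{-j}$. Let $\widehat{m}$ and $\widehat{m}_{-j}$ be the least-squares linear regressions of $y$ on $X$ and of $y$ on $X^{-j}$, respectively, trained on $n_{\mathrm{train}}$ observations. Then, with the quadratic loss, $$\mathbb{E}\left[\widehat{\psi}^j_{\mathrm{LOCO}}\right]=O\left(1/n_{\mathrm{train}}\right).$$
   Context: For a vector $x\in\mathbb{R}^p$ (written as a row), $x^{j}$ is its $j$-th coordinate and $x^{-j}$ is $x$ with the $j$-th coordinate removed. Given an i.i.d. test set $(x_i,y_i)_{i=1,\dots,n_{\mathrm{test}}}$ independent of the training data, the Leave-One-Covariate-Out importance with quadratic loss is $$\widehat{\psi}^j_{\mathrm{LOCO}}=\frac{1}{n_{\mathrm{test}}}\sum_{i=1}^{n_{\mathrm{test}}}\left[\left(\widehat{m}_{-j}(x_i^{-j})-y_i\right)^2-\left(\widehat{m}(x_i)-y_i\right)^2\right].$$ *)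

theory Defs
  imports "HOL-Probability.Probability" "HOL-Library.Landau_Symbols"
begin

text \<open>The normal law with mean \<open>\<mu>\<close> and variance \<open>\<sigma>\<^sup>2\<close>; the degenerate case \<open>\<sigma> = 0\<close> is the Dirac mass.\<close>

definition normal_law :: "real \<Rightarrow> real \<Rightarrow> real measure" where
  "normal_law \<mu> \<sigma> =
     (if \<sigma> = 0 then return borel \<mu> else density lborel (\<lambda>x. ennreal (normal_density \<mu> \<sigma> x)))"

definition gaussian_vector :: "'a measure \<Rightarrow> ('a \<Rightarrow> real ^ 'p) \<Rightarrow> bool" where
  "gaussian_vector M X \<longleftrightarrow>
     X \<in> borel_measurable M \<and>
     (\<forall>u. \<exists>\<mu> \<sigma>. distr M borel (\<lambda>\<omega>. u \<bullet> X \<omega>) = normal_law \<mu> \<sigma>)"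

definition covariance_matrix :: "'a measure \<Rightarrow> ('a \<Rightarrow> real ^ 'p) \<Rightarrow> real ^ 'p ^ 'p" where
  "covariance_matrix M X =
     (\<chi> k l. \<integral>\<omega>. (X \<omega> $ k - (\<integral>\<omega>'. X \<omega>' $ k \<partial>M)) * (X \<omega> $ l - (\<integral>\<omega>'. X \<omega>' $ l \<partial>M)) \<partial>M)"

text \<open>The library's \<open>indep_var\<close> requires both variables to have the same value type; this is the
  same notion for two Borel variables of different types.\<close>

definition indep_borel ::
  "'a measure \<Rightarrow> ('a \<Rightarrow> 'b::topological_space) \<Rightarrow> ('a \<Rightarrow> 'c::topological_space) \<Rightarrow> bool" where
  "indep_borel M U V \<longleftrightarrow>
     U \<in> borel_measurable M \<and> V \<in> borel_measurable M \<and>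
     prob_space.indep_set M {U -` A \<inter> space M | A. A \<in> sets borel}
                            {V -` B \<inter> space M | B. B \<in> sets borel}"

text \<open>\<open>U\<close> and \<open>V\<close> are independent conditionally on \<open>W\<close>, a random variable with values in \<open>N\<close>:
  \<open>P (U \<in> A, V \<in> B | W) = P (U \<in> A | W) P (V \<in> B | W)\<close> almost surely, for all Borel sets.\<close>

definition cond_indep ::
  "'a measure \<Rightarrow> ('a \<Rightarrow> real) \<Rightarrow> ('a \<Rightarrow> real) \<Rightarrow> 'w measure \<Rightarrow> ('a \<Rightarrow> 'w) \<Rightarrow> bool" where
  "cond_indep M U V N W \<longleftrightarrow>
     U \<in> borel_measurable M \<and> V \<in> borel_measurable M \<and> W \<in> measurable M N \<and>
     (let F = vimage_algebra (space M) W N in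
       \<forall>A\<in>sets borel. \<forall>B\<in>sets borel. AE \<omega> in M.
         real_cond_exp M F (\<lambda>\<omega>. indicator A (U \<omega>) * indicator B (V \<omega>)) \<omega> =
         real_cond_exp M F (\<lambda>\<omega>. indicator A (U \<omega>)) \<omega> *
         real_cond_exp M F (\<lambda>\<omega>. indicator B (V \<omega>)) \<omega>)"

text \<open>Subvectors are extensional functions on their set of coordinates: \<open>coords UNIV x\<close> is the
  full vector and \<open>coords (- {j}) x\<close> is \<open>x\<close> without its \<open>j\<close>-th coordinate (the empty vector if
  there is only one coordinate).\<close>

definition coords :: "'p set \<Rightarrow> real ^ 'p \<Rightarrow> 'p \<Rightarrow> real" where
  "coords S x = restrict (\<lambda>k. x $ k) S"

definition linear_predictor :: "'p set \<Rightarrow> ('p \<Rightarrow> real) \<Rightarrow> ('p \<Rightarrow> real) \<Rightarrow> real" where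
  "linear_predictor S b z = (\<Sum>k\<in>S. b k * z k)"

text \<open>The map \<open>fit\<close> sends a sample of \<open>n\<close> pairs (covariates in \<open>S\<close>, response) to a least-squares
  coefficient vector.  The minimiser need not be unique (e.g. for \<open>n < card S\<close>), so \<open>fit\<close> is an
  arbitrary measurable choice of one.\<close>

definition least_squares_fit ::
  "'p set \<Rightarrow> nat \<Rightarrow> ((nat \<Rightarrow> ('p \<Rightarrow> real) \<times> real) \<Rightarrow> 'p \<Rightarrow> real) \<Rightarrow> bool" where
  "least_squares_fit S n fit \<longleftrightarrow>
     (let D = Pi\<^sub>M {..<n} (\<lambda>_. Pi\<^sub>M S (\<lambda>_. borel) \<Otimes>\<^sub>M borel) in
       fit \<in> measurable D (Pi\<^sub>M S (\<lambda>_. borel)) \<and>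
       (\<forall>d\<in>space D.
          is_arg_min (\<lambda>b. \<Sum>i<n. (snd (d i) - linear_predictor S b (fst (d i)))\<^sup>2)
                     (\<lambda>b. b \<in> S \<rightarrow>\<^sub>E UNIV) (fit d)))"

text \<open>The regression function on the covariates in \<open>S\<close>, trained on the first \<open>n\<close> observations.\<close>

definition trained_predictor ::
  "'p set \<Rightarrow> nat \<Rightarrow> ((nat \<Rightarrow> ('p \<Rightarrow> real) \<times> real) \<Rightarrow> 'p \<Rightarrow> real) \<Rightarrow>
   (nat \<Rightarrow> (real ^ 'p) \<times> real) \<Rightarrow> ('p \<Rightarrow> real) \<Rightarrow> real" where
  "trained_predictor S n fit d =
     linear_predictor S (fit (\<lambda>i\<in>{..<n}. (coords S (fst (d i)), snd (d i))))"

definition loco ::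
  "'p \<Rightarrow> (('p \<Rightarrow> real) \<Rightarrow> real) \<Rightarrow> (('p \<Rightarrow> real) \<Rightarrow> real) \<Rightarrow>
   nat \<Rightarrow> (nat \<Rightarrow> (real ^ 'p) \<times> real) \<Rightarrow> real" where
  "loco j m m_j N d =
     1 / real N * (\<Sum>i<N. (m_j (coords (- {j}) (fst (d i))) - snd (d i))\<^sup>2
                        - (m (coords UNIV (fst (d i))) - snd (d i))\<^sup>2)"

end

theory Submission imports Defs begin

text \<open>Write \<open>K = 4 (p + 4)\<close>, where \<open>p\<close> is the number of covariates.

\<^bold>\<open>Reduction.\<close> Conditional independence forces \<open>\<beta>\<^sub>j = 0\<close> (\<open>coefficient_zero_if_cond_indep\<close>), so
both regressions, on all covariates and on all but the \<open>j\<close>-th, are well specified, with the same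
noise. If \<open>\<delta>\<close> is the estimation error of either coefficient vector, padded with zeros, and \<open>(x, e)\<close>
are the covariates and the noise of a test point, the expected quadratic loss is
\<open>E (x \<bullet> \<delta> - e)\<^sup>2 = E (x \<bullet> \<delta>)\<^sup>2 + E e\<^sup>2\<close>. The noise terms of the two models cancel in the score, and
it remains to show \<open>E (x \<bullet> \<delta>)\<^sup>2 = O(1/n)\<close> (\<open>prediction_error_rate\<close>).

\<^bold>\<open>The coefficient.\<close> With \<open>\<Sigma>\<close> the covariance matrix and \<open>v = inverse \<Sigma> e\<^sub>j\<close>, the variable \<open>v \<bullet> X\<close> is
uncorrelated with every coordinate but the \<open>j\<close>-th. Its centred character
\<open>f = exp (i t v \<bullet> X) - E exp (i t v \<bullet> X)\<close> therefore has conditional expectation \<open>0\<close> given the other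
coordinates; as Gaussian vectors are given by their one-dimensional projections, this is derived
by applying Levy's uniqueness theorem to one coordinate at a time. Conditional independence then
gives \<open>E (f h g(y)) = 0\<close> for all bounded \<open>g\<close> and all characters \<open>h\<close> of the other coordinates.
For \<open>g = exp (i y)\<close> and suitable \<open>h\<close> and \<open>t\<close> this reads
\<open>(1 - |E exp (i b v \<bullet> X)|\<^sup>2) E exp (i \<epsilon>) = 0\<close> with \<open>b = \<beta>\<^sub>j / v\<^sub>j\<close>, hence \<open>b = 0\<close>.

\<^bold>\<open>The risk.\<close> Put \<open>Z = \<Sum> e\<^sub>i x\<^sub>i\<close>. Since the fit does at least as well on the training sample as the true
coefficients, \<open>\<Sum> (x\<^sub>i \<bullet> \<delta>)\<^sup>2 \<le> 2 (\<delta> \<bullet> Z)\<close>, so \<open>|\<delta>| \<le> 2 |Z| / \<lambda>\<close> with \<open>\<lambda>\<close> the smallest eigenvalue of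
\<open>\<Sum> x\<^sub>i x\<^sub>i\<^sup>T\<close>. The training sample is cut into \<open>m = n div K\<close> blocks of \<open>K\<close> observations. The smallest
eigenvalue of one block is bounded below by the inverse square root of its \<open>energy\<close>, the integral
over directions \<open>v\<close> in an annulus of a product of negative powers of \<open>|x\<^sub>l \<bullet> v|\<close>
(\<open>energy_lower_bound\<close>); eigenvalue bounds add up over blocks, and convexity of \<open>t \<mapsto> 1/t\<^sup>2\<close> yields
\<open>1/\<lambda>\<^sup>2 \<le> const (sum of the block energies) / m^3\<close>. By Tonelli and the independence of the observations, the
expectation of an energy, even weighted by second moments, is finite as soon as the projections
\<open>x \<bullet> v\<close> have a uniformly bounded negative moment, which holds for a nondegenerate Gaussian vector
(\<open>inv_proj_moment_bound\<close>). The energies depend on the covariates only, and changing the sign of a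
single \<open>e\<^sub>i\<close> preserves the law of the sample; so the cross terms of \<open>|Z|\<^sup>2\<close> vanish, each of the \<open>n\<close>
diagonal terms contributes a constant per block, and the risk is \<open>O (n m / m\<^sup>3) = O (1/n)\<close>.\<close>

section \<open>Weights, laws and characteristic functions\<close>

lemma borel_measurable_vec_component [measurable (raw)]:
  fixes f :: "'a \<Rightarrow> real ^ 'p::finite"
  assumes [measurable]: "f \<in> borel_measurable M"
  shows "(\<lambda>\<omega>. f \<omega> $ k) \<in> borel_measurable M"
proof -
  have "(\<lambda>\<omega>. axis k 1 \<bullet> f \<omega>) \<in> borel_measurable M" by measurable
  then show ?thesis by (simp add: inner_axis')
qed

text \<open>The complex measure with density \<open>f\<close> has image \<open>0\<close> under \<open>Y\<close>. For integrable \<open>f\<close> and measurable \<open>Y\<close>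
this says that the conditional expectation of \<open>f\<close> given \<open>Y\<close> vanishes; it is stated through
integrals to avoid complex-valued conditional expectations.\<close>

definition annihilates_law :: "'a measure \<Rightarrow> ('a \<Rightarrow> complex) \<Rightarrow> 'b measure \<Rightarrow> ('a \<Rightarrow> 'b) \<Rightarrow> bool" where
  "annihilates_law M f N Y \<longleftrightarrow> (\<forall>A\<in>sets N. (\<integral>\<omega>. f \<omega> * indicator A (Y \<omega>) \<partial>M) = 0)"

lemma integrable_mult_bounded:
  fixes f g :: "'a \<Rightarrow> complex"
  assumes f: "integrable M f" and g: "g \<in> borel_measurable M" and B: "\<And>\<omega>. norm (g \<omega>) \<le> B"
  shows "integrable M (\<lambda>\<omega>. f \<omega> * g \<omega>)"
proof (rule Bochner_Integration.integrable_bound[where f = "\<lambda>\<omega>. B *\<^sub>R f \<omega>"])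
  show "AE \<omega> in M. norm (f \<omega> * g \<omega>) \<le> norm (B *\<^sub>R f \<omega>)"
  proof (intro AE_I2)
    fix \<omega>
    have "norm (f \<omega>) * norm (g \<omega>) \<le> norm (f \<omega>) * \<bar>B\<bar>"
      using B[of \<omega>] by (intro mult_left_mono) auto
    then show "norm (f \<omega> * g \<omega>) \<le> norm (B *\<^sub>R f \<omega>)"
      by (simp add: norm_mult mult.commute)
  qed
qed (use f g borel_measurable_integrable[OF f] in auto)

text \<open>Real weights are handled through their positive and negative parts, that is, as a difference of
the two image measures below; \<open>ennreal\<close> truncates negative values to \<open>0\<close>.\<close>

lemma emeasure_weight_parts_eq_if_integral_zero:
  fixes f :: "'a \<Rightarrow> real"
  assumes f: "integrable M f" and Y[measurable]: "Y \<in> measurable M N"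
    and A: "A \<in> sets N" and 0: "(\<integral>\<omega>. f \<omega> * indicator A (Y \<omega>) \<partial>M) = 0"
  shows "emeasure (distr (density M (\<lambda>\<omega>. ennreal (f \<omega>))) N Y) A
       = emeasure (distr (density M (\<lambda>\<omega>. ennreal (- f \<omega>))) N Y) A"
proof -
  have [measurable]: "f \<in> borel_measurable M" using f by auto
  note A[measurable]
  have e: "emeasure (distr (density M (\<lambda>\<omega>. ennreal (h \<omega>))) N Y) A =
      ennreal (\<integral>\<omega>. max 0 (h \<omega>) * indicator A (Y \<omega>) \<partial>M)"
    if h[measurable]: "integrable M h" for h :: "'a \<Rightarrow> real"
  proof -
    have [measurable]: "h \<in> borel_measurable M" using h by auto
    have "emeasure (distr (density M (\<lambda>\<omega>. ennreal (h \<omega>))) N Y) A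
        = (\<integral>\<^sup>+\<omega>. ennreal (h \<omega>) * indicator (Y -` A \<inter> space M) \<omega> \<partial>M)"
      using A by (simp add: emeasure_distr emeasure_density)
    also have "\<dots> = (\<integral>\<^sup>+\<omega>. ennreal (max 0 (h \<omega>) * indicator A (Y \<omega>)) \<partial>M)"
      by (intro nn_integral_cong) (auto simp: indicator_def max_def ennreal_neg)
    also have "\<dots> = ennreal (\<integral>\<omega>. max 0 (h \<omega>) * indicator A (Y \<omega>) \<partial>M)"
    proof (rule nn_integral_eq_integral)
      show "integrable M (\<lambda>\<omega>. max 0 (h \<omega>) * indicator A (Y \<omega>))"
        by (rule Bochner_Integration.integrable_bound[OF h]) (auto simp: indicator_def)
    qed auto
    finally show ?thesis .
  qed
  have i: "integrable M (\<lambda>\<omega>. max 0 (h \<omega>) * indicator A (Y \<omega>))" if h: "integrable M h" for h :: "'a \<Rightarrow> real"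
  proof -
    have [measurable]: "h \<in> borel_measurable M" using h by auto
    show ?thesis by (rule Bochner_Integration.integrable_bound[OF h]) (auto simp: indicator_def)
  qed
  have "(\<integral>\<omega>. max 0 (f \<omega>) * indicator A (Y \<omega>) \<partial>M) - (\<integral>\<omega>. max 0 (- f \<omega>) * indicator A (Y \<omega>) \<partial>M)
      = (\<integral>\<omega>. max 0 (f \<omega>) * indicator A (Y \<omega>) - max 0 (- f \<omega>) * indicator A (Y \<omega>) \<partial>M)"
    using i[of f] i[of "\<lambda>\<omega>. - f \<omega>"] f by simp
  also have "\<dots> = (\<integral>\<omega>. f \<omega> * indicator A (Y \<omega>) \<partial>M)"
    by (intro Bochner_Integration.integral_cong) (auto simp: max_def)
  finally have "(\<integral>\<omega>. max 0 (f \<omega>) * indicator A (Y \<omega>) \<partial>M) = (\<integral>\<omega>. max 0 (- f \<omega>) * indicator A (Y \<omega>) \<partial>M)"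
    using 0 by simp
  with 0 show ?thesis using f by (simp add: e)
qed

lemma integral_weight_distr_density:
  fixes f :: "'a \<Rightarrow> real" and g :: "'b \<Rightarrow> complex"
  assumes f: "integrable M f" and Y[measurable]: "Y \<in> measurable M N"
    and g[measurable]: "g \<in> borel_measurable N" and B: "\<And>z. norm (g z) \<le> B"
  shows "(\<integral>\<omega>. of_real (f \<omega>) * g (Y \<omega>) \<partial>M)
       = (\<integral>z. g z \<partial>distr (density M (\<lambda>\<omega>. ennreal (f \<omega>))) N Y)
       - (\<integral>z. g z \<partial>distr (density M (\<lambda>\<omega>. ennreal (- f \<omega>))) N Y)"
proof -
  have [measurable]: "f \<in> borel_measurable M" using f by auto
  have i: "(\<integral>z. g z \<partial>distr (density M (\<lambda>\<omega>. ennreal (h \<omega>))) N Y)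
      = (\<integral>\<omega>. of_real (max 0 (h \<omega>)) * g (Y \<omega>) \<partial>M)"
    if h[measurable]: "h \<in> borel_measurable M" for h :: "'a \<Rightarrow> real"
  proof -
    have "density M (\<lambda>\<omega>. ennreal (h \<omega>)) = density M (\<lambda>\<omega>. ennreal (max 0 (h \<omega>)))"
      by (intro arg_cong[where f = "density M"] ext) (auto simp: max_def ennreal_neg)
    then have "(\<integral>z. g z \<partial>distr (density M (\<lambda>\<omega>. ennreal (h \<omega>))) N Y)
        = (\<integral>z. g z \<partial>distr (density M (\<lambda>\<omega>. ennreal (max 0 (h \<omega>)))) N Y)" by simp
    also have "\<dots> = (\<integral>\<omega>. g (Y \<omega>) \<partial>density M (\<lambda>\<omega>. ennreal (max 0 (h \<omega>))))"
      by (rule integral_distr) auto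
    also have "\<dots> = (\<integral>\<omega>. of_real (max 0 (h \<omega>)) * g (Y \<omega>) \<partial>M)"
      by (subst integral_density) (auto simp: scaleR_conv_of_real)
    finally show ?thesis .
  qed
  have int: "integrable M (\<lambda>\<omega>. of_real (max 0 (h \<omega>)) * g (Y \<omega>))"
    if h: "integrable M h" for h :: "'a \<Rightarrow> real"
    using h by (intro integrable_mult_bounded[where B = B]) (auto intro!: B)
  have "(\<integral>\<omega>. of_real (max 0 (f \<omega>)) * g (Y \<omega>) \<partial>M) - (\<integral>\<omega>. of_real (max 0 (- f \<omega>)) * g (Y \<omega>) \<partial>M)
      = (\<integral>\<omega>. of_real (max 0 (f \<omega>)) * g (Y \<omega>) - of_real (max 0 (- f \<omega>)) * g (Y \<omega>) \<partial>M)"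
    using int[OF f] int[of "\<lambda>\<omega>. - f \<omega>"] f by simp
  also have "\<dots> = (\<integral>\<omega>. of_real (f \<omega>) * g (Y \<omega>) \<partial>M)"
    by (intro Bochner_Integration.integral_cong) (auto simp: max_def)
  finally show ?thesis by (simp add: i)
qed

lemma integral_complex_weight_split:
  fixes f g :: "'a \<Rightarrow> complex"
  assumes f: "integrable M f" and g: "g \<in> borel_measurable M" and B: "\<And>\<omega>. norm (g \<omega>) \<le> B"
  shows "(\<integral>\<omega>. f \<omega> * g \<omega> \<partial>M)
       = (\<integral>\<omega>. of_real (Re (f \<omega>)) * g \<omega> \<partial>M) + \<i> * (\<integral>\<omega>. of_real (Im (f \<omega>)) * g \<omega> \<partial>M)"
proof -
  have "(\<integral>\<omega>. f \<omega> * g \<omega> \<partial>M)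
      = (\<integral>\<omega>. of_real (Re (f \<omega>)) * g \<omega> + \<i> * (of_real (Im (f \<omega>)) * g \<omega>) \<partial>M)"
    by (intro Bochner_Integration.integral_cong refl, subst (1) complex_eq) (simp add: algebra_simps)
  also have "\<dots> = (\<integral>\<omega>. of_real (Re (f \<omega>)) * g \<omega> \<partial>M) + \<i> * (\<integral>\<omega>. of_real (Im (f \<omega>)) * g \<omega> \<partial>M)"
    using integrable_mult_bounded[OF _ g B, of "\<lambda>\<omega>. of_real (Re (f \<omega>))"]
      integrable_mult_bounded[OF _ g B, of "\<lambda>\<omega>. of_real (Im (f \<omega>))"] f by simp
  finally show ?thesis .
qed

lemma indicator_integral_parts_zero:
  fixes f :: "'a \<Rightarrow> complex"
  assumes f: "integrable M f" and Y[measurable]: "Y \<in> measurable M N"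
    and A[measurable]: "A \<in> sets N" and z: "(\<integral>\<omega>. f \<omega> * indicator A (Y \<omega>) \<partial>M) = 0"
  shows "(\<integral>\<omega>. Re (f \<omega>) * indicator A (Y \<omega>) \<partial>M) = 0"
    and "(\<integral>\<omega>. Im (f \<omega>) * indicator A (Y \<omega>) \<partial>M) = 0"
proof -
  have reim: "Re (f \<omega> * indicator A (Y \<omega>)) = Re (f \<omega>) * indicator A (Y \<omega>)"
    "Im (f \<omega> * indicator A (Y \<omega>)) = Im (f \<omega>) * indicator A (Y \<omega>)" for \<omega>
    by (auto simp: indicator_def)
  have i: "integrable M (\<lambda>\<omega>. f \<omega> * indicator A (Y \<omega>))"
    using f by (rule integrable_mult_bounded[where B = 1]) (auto simp: indicator_def)
  have "(\<integral>\<omega>. Re (f \<omega> * indicator A (Y \<omega>)) \<partial>M) = 0"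
    "(\<integral>\<omega>. Im (f \<omega> * indicator A (Y \<omega>)) \<partial>M) = 0"
    using integral_Re[OF i] integral_Im[OF i] z by (simp_all only: zero_complex.sel)
  then show "(\<integral>\<omega>. Re (f \<omega>) * indicator A (Y \<omega>) \<partial>M) = 0"
    and "(\<integral>\<omega>. Im (f \<omega>) * indicator A (Y \<omega>) \<partial>M) = 0"
    by (simp_all only: reim)
qed

text \<open>Extension from indicators to bounded measurable functions of \<open>Y\<close>.\<close>

lemma annihilates_law_integral:
  fixes f :: "'a \<Rightarrow> complex" and g :: "'b \<Rightarrow> complex"
  assumes f: "integrable M f" and Y[measurable]: "Y \<in> measurable M N"
    and an: "annihilates_law M f N Y"
    and g[measurable]: "g \<in> borel_measurable N" and B: "\<And>z. norm (g z) \<le> B"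
  shows "(\<integral>\<omega>. f \<omega> * g (Y \<omega>) \<partial>M) = 0"
proof -
  have [measurable]: "f \<in> borel_measurable M" using f by auto
  have 0: "(\<integral>\<omega>. Re (f \<omega>) * indicator A (Y \<omega>) \<partial>M) = 0"
      "(\<integral>\<omega>. Im (f \<omega>) * indicator A (Y \<omega>) \<partial>M) = 0" if "A \<in> sets N" for A
    using indicator_integral_parts_zero[OF f Y that] an that by (auto simp: annihilates_law_def)
  have r: "(\<integral>\<omega>. of_real (h \<omega>) * g (Y \<omega>) \<partial>M) = 0"
    if h: "integrable M h" and z: "\<And>A. A \<in> sets N \<Longrightarrow> (\<integral>\<omega>. h \<omega> * indicator A (Y \<omega>) \<partial>M) = 0"
    for h :: "'a \<Rightarrow> real"
  proof -
    have "distr (density M (\<lambda>\<omega>. ennreal (h \<omega>))) N Y = distr (density M (\<lambda>\<omega>. ennreal (- h \<omega>))) N Y"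
      by (rule measure_eqI) (auto intro!: emeasure_weight_parts_eq_if_integral_zero h z)
    then show ?thesis using integral_weight_distr_density[OF h Y g B] by simp
  qed
  show ?thesis
    using f 0 by (subst integral_complex_weight_split[where B = B])
      (auto intro!: B simp: r[of "\<lambda>\<omega>. Re (f \<omega>)"] r[of "\<lambda>\<omega>. Im (f \<omega>)"])
qed

text \<open>Levy's uniqueness theorem for weights: the images of the positive and the negative part of \<open>f\<close> have
the same total mass (take \<open>t = 0\<close>) and the same characteristic function after normalisation.\<close>

lemma real_weight_annihilates_law_if_char_zero:
  fixes f :: "'a \<Rightarrow> real"
  assumes f: "integrable M f" and Y[measurable]: "Y \<in> borel_measurable M"
    and char0: "\<And>t. (\<integral>\<omega>. of_real (f \<omega>) * iexp (t * Y \<omega>) \<partial>M) = 0"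
    and A: "A \<in> sets borel"
  shows "(\<integral>\<omega>. of_real (f \<omega>) * indicator A (Y \<omega>) \<partial>M) = (0::complex)"
proof -
  have [measurable]: "f \<in> borel_measurable M" using f by auto
  define P where "P s = distr (density M (\<lambda>\<omega>. ennreal (s * f \<omega>))) borel Y" for s :: real
  define c where "c = (\<integral>\<omega>. max 0 (f \<omega>) \<partial>M)"
  have [simp]: "sets (P s) = sets borel" "space (P s) = UNIV" for s by (auto simp: P_def)
  have mass: "emeasure (P s) UNIV = ennreal (\<integral>\<omega>. max 0 (s * f \<omega>) \<partial>M)" for s
  proof -
    have "emeasure (P s) UNIV = (\<integral>\<^sup>+\<omega>. ennreal (s * f \<omega>) \<partial>M)"
      by (simp add: P_def emeasure_distr emeasure_density cong: nn_integral_cong)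
    also have "\<dots> = (\<integral>\<^sup>+\<omega>. ennreal (max 0 (s * f \<omega>)) \<partial>M)"
      by (intro nn_integral_cong) (auto simp: max_def ennreal_neg)
    also have "\<dots> = ennreal (\<integral>\<omega>. max 0 (s * f \<omega>) \<partial>M)"
      using f by (intro nn_integral_eq_integral) auto
    finally show ?thesis .
  qed
  have diff: "(\<integral>\<omega>. of_real (f \<omega>) * g (Y \<omega>) \<partial>M) = (\<integral>z. g z \<partial>P 1) - (\<integral>z. g z \<partial>P (-1))"
    if "g \<in> borel_measurable borel" "\<And>z. norm (g z) \<le> 1" for g :: "real \<Rightarrow> complex"
    using integral_weight_distr_density[OF f Y that] by (simp add: P_def)
  have c': "(\<integral>\<omega>. max 0 (- f \<omega>) \<partial>M) = c"
  proof -
    have "c - (\<integral>\<omega>. max 0 (- f \<omega>) \<partial>M) = (\<integral>\<omega>. max 0 (f \<omega>) - max 0 (- f \<omega>) \<partial>M)"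
      unfolding c_def using f by (intro Bochner_Integration.integral_diff[symmetric]) auto
    also have "\<dots> = (\<integral>\<omega>. f \<omega> \<partial>M)"
      by (intro Bochner_Integration.integral_cong) (auto simp: max_def)
    finally have "c - (\<integral>\<omega>. max 0 (- f \<omega>) \<partial>M) = (\<integral>\<omega>. f \<omega> \<partial>M)" .
    moreover have "of_real (\<integral>\<omega>. f \<omega> \<partial>M) = (0::complex)" using char0[of 0] by simp
    ultimately show ?thesis by (simp only: of_real_eq_0_iff)
  qed
  have m: "emeasure (P s) UNIV = ennreal c" if "s \<in> {1,-1}" for s
    using that c' by (auto simp: mass c_def)
  have c0: "c \<ge> 0" by (simp add: c_def)
  have "P 1 = P (-1)"
  proof (cases "c = 0")
    case True
    have "emeasure (P s) B = 0" if "s \<in> {1,-1}" for s B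
      using m[OF that] emeasure_mono[of B UNIV "P s"] True by simp
    then show ?thesis by (intro measure_eqI) auto
  next
    case False
    with c0 have c: "c > 0" by simp
    define Q where "Q s = scale_measure (ennreal (1/c)) (P s)" for s
    have [simp]: "sets (Q s) = sets borel" "space (Q s) = UNIV" for s
      by (auto simp: Q_def space_scale_measure)
    have Q: "real_distribution (Q s)" if "s \<in> {1,-1}" for s
    proof -
      have "prob_space (Q s)"
        using c m[OF that] by (intro prob_spaceI) (simp add: Q_def space_scale_measure ennreal_mult[symmetric])
      then show ?thesis by (simp add: real_distribution_def real_distribution_axioms_def)
    qed
    have Qd: "Q s = density (P s) (\<lambda>_. ennreal (1/c))" for s
      by (rule measure_eqI) (auto simp: Q_def emeasure_density nn_integral_cmult_indicator)
    have "char (Q 1) = char (Q (-1))"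
    proof
      fix t
      have "char (Q s) t = (1/c) *\<^sub>R (\<integral>z. iexp (t * z) \<partial>P s)" for s
        unfolding char_def Qd using c by (subst integral_density) (auto simp: P_def)
      moreover have "(\<integral>z. iexp (t * z) \<partial>P 1) = (\<integral>z. iexp (t * z) \<partial>P (-1))"
        using diff[of "\<lambda>z. iexp (t * z)"] char0[of t] by simp
      ultimately show "char (Q 1) t = char (Q (-1)) t" by simp
    qed
    then have QQ: "Q 1 = Q (-1)" using Q by (intro Levy_uniqueness) auto
    show ?thesis
    proof (rule measure_eqI)
      fix B assume "B \<in> sets (P 1)"
      have "ennreal c * emeasure (Q s) B = emeasure (P s) B" for s
        using c by (simp add: Q_def mult.assoc[symmetric] ennreal_mult[symmetric])
      then show "emeasure (P 1) B = emeasure (P (-1)) B" using QQ by metis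
    qed simp
  qed
  then show ?thesis using A diff[of "indicator A"] by (simp add: indicator_def)
qed

lemma annihilates_law_if_char_zero:
  fixes f :: "'a \<Rightarrow> complex"
  assumes f: "integrable M f" and Y[measurable]: "Y \<in> borel_measurable M"
    and char0: "\<And>t. (\<integral>\<omega>. f \<omega> * iexp (t * Y \<omega>) \<partial>M) = 0"
  shows "annihilates_law M f borel Y"
proof -
  have [measurable]: "f \<in> borel_measurable M" using f by auto
  have cnj0: "(\<integral>\<omega>. cnj (f \<omega>) * iexp (t * Y \<omega>) \<partial>M) = 0" for t
  proof -
    have "(\<integral>\<omega>. cnj (f \<omega>) * iexp (t * Y \<omega>) \<partial>M) = (\<integral>\<omega>. cnj (f \<omega> * iexp ((-t) * Y \<omega>)) \<partial>M)"
      by (intro Bochner_Integration.integral_cong) (simp_all add: exp_cnj)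
    also have "\<dots> = cnj (\<integral>\<omega>. f \<omega> * iexp ((-t) * Y \<omega>) \<partial>M)" by (rule integral_bounded_linear'[OF bounded_linear_cnj bounded_linear_cnj]) simp
    finally show ?thesis using char0[of "-t"] by simp
  qed
  have ic: "integrable M (\<lambda>\<omega>. cnj (f \<omega>))" using f by simp
  have i: "integrable M (\<lambda>\<omega>. h \<omega> * iexp (t * Y \<omega>))" if "integrable M h" for h t
    using that by (rule integrable_mult_bounded[where B = 1]) auto
  have re: "(\<integral>\<omega>. of_real (Re (f \<omega>)) * iexp (t * Y \<omega>) \<partial>M) = 0" for t
  proof -
    have "(\<integral>\<omega>. of_real (Re (f \<omega>)) * iexp (t * Y \<omega>) \<partial>M)
      = (\<integral>\<omega>. (f \<omega> * iexp (t * Y \<omega>) + cnj (f \<omega>) * iexp (t * Y \<omega>)) / 2 \<partial>M)"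
      by (intro Bochner_Integration.integral_cong refl)
        (simp add: distrib_right[symmetric] complex_add_cnj)
    also have "\<dots> = 0"
      using i[OF f, of t] i[OF ic, of t] char0[of t] cnj0[of t] by simp
    finally show ?thesis .
  qed
  have im: "(\<integral>\<omega>. of_real (Im (f \<omega>)) * iexp (t * Y \<omega>) \<partial>M) = 0" for t
  proof -
    have "(\<integral>\<omega>. of_real (Im (f \<omega>)) * iexp (t * Y \<omega>) \<partial>M)
      = (\<integral>\<omega>. (f \<omega> * iexp (t * Y \<omega>) - cnj (f \<omega>) * iexp (t * Y \<omega>)) / (2 * \<i>) \<partial>M)"
      by (intro Bochner_Integration.integral_cong refl)
        (simp add: left_diff_distrib[symmetric] complex_diff_cnj mult.commute)
    also have "\<dots> = 0"
      using i[OF f, of t] i[OF ic, of t] char0[of t] cnj0[of t] by simp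
    finally show ?thesis .
  qed
  show ?thesis
    unfolding annihilates_law_def
  proof
    fix A :: "real set" assume A[measurable]: "A \<in> sets borel"
    have [measurable]: "(\<lambda>\<omega>. indicator A (Y \<omega>) :: complex) \<in> borel_measurable M" by measurable
    show "(\<integral>\<omega>. f \<omega> * indicator A (Y \<omega>) \<partial>M) = 0"
      using real_weight_annihilates_law_if_char_zero[OF _ Y re A]
        real_weight_annihilates_law_if_char_zero[OF _ Y im A] f
      by (subst integral_complex_weight_split[where B = 1]) (auto simp: indicator_def)
  qed
qed

text \<open>A multivariate uniqueness theorem: if the weight \<open>f\<close> is orthogonal to all characters of the subvector
with coordinates in \<open>S\<close>, it annihilates the law of that subvector. Characters are replaced by
indicators one coordinate at a time, the remaining character being absorbed into the weight;
indicators of boxes then determine the image measures.\<close>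

lemma annihilates_law_coords_if_char_zero:
  fixes f :: "'a \<Rightarrow> complex" and X :: "'a \<Rightarrow> real ^ 'p::finite"
  assumes f: "integrable M f" and X[measurable]: "X \<in> borel_measurable M"
    and char0: "\<And>u. (\<forall>k\<in>-S. u $ k = 0) \<Longrightarrow> (\<integral>\<omega>. f \<omega> * iexp (u \<bullet> X \<omega>) \<partial>M) = 0"
  shows "annihilates_law M f (Pi\<^sub>M S (\<lambda>_. borel)) (\<lambda>\<omega>. coords S (X \<omega>))"
proof -
  let ?N = "Pi\<^sub>M S (\<lambda>_. borel) :: ('p \<Rightarrow> real) measure" and ?W = "\<lambda>\<omega>. coords S (X \<omega>)"
  have [measurable]: "f \<in> borel_measurable M" using f by auto
  have W[measurable]: "?W \<in> measurable M ?N" unfolding coords_def by measurable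
  have boxes: "(\<integral>\<omega>. (f \<omega> * (\<Prod>k\<in>I. indicator (B k) (X \<omega> $ k))) * iexp (u \<bullet> X \<omega>) \<partial>M) = 0"
    if "I \<subseteq> S" "\<And>k. k \<in> I \<Longrightarrow> B k \<in> sets borel" "\<forall>k\<in>-S. u $ k = 0" for I B u
  proof -
    have "finite I" by simp
    then show ?thesis using that
    proof (induction I arbitrary: u rule: finite_induct)
      case empty
      then show ?case using char0 by simp
    next
      case (insert k I)
      define f' where "f' \<omega> = (f \<omega> * (\<Prod>k\<in>I. indicator (B k) (X \<omega> $ k))) * iexp (u \<bullet> X \<omega>)" for \<omega>
      have [measurable]: "B l \<in> sets borel" if "l \<in> insert k I" for l using insert.prems that by auto
      have ind[measurable]: "(\<lambda>\<omega>. indicator (B l) (X \<omega> $ l) :: complex) \<in> borel_measurable M"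
        if "l \<in> insert k I" for l using that by measurable
      have f': "integrable M f'"
      proof -
        have "norm ((\<Prod>k\<in>I. indicator (B k) (X \<omega> $ k)) * iexp (u \<bullet> X \<omega>)) \<le> 1" for \<omega>
          by (auto simp: norm_mult prod_norm[symmetric] indicator_def intro!: prod_le_1)
        moreover have "(\<lambda>\<omega>. (\<Prod>k\<in>I. indicator (B k) (X \<omega> $ k)) * iexp (u \<bullet> X \<omega>)) \<in> borel_measurable M"
          by (intro borel_measurable_times borel_measurable_prod ind) auto
        ultimately show ?thesis
          unfolding f'_def mult.assoc by (intro integrable_mult_bounded[OF f]) auto
      qed
      have "annihilates_law M f' borel (\<lambda>\<omega>. X \<omega> $ k)"
      proof (rule annihilates_law_if_char_zero[OF f'])
        fix t
        have "(\<integral>\<omega>. f' \<omega> * iexp (t * X \<omega> $ k) \<partial>M)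
            = (\<integral>\<omega>. (f \<omega> * (\<Prod>k\<in>I. indicator (B k) (X \<omega> $ k))) * iexp ((u + t *\<^sub>R axis k 1) \<bullet> X \<omega>) \<partial>M)"
          by (intro Bochner_Integration.integral_cong refl)
            (simp add: f'_def inner_add_left exp_add distrib_left inner_axis' mult_ac)
        also have "\<dots> = 0"
          using insert.prems by (intro insert.IH) (auto simp: axis_def)
        finally show "(\<integral>\<omega>. f' \<omega> * iexp (t * X \<omega> $ k) \<partial>M) = 0" .
      qed simp
      then have "(\<integral>\<omega>. f' \<omega> * indicator (B k) (X \<omega> $ k) \<partial>M) = 0"
        using insert.prems by (simp add: annihilates_law_def)
      then show ?case
        using insert.hyps by (simp add: f'_def mult_ac)
    qed
  qed
  have box: "(\<integral>\<omega>. f \<omega> * indicator (Pi\<^sub>E S B) (?W \<omega>) \<partial>M) = 0"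
    if "\<And>k. k \<in> S \<Longrightarrow> B k \<in> sets borel" for B
  proof -
    have *: "indicator (Pi\<^sub>E S B) (?W \<omega>) = (\<Prod>k\<in>S. indicator (B k) (X \<omega> $ k) :: complex)" for \<omega>
      using finite[of S] by (auto simp: coords_def indicator_def PiE_iff)
    show ?thesis using boxes[of S B 0] that by (simp add: *)
  qed
  have eq: "distr (density M (\<lambda>\<omega>. ennreal (h \<omega>))) ?N ?W = distr (density M (\<lambda>\<omega>. ennreal (- h \<omega>))) ?N ?W"
    if h: "integrable M h"
      and z: "\<And>B. (\<And>k. k \<in> S \<Longrightarrow> B k \<in> sets borel) \<Longrightarrow> (\<integral>\<omega>. h \<omega> * indicator (Pi\<^sub>E S B) (?W \<omega>) \<partial>M) = 0"
    for h :: "'a \<Rightarrow> real"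
  proof (rule measure_eqI_PiM_finite)
    fix B :: "'p \<Rightarrow> real set" assume B: "\<And>k. k \<in> S \<Longrightarrow> B k \<in> sets borel"
    show "emeasure (distr (density M (\<lambda>\<omega>. ennreal (h \<omega>))) ?N ?W) (Pi\<^sub>E S B)
        = emeasure (distr (density M (\<lambda>\<omega>. ennreal (- h \<omega>))) ?N ?W) (Pi\<^sub>E S B)"
      using B by (intro emeasure_weight_parts_eq_if_integral_zero h W z sets_PiM_I_finite) auto
  next
    show "range (\<lambda>_::nat. Pi\<^sub>E S (\<lambda>_. UNIV)) \<subseteq> prod_algebra S (\<lambda>_. borel :: real measure)"
      by (auto intro!: prod_algebraI_finite)
    show "(\<Union>i::nat. Pi\<^sub>E S (\<lambda>_. UNIV)) = space ?N" by (simp add: space_PiM)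
    fix i :: nat
    have [measurable]: "h \<in> borel_measurable M" using h by auto
    have "emeasure (distr (density M (\<lambda>\<omega>. ennreal (h \<omega>))) ?N ?W) (Pi\<^sub>E S (\<lambda>_. UNIV))
        \<le> emeasure (distr (density M (\<lambda>\<omega>. ennreal (h \<omega>))) ?N ?W) (space ?N)"
      by (simp add: space_PiM)
    also have "\<dots> = (\<integral>\<^sup>+\<omega>. ennreal (h \<omega>) \<partial>M)"
      using measurable_space[OF W]
      by (subst emeasure_distr) (auto simp: emeasure_density intro!: nn_integral_cong split: split_indicator)
    also have "\<dots> < \<infinity>" using h real_integrable_def by (auto simp: top.not_eq_extremum)
    finally show "emeasure (distr (density M (\<lambda>\<omega>. ennreal (h \<omega>))) ?N ?W) (Pi\<^sub>E S (\<lambda>_. UNIV)) \<noteq> \<infinity>"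
      by simp
  qed auto
  have parts: "(\<integral>\<omega>. Re (f \<omega>) * indicator (Pi\<^sub>E S B) (?W \<omega>) \<partial>M) = 0"
    "(\<integral>\<omega>. Im (f \<omega>) * indicator (Pi\<^sub>E S B) (?W \<omega>) \<partial>M) = 0"
    if B: "\<And>k. k \<in> S \<Longrightarrow> B k \<in> sets borel" for B
  proof -
    have m: "Pi\<^sub>E S B \<in> sets ?N" using B by (intro sets_PiM_I_finite) auto
    show "(\<integral>\<omega>. Re (f \<omega>) * indicator (Pi\<^sub>E S B) (?W \<omega>) \<partial>M) = 0"
      "(\<integral>\<omega>. Im (f \<omega>) * indicator (Pi\<^sub>E S B) (?W \<omega>) \<partial>M) = 0"
      using indicator_integral_parts_zero[OF f W m box[OF B]] by auto
  qed
  show ?thesis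
    unfolding annihilates_law_def
  proof
    fix A assume A: "A \<in> sets ?N"
    have r: "(\<integral>\<omega>. of_real (h \<omega>) * indicator A (?W \<omega>) \<partial>M) = (0::complex)"
      if h: "integrable M h"
        and z: "\<And>B. (\<And>k. k \<in> S \<Longrightarrow> B k \<in> sets borel) \<Longrightarrow> (\<integral>\<omega>. h \<omega> * indicator (Pi\<^sub>E S B) (?W \<omega>) \<partial>M) = 0"
      for h :: "'a \<Rightarrow> real"
      using integral_weight_distr_density[OF h W, of "indicator A" 1] A eq[OF h z]
      by (simp add: indicator_def)
    have ind: "(\<lambda>\<omega>. indicator A (?W \<omega>) :: complex) \<in> borel_measurable M"
      using A by measurable
    have "norm (indicator A (?W \<omega>) :: complex) \<le> 1" for \<omega> by (simp add: indicator_def)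
    from integral_complex_weight_split[OF f ind this]
    show "(\<integral>\<omega>. f \<omega> * indicator A (?W \<omega>) \<partial>M) = 0"
      using r[of "\<lambda>\<omega>. Re (f \<omega>)"] r[of "\<lambda>\<omega>. Im (f \<omega>)"] parts f by simp
  qed
qed

section \<open>Normal laws and Gaussian vectors\<close>

text \<open>This representation covers all \<open>\<sigma>\<close>, including \<open>\<sigma> = 0\<close> and negative values, and transfers moments and
characteristic functions from the standard normal law.\<close>

lemma normal_law_eq_distr:
  "normal_law \<mu> \<sigma> = distr std_normal_distribution borel (\<lambda>z. \<mu> + \<sigma> * z)"
proof (cases "\<sigma> = 0")
  case True
  interpret prob_space std_normal_distribution by (rule prob_space_normal_density) simp
  show ?thesis using True
    by (intro measure_eqI) (auto simp: normal_law_def emeasure_distr indicator_def emeasure_space_1[simplified])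
next
  case False
  interpret prob_space std_normal_distribution by (rule prob_space_normal_density) simp
  have "distributed std_normal_distribution lborel (\<lambda>x. x) (normal_density 0 1)"
    by (auto simp: distributed_def intro!: measure_eqI simp: emeasure_distr)
  from normal_density_affine[OF this, of \<sigma> \<mu>] False
  have "distr std_normal_distribution lborel (\<lambda>z. \<mu> + \<sigma> * z) = density lborel (normal_density \<mu> \<bar>\<sigma>\<bar>)"
    by (simp add: distributed_def)
  moreover have "normal_density \<mu> \<bar>\<sigma>\<bar> = normal_density \<mu> \<sigma>"
    by (simp add: normal_density_def fun_eq_iff)
  ultimately show ?thesis using False
    by (simp add: normal_law_def cong: distr_cong)
qed

lemma normal_law_abs: "normal_law \<mu> \<bar>\<sigma>\<bar> = normal_law \<mu> \<sigma>"
  by (simp add: normal_law_def normal_density_def)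

lemma integrable_normal_law_power: "integrable (normal_law \<mu> \<sigma>) (\<lambda>z. z ^ k)"
proof -
  have "integrable std_normal_distribution (\<lambda>z. \<Sum>i\<le>k. of_nat (k choose i) * \<mu> ^ i * (\<sigma> ^ (k - i) * z ^ (k - i)))"
    by (intro Bochner_Integration.integrable_sum integrable_mult_right integrable_std_normal_distribution_moment)
  moreover have binom: "(\<mu> + \<sigma> * z) ^ k = (\<Sum>i\<le>k. of_nat (k choose i) * \<mu> ^ i * (\<sigma> ^ (k - i) * z ^ (k - i)))" for z
    by (subst binomial_ring) (simp only: power_mult_distrib)
  ultimately show ?thesis
    unfolding normal_law_eq_distr
    by (subst integrable_distr_eq) (auto simp: binom)
qed

lemma normal_law_mean_variance:
  "(\<integral>z. z \<partial>normal_law \<mu> \<sigma>) = \<mu>" "(\<integral>z. (z - \<mu>)\<^sup>2 \<partial>normal_law \<mu> \<sigma>) = \<sigma>\<^sup>2"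
proof -
  interpret prob_space std_normal_distribution by (rule prob_space_normal_density) simp
  have i: "integrable std_normal_distribution (\<lambda>z. z)"
    using integrable_std_normal_distribution_moment[of 1] by simp
  have m1: "(\<integral>z. z \<partial>std_normal_distribution) = 0"
    using integral_std_normal_distribution_moment_odd[of 1] by simp
  have "(\<integral>z. z \<partial>normal_law \<mu> \<sigma>) = (\<integral>z. \<mu> + \<sigma> * z \<partial>std_normal_distribution)"
    unfolding normal_law_eq_distr by (rule integral_distr) auto
  also have "\<dots> = \<mu> + \<sigma> * (\<integral>z. z \<partial>std_normal_distribution)"
    using i prob_space by (subst Bochner_Integration.integral_add) simp_all
  finally show "(\<integral>z. z \<partial>normal_law \<mu> \<sigma>) = \<mu>" by (simp only: m1)
  have m2: "(\<integral>z. z\<^sup>2 \<partial>std_normal_distribution) = 1"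
    using std_normal_distribution_even_moments(1)[of 1] by simp
  have "(\<integral>z. (z - \<mu>)\<^sup>2 \<partial>normal_law \<mu> \<sigma>) = (\<integral>z. (\<mu> + \<sigma> * z - \<mu>)\<^sup>2 \<partial>std_normal_distribution)"
    unfolding normal_law_eq_distr by (rule integral_distr) auto
  also have "\<dots> = (\<integral>z. \<sigma>\<^sup>2 * z\<^sup>2 \<partial>std_normal_distribution)"
    by (simp add: power_mult_distrib)
  also have "\<dots> = \<sigma>\<^sup>2 * (\<integral>z. z\<^sup>2 \<partial>std_normal_distribution)"
    by (rule integral_mult_right_zero)
  finally show "(\<integral>z. (z - \<mu>)\<^sup>2 \<partial>normal_law \<mu> \<sigma>) = \<sigma>\<^sup>2" by (simp only: m2)
qed

lemma char_normal_law:
  "char (normal_law \<mu> \<sigma>) t = iexp (t * \<mu>) * of_real (exp (- (t * \<sigma>)\<^sup>2 / 2))"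
proof -
  have "char (normal_law \<mu> \<sigma>) t = (\<integral>z. iexp (t * \<mu>) * iexp (t * \<sigma> * z) \<partial>std_normal_distribution)"
    unfolding normal_law_eq_distr char_def
    by (subst integral_distr) (auto simp: exp_add[symmetric] algebra_simps)
  also have "\<dots> = iexp (t * \<mu>) * char std_normal_distribution (t * \<sigma>)"
    by (simp add: char_def)
  finally show ?thesis by (simp add: char_std_normal_distribution)
qed

lemma sets_normal_law [simp]: "sets (normal_law \<mu> \<sigma>) = sets borel"
  by (simp add: normal_law_eq_distr)

lemma normal_law_reflect: "distr (normal_law 0 \<sigma>) borel uminus = normal_law 0 \<sigma>"
proof -
  have "distr (normal_law 0 \<sigma>) borel uminus = normal_law 0 (- \<sigma>)"
    unfolding normal_law_eq_distr by (subst distr_distr) (auto simp: comp_def)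
  also have "\<dots> = normal_law 0 \<sigma>"
    by (simp add: normal_law_def normal_density_def)
  finally show ?thesis .
qed

text \<open>A random covariate vector with nondegenerate Gaussian law.\<close>

locale gaussian_design = prob_space M for M :: "'a measure" +
  fixes X :: "'a \<Rightarrow> real ^ 'p::finite"
  assumes gauss: "gaussian_vector M X"
    and nondegenerate: "invertible (covariance_matrix M X)"
begin

abbreviation mean :: "real ^ 'p" where "mean \<equiv> \<chi> k. expectation (\<lambda>\<omega>. X \<omega> $ k)"

abbreviation cov :: "real ^ 'p ^ 'p" where "cov \<equiv> covariance_matrix M X"

lemma measurable_design [measurable]: "X \<in> borel_measurable M"
  using gauss by (simp add: gaussian_vector_def)

lemma integrable_inner_power: "integrable M (\<lambda>\<omega>. (u \<bullet> X \<omega>) ^ k)"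
proof -
  obtain \<mu> \<sigma> where "distr M borel (\<lambda>\<omega>. u \<bullet> X \<omega>) = normal_law \<mu> \<sigma>"
    using gauss unfolding gaussian_vector_def by blast
  then have "integrable (distr M borel (\<lambda>\<omega>. u \<bullet> X \<omega>)) (\<lambda>z. z ^ k)"
    by (simp add: integrable_normal_law_power)
  then show ?thesis by (simp add: integrable_distr_eq)
qed

lemma integrable_component_power: "integrable M (\<lambda>\<omega>. (X \<omega> $ l) ^ k)"
  using integrable_inner_power[of "axis l 1" k] by (simp add: inner_axis')

lemma integrable_component: "integrable M (\<lambda>\<omega>. X \<omega> $ l)"
  using integrable_component_power[of l 1] by simp

lemma integrable_centered_mult: "integrable M (\<lambda>\<omega>. (X \<omega> $ k - a) * (X \<omega> $ l - b))"
proof (rule Bochner_Integration.integrable_bound)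
  have [simp]: "integrable M (\<lambda>\<omega>. (X \<omega> $ k - a)\<^sup>2)" for k a
    unfolding power2_diff using integrable_component_power[of k 2] integrable_component[of k] by simp
  show "integrable M (\<lambda>\<omega>. (X \<omega> $ k - a)\<^sup>2 + (X \<omega> $ l - b)\<^sup>2)" by simp
  have "\<bar>x * y\<bar> \<le> x\<^sup>2 + y\<^sup>2" for x y :: real
  proof -
    have "2 * (\<bar>x\<bar> * \<bar>y\<bar>) \<le> x\<^sup>2 + y\<^sup>2" using sum_squares_bound[of "\<bar>x\<bar>" "\<bar>y\<bar>"] by simp
    moreover have "0 \<le> \<bar>x\<bar> * \<bar>y\<bar>" by simp
    ultimately show ?thesis unfolding abs_mult by linarith
  qed
  then show "AE \<omega> in M. norm ((X \<omega> $ k - a) * (X \<omega> $ l - b)) \<le> norm ((X \<omega> $ k - a)\<^sup>2 + (X \<omega> $ l - b)\<^sup>2)"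
    by simp
qed simp

lemma inner_centered: "u \<bullet> X \<omega> - u \<bullet> mean = (\<Sum>k\<in>UNIV. u $ k * (X \<omega> $ k - mean $ k))"
  by (simp add: inner_vec_def sum_subtractf right_diff_distrib)

lemma expectation_inner: "expectation (\<lambda>\<omega>. u \<bullet> X \<omega>) = u \<bullet> mean"
  using integrable_component by (simp add: inner_vec_def)

lemma covariance_component_inner:
  "expectation (\<lambda>\<omega>. (X \<omega> $ l - mean $ l) * (u \<bullet> X \<omega> - u \<bullet> mean)) = (cov *v u) $ l"
proof -
  have "expectation (\<lambda>\<omega>. (X \<omega> $ l - mean $ l) * (u \<bullet> X \<omega> - u \<bullet> mean))
    = expectation (\<lambda>\<omega>. \<Sum>k\<in>UNIV. u $ k * ((X \<omega> $ l - mean $ l) * (X \<omega> $ k - mean $ k)))"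
    unfolding inner_centered by (simp add: sum_distrib_left mult_ac)
  also have "\<dots> = (\<Sum>k\<in>UNIV. u $ k * cov $ l $ k)"
    using integrable_centered_mult by (simp add: covariance_matrix_def)
  finally show ?thesis by (simp add: matrix_vector_mult_def mult_ac)
qed

lemma integrable_centered_inner_mult:
  "integrable M (\<lambda>\<omega>. (X \<omega> $ l - mean $ l) * (u \<bullet> X \<omega> - u \<bullet> mean))"
  unfolding inner_centered sum_distrib_left
  using integrable_centered_mult
  by (intro Bochner_Integration.integrable_sum) (simp add: mult.left_commute)

lemma covariance_inner:
  "expectation (\<lambda>\<omega>. (w \<bullet> X \<omega> - w \<bullet> mean) * (u \<bullet> X \<omega> - u \<bullet> mean)) = w \<bullet> (cov *v u)"
proof -
  have "expectation (\<lambda>\<omega>. (w \<bullet> X \<omega> - w \<bullet> mean) * (u \<bullet> X \<omega> - u \<bullet> mean))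
    = expectation (\<lambda>\<omega>. \<Sum>l\<in>UNIV. w $ l * ((X \<omega> $ l - mean $ l) * (u \<bullet> X \<omega> - u \<bullet> mean)))"
    by (simp add: inner_centered[of w] sum_distrib_right mult.assoc)
  also have "\<dots> = (\<Sum>l\<in>UNIV. w $ l * (cov *v u) $ l)"
    using integrable_centered_inner_mult[of _ u] covariance_component_inner[of _ u] by simp
  finally show ?thesis by (simp add: inner_vec_def)
qed

lemma cov_symmetric: "w \<bullet> (cov *v u) = u \<bullet> (cov *v w)"
  unfolding covariance_inner[symmetric] by (simp add: mult.commute)

text \<open>If the quadratic form vanished at \<open>u\<close>, the projection \<open>u \<bullet> X\<close> would be almost surely constant, hence
uncorrelated with every coordinate, and \<open>u\<close> would lie in the kernel of the covariance matrix.\<close>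

lemma cov_pos:
  assumes "u \<noteq> 0" shows "0 < u \<bullet> (cov *v u)"
proof -
  have nn: "0 \<le> u \<bullet> (cov *v u)"
    unfolding covariance_inner[symmetric] by simp
  have "u \<bullet> (cov *v u) \<noteq> 0"
  proof
    assume 0: "u \<bullet> (cov *v u) = 0"
    have i: "integrable M (\<lambda>\<omega>. (u \<bullet> X \<omega> - u \<bullet> mean)\<^sup>2)"
      unfolding power2_diff using integrable_inner_power[of u 2] integrable_inner_power[of u 1] by simp
    have "AE \<omega> in M. (u \<bullet> X \<omega> - u \<bullet> mean)\<^sup>2 = 0"
      using 0 integral_nonneg_eq_0_iff_AE[OF i] covariance_inner[of u u] by (simp add: power2_eq_square)
    then have ae: "AE \<omega> in M. u \<bullet> X \<omega> - u \<bullet> mean = 0" by simp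
    have "(cov *v u) $ l = 0" for l
    proof -
      have "(cov *v u) $ l = expectation (\<lambda>\<omega>. 0)"
        unfolding covariance_component_inner[symmetric]
        using ae by (intro integral_cong_AE) auto
      then show ?thesis by simp
    qed
    then have "cov *v u = 0" by (simp add: vec_eq_iff)
    moreover have "\<exists>B. B ** cov = mat 1" using nondegenerate by (auto simp: invertible_def)
    ultimately have "u = 0" by (simp add: matrix_left_invertible_ker)
    with assms show False by simp
  qed
  with nn show ?thesis by simp
qed

lemma distr_inner: "distr M borel (\<lambda>\<omega>. u \<bullet> X \<omega>) = normal_law (u \<bullet> mean) (sqrt (u \<bullet> (cov *v u)))"
proof -
  obtain \<mu> \<sigma> where d: "distr M borel (\<lambda>\<omega>. u \<bullet> X \<omega>) = normal_law \<mu> \<sigma>"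
    using gauss unfolding gaussian_vector_def by blast
  have "(\<integral>z. z \<partial>distr M borel (\<lambda>\<omega>. u \<bullet> X \<omega>)) = u \<bullet> mean"
    by (simp add: integral_distr expectation_inner)
  then have mu: "\<mu> = u \<bullet> mean" by (simp add: d normal_law_mean_variance)
  have "(\<integral>z. (z - \<mu>)\<^sup>2 \<partial>distr M borel (\<lambda>\<omega>. u \<bullet> X \<omega>)) = u \<bullet> (cov *v u)"
    by (simp add: integral_distr mu covariance_inner[symmetric] power2_eq_square)
  then have "\<sigma>\<^sup>2 = u \<bullet> (cov *v u)" by (simp add: d normal_law_mean_variance)
  then have "sqrt (u \<bullet> (cov *v u)) = \<bar>\<sigma>\<bar>" by (metis real_sqrt_abs)
  then show ?thesis using d mu by (simp add: normal_law_abs)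
qed

lemma expectation_iexp_inner:
  "expectation (\<lambda>\<omega>. iexp (u \<bullet> X \<omega>)) = iexp (u \<bullet> mean) * of_real (exp (- (u \<bullet> (cov *v u)) / 2))"
proof -
  have "0 \<le> u \<bullet> (cov *v u)" using cov_pos[of u] by (cases "u = 0") simp_all
  then show ?thesis
    using char_normal_law[of "u \<bullet> mean" "sqrt (u \<bullet> (cov *v u))" 1]
    unfolding distr_inner[symmetric] char_def by (simp add: integral_distr)
qed

end

section \<open>Conditional independence and the vanishing coefficient\<close>

lemma (in prob_space) finite_measure_subalgebra_vimage:
  assumes "W \<in> measurable M N"
  shows "finite_measure_subalgebra M (vimage_algebra (space M) W N)"
proof (unfold_locales)
  show "subalgebra M (vimage_algebra (space M) W N)"
    using assms measurable_space[OF assms]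
    by (auto simp: subalgebra_def sets_vimage_algebra2 measurable_sets)
qed

text \<open>An annihilated weight is orthogonal to every integrable \<open>G\<close> measurable with respect to \<open>W\<close>.\<close>

lemma (in prob_space) integral_mult_annihilated_weight:
  fixes f :: "'a \<Rightarrow> complex" and G :: "'a \<Rightarrow> real"
  assumes f: "integrable M f" and W: "W \<in> measurable M N" and an: "annihilates_law M f N W"
    and G: "G \<in> borel_measurable (vimage_algebra (space M) W N)" and iG: "integrable M G"
    and B: "\<And>\<omega>. norm (f \<omega>) \<le> B"
  shows "(\<integral>\<omega>. f \<omega> * of_real (G \<omega>) \<partial>M) = 0"
proof -
  let ?F = "vimage_algebra (space M) W N"
  interpret F: finite_measure_subalgebra M ?F by (rule finite_measure_subalgebra_vimage[OF W])
  have [measurable]: "f \<in> borel_measurable M" using f by auto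
  have r: "integrable M (\<lambda>\<omega>. G \<omega> * h \<omega>) \<and> (\<integral>\<omega>. G \<omega> * h \<omega> \<partial>M) = 0"
    if h: "integrable M h" and hB: "\<And>\<omega>. \<bar>h \<omega>\<bar> \<le> B"
      and z: "\<And>A. A \<in> sets N \<Longrightarrow> (\<integral>\<omega>. h \<omega> * indicator A (W \<omega>) \<partial>M) = 0" for h :: "'a \<Rightarrow> real"
  proof -
    have [measurable]: "h \<in> borel_measurable M" using h by auto
    have i: "integrable M (\<lambda>\<omega>. G \<omega> * h \<omega>)"
    proof (rule Bochner_Integration.integrable_bound[where f = "\<lambda>\<omega>. B * G \<omega>"])
      show "AE \<omega> in M. norm (G \<omega> * h \<omega>) \<le> norm (B * G \<omega>)"
      proof (intro AE_I2)
        fix \<omega> 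
        have "\<bar>G \<omega>\<bar> * \<bar>h \<omega>\<bar> \<le> \<bar>G \<omega>\<bar> * \<bar>B\<bar>" using hB[of \<omega>] by (intro mult_left_mono) auto
        then show "norm (G \<omega> * h \<omega>) \<le> norm (B * G \<omega>)" by (simp add: abs_mult mult.commute)
      qed
    qed (use iG borel_measurable_integrable[OF iG] in auto)
    have "AE \<omega> in M. real_cond_exp M ?F h \<omega> = 0"
    proof (rule F.real_cond_exp_charact)
      fix A assume "A \<in> sets ?F"
      then obtain C where C: "C \<in> sets N" "A = W -` C \<inter> space M"
        using measurable_space[OF W] by (auto simp: sets_vimage_algebra2)
      have "(\<integral>\<omega>\<in>A. h \<omega> \<partial>M) = (\<integral>\<omega>. h \<omega> * indicator C (W \<omega>) \<partial>M)"
        unfolding set_lebesgue_integral_def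
        by (intro Bochner_Integration.integral_cong) (auto simp: C indicator_def)
      then show "(\<integral>\<omega>\<in>A. h \<omega> \<partial>M) = (\<integral>\<omega>\<in>A. 0 \<partial>M)" using z[OF C(1)] by simp
    qed (use h in auto)
    then have "(\<integral>\<omega>. G \<omega> * real_cond_exp M ?F h \<omega> \<partial>M) = (\<integral>\<omega>. 0 \<partial>M)"
      using borel_measurable_integrable[OF iG] by (intro integral_cong_AE) auto
    then show ?thesis using F.real_cond_exp_intg(2)[OF i G] i by simp
  qed
  have z: "(\<integral>\<omega>. Re (f \<omega>) * indicator A (W \<omega>) \<partial>M) = 0"
      "(\<integral>\<omega>. Im (f \<omega>) * indicator A (W \<omega>) \<partial>M) = 0" if "A \<in> sets N" for A
    using indicator_integral_parts_zero[OF f W that] an that by (auto simp: annihilates_law_def)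
  have B': "\<bar>Re (f \<omega>)\<bar> \<le> B" "\<bar>Im (f \<omega>)\<bar> \<le> B" for \<omega>
    using B[of \<omega>] abs_Re_le_cmod[of "f \<omega>"] abs_Im_le_cmod[of "f \<omega>"] by linarith+
  have re: "integrable M (\<lambda>\<omega>. G \<omega> * Re (f \<omega>)) \<and> (\<integral>\<omega>. G \<omega> * Re (f \<omega>) \<partial>M) = 0"
    using f by (intro r B' z) auto
  have im: "integrable M (\<lambda>\<omega>. G \<omega> * Im (f \<omega>)) \<and> (\<integral>\<omega>. G \<omega> * Im (f \<omega>) \<partial>M) = 0"
    using f by (intro r B' z) auto
  have "(\<integral>\<omega>. f \<omega> * of_real (G \<omega>) \<partial>M)
      = (\<integral>\<omega>. of_real (G \<omega> * Re (f \<omega>)) + \<i> * of_real (G \<omega> * Im (f \<omega>)) \<partial>M)"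
    by (intro Bochner_Integration.integral_cong refl, subst (1) complex_eq) (simp add: algebra_simps)
  also have "\<dots> = of_real (\<integral>\<omega>. G \<omega> * Re (f \<omega>) \<partial>M) + \<i> * of_real (\<integral>\<omega>. G \<omega> * Im (f \<omega>) \<partial>M)"
  proof -
    have "integrable M (\<lambda>\<omega>. complex_of_real (G \<omega> * Re (f \<omega>)))" 
      "integrable M (\<lambda>\<omega>. complex_of_real (G \<omega> * Im (f \<omega>)))"
      using re im by (auto intro!: integrable_of_real simp del: of_real_mult)
    then show ?thesis by (simp del: of_real_mult)
  qed
  finally show ?thesis using re im by simp
qed

text \<open>Given \<open>W\<close>, the residual of the indicator of \<open>V \<in> B\<close> after subtracting its conditional expectation is
orthogonal to all indicators of \<open>U\<close>.\<close>

lemma (in prob_space) cond_indep_residual: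
  fixes h :: "'a \<Rightarrow> real"
  assumes ci: "cond_indep M U V N W"
    and h: "h \<in> borel_measurable (vimage_algebra (space M) W N)" and hC: "\<And>\<omega>. \<bar>h \<omega>\<bar> \<le> C"
    and A[measurable]: "A \<in> sets borel" and B[measurable]: "B \<in> sets borel"
  defines "G \<equiv> real_cond_exp M (vimage_algebra (space M) W N) (\<lambda>\<omega>. indicator B (V \<omega>))"
  shows "(\<integral>\<omega>. h \<omega> * (indicator B (V \<omega>) - G \<omega>) * indicator A (U \<omega>) \<partial>M) = 0"
    and "integrable M G" and "integrable M (\<lambda>\<omega>. h \<omega> * (indicator B (V \<omega>) - G \<omega>))"
proof -
  let ?F = "vimage_algebra (space M) W N"
  have UV[measurable]: "U \<in> borel_measurable M" "V \<in> borel_measurable M" and W: "W \<in> measurable M N"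
    using ci by (auto simp: cond_indep_def)
  interpret F: finite_measure_subalgebra M ?F by (rule finite_measure_subalgebra_vimage[OF W])
  have [measurable]: "h \<in> borel_measurable M" by (rule measurable_from_subalg[OF F.subalg h])
  have GF: "G \<in> borel_measurable ?F" by (simp add: G_def)
  have [measurable]: "G \<in> borel_measurable M" by (rule measurable_from_subalg[OF F.subalg GF])
  have iG: "integrable M G"
    unfolding G_def by (intro F.real_cond_exp_int integrable_const_bound[where B = 1]) (auto simp: indicator_def)
  then show "integrable M G" .
  have bdd: "integrable M (\<lambda>\<omega>. h \<omega> * g \<omega>)" if g: "integrable M g" for g
  proof (rule Bochner_Integration.integrable_bound[where f = "\<lambda>\<omega>. C * g \<omega>"])
    show "AE \<omega> in M. norm (h \<omega> * g \<omega>) \<le> norm (C * g \<omega>)"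
    proof (intro AE_I2)
      fix \<omega> 
      have "\<bar>h \<omega>\<bar> * \<bar>g \<omega>\<bar> \<le> \<bar>C\<bar> * \<bar>g \<omega>\<bar>" using hC[of \<omega>] by (intro mult_right_mono) auto
      then show "norm (h \<omega> * g \<omega>) \<le> norm (C * g \<omega>)" by (simp add: abs_mult)
    qed
  qed (use g borel_measurable_integrable[OF g] in auto)
  have i1: "integrable M (\<lambda>\<omega>. indicator B (V \<omega>) :: real)"
    by (intro integrable_const_bound[where B = 1]) (auto simp: indicator_def)
  have i2: "integrable M (\<lambda>\<omega>. indicator A (U \<omega>) * indicator B (V \<omega>) :: real)"
    by (intro integrable_const_bound[where B = 1]) (auto simp: indicator_def)
  have i3: "integrable M (\<lambda>\<omega>. indicator A (U \<omega>) * G \<omega>)"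
    by (rule Bochner_Integration.integrable_bound[OF iG]) (auto simp: indicator_def)
  show "integrable M (\<lambda>\<omega>. h \<omega> * (indicator B (V \<omega>) - G \<omega>))"
    by (intro bdd Bochner_Integration.integrable_diff i1 iG)
  have i4: "integrable M (\<lambda>\<omega>. (h \<omega> * G \<omega>) * indicator A (U \<omega>))"
    using bdd[OF i3] by (simp add: mult_ac)
  have ae: "AE \<omega> in M. real_cond_exp M ?F (\<lambda>\<omega>. indicator A (U \<omega>) * indicator B (V \<omega>)) \<omega>
      = real_cond_exp M ?F (\<lambda>\<omega>. indicator A (U \<omega>)) \<omega> * G \<omega>"
    using ci A B by (auto simp: cond_indep_def Let_def G_def)
  have mm: "real_cond_exp M ?F f \<in> borel_measurable M" for f
    by (rule measurable_from_subalg[OF F.subalg]) simp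
  note [measurable] = mm
  have hG: "(\<lambda>\<omega>. h \<omega> * G \<omega>) \<in> borel_measurable ?F" using h GF by measurable
  have "(\<integral>\<omega>. h \<omega> * (indicator A (U \<omega>) * indicator B (V \<omega>)) \<partial>M)
      = (\<integral>\<omega>. h \<omega> * real_cond_exp M ?F (\<lambda>\<omega>. indicator A (U \<omega>) * indicator B (V \<omega>)) \<omega> \<partial>M)"
    using F.real_cond_exp_intg(2)[OF bdd[OF i2] h] by simp
  also have "\<dots> = (\<integral>\<omega>. (h \<omega> * G \<omega>) * real_cond_exp M ?F (\<lambda>\<omega>. indicator A (U \<omega>)) \<omega> \<partial>M)"
    using ae by (intro integral_cong_AE) (auto simp: mult_ac)
  also have "\<dots> = (\<integral>\<omega>. (h \<omega> * G \<omega>) * indicator A (U \<omega>) \<partial>M)"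
    using F.real_cond_exp_intg(2)[OF i4 hG] by simp
  finally have e: "(\<integral>\<omega>. h \<omega> * (indicator A (U \<omega>) * indicator B (V \<omega>)) \<partial>M)
    = (\<integral>\<omega>. (h \<omega> * G \<omega>) * indicator A (U \<omega>) \<partial>M)" .
  have "(\<integral>\<omega>. h \<omega> * (indicator B (V \<omega>) - G \<omega>) * indicator A (U \<omega>) \<partial>M)
     = (\<integral>\<omega>. h \<omega> * (indicator A (U \<omega>) * indicator B (V \<omega>)) - (h \<omega> * G \<omega>) * indicator A (U \<omega>) \<partial>M)"
    by (simp add: algebra_simps)
  also have "\<dots> = 0" using bdd[OF i2] i4 e by simp
  finally show "(\<integral>\<omega>. h \<omega> * (indicator B (V \<omega>) - G \<omega>) * indicator A (U \<omega>) \<partial>M) = 0" .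
qed

lemma (in prob_space) indep_borel_indep_var:
  assumes ind: "indep_borel M U V" and f: "f \<in> borel_measurable borel" and g: "g \<in> borel_measurable borel"
  shows "indep_var borel (\<lambda>\<omega>. f (U \<omega>)) borel (\<lambda>\<omega>. g (V \<omega>))"
proof -
  have [measurable]: "U \<in> borel_measurable M" "V \<in> borel_measurable M" using ind by (auto simp: indep_borel_def)
  note [measurable] = f g
  have "indep_set {(\<lambda>\<omega>. f (U \<omega>)) -` A \<inter> space M | A. A \<in> sets borel}
    {(\<lambda>\<omega>. g (V \<omega>)) -` A \<inter> space M | A. A \<in> sets borel}"
  proof (rule indep_setI)
    have iD: "prob ((U -` A \<inter> space M) \<inter> (V -` B \<inter> space M)) = prob (U -` A \<inter> space M) * prob (V -` B \<inter> space M)"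
      if "A \<in> sets borel" "B \<in> sets borel" for A B
      using ind that by (intro indep_setD) (auto simp: indep_borel_def)
    fix a b assume "a \<in> {(\<lambda>\<omega>. f (U \<omega>)) -` A \<inter> space M | A. A \<in> sets borel}"
      "b \<in> {(\<lambda>\<omega>. g (V \<omega>)) -` A \<inter> space M | A. A \<in> sets borel}"
    then obtain A B where AB: "A \<in> sets borel" "B \<in> sets borel"
      and ab: "a = U -` (f -` A) \<inter> space M" "b = V -` (g -` B) \<inter> space M" by auto
    have "f -` A \<in> sets borel" "g -` B \<in> sets borel"
      using measurable_sets_borel[OF f AB(1)] measurable_sets_borel[OF g AB(2)] by auto
    then show "prob (a \<inter> b) = prob a * prob b" unfolding ab by (rule iD)
  qed (auto intro!: measurable_sets[where A = borel])
  moreover have "Int_stable {Y -` A \<inter> space M | A. A \<in> sets N}" for Y :: "'a \<Rightarrow> 'd" and N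
  proof (rule Int_stableI)
    fix a b assume "a \<in> {Y -` A \<inter> space M | A. A \<in> sets N}" "b \<in> {Y -` A \<inter> space M | A. A \<in> sets N}"
    then obtain A B where "A \<in> sets N" "B \<in> sets N" "a = Y -` A \<inter> space M" "b = Y -` B \<inter> space M" by auto
    then have "A \<inter> B \<in> sets N" "a \<inter> b = Y -` (A \<inter> B) \<inter> space M" by auto
    then show "a \<inter> b \<in> {Y -` A \<inter> space M | A. A \<in> sets N}" by blast
  qed
  ultimately show ?thesis
    unfolding indep_var_eq by (intro conjI indep_set_sigma_sets) measurable
qed

lemma iexp_add: "iexp (a + b) = iexp a * iexp b"
  by (simp add: exp_add distrib_left)

context gaussian_design
begin

text \<open>Conditional independence of the \<open>j\<close>-th covariate and the response, given the other covariates, forces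
the \<open>j\<close>-th coefficient to vanish. The case \<open>\<sigma> = 0\<close> is included: all that matters
about the law of the noise is \<open>E exp (i \<epsilon>) \<noteq> 0\<close>.\<close>

lemma coefficient_zero_if_cond_indep:
  assumes eps[measurable]: "\<epsilon> \<in> borel_measurable M" and law: "distr M borel \<epsilon> = normal_law 0 \<sigma>"
    and ind: "indep_borel M X \<epsilon>"
    and ci: "cond_indep M (\<lambda>\<omega>. X \<omega> $ j) (\<lambda>\<omega>. X \<omega> \<bullet> \<beta> + \<epsilon> \<omega>)
      (Pi\<^sub>M (- {j}) (\<lambda>_. borel)) (\<lambda>\<omega>. coords (- {j}) (X \<omega>))"
  shows "\<beta> $ j = 0"
proof -
  let ?N = "Pi\<^sub>M (- {j}) (\<lambda>_. borel) :: ('p \<Rightarrow> real) measure" and ?W = "\<lambda>\<omega>. coords (- {j}) (X \<omega>)"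
  let ?V = "\<lambda>\<omega>. X \<omega> \<bullet> \<beta> + \<epsilon> \<omega>"
  let ?F = "vimage_algebra (space M) ?W ?N"
  have W[measurable]: "?W \<in> measurable M ?N" unfolding coords_def by measurable
  obtain B where B: "cov ** B = mat 1" using nondegenerate by (auto simp: invertible_def)
  \<comment> \<open>\<open>v\<close> is the \<open>j\<close>-th column of the inverse covariance matrix: the covariance of \<open>v \<bullet> X\<close> and \<open>u \<bullet> X\<close> is \<open>u $ j\<close>.\<close>
  define v where "v = B *v axis j 1"
  have cv: "cov *v v = axis j 1"
    by (simp add: v_def matrix_vector_mul_assoc B)
  have uv: "u \<bullet> (cov *v v) = u $ j" for u by (simp add: cv inner_axis)
  have vu: "v \<bullet> (cov *v u) = u $ j" for u using cov_symmetric[of v u] by (simp add: uv)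
  have "v \<noteq> 0" using cv by (auto simp: axis_eq_0_iff)
  then have vj: "v $ j > 0" using cov_pos[of v] by (simp add: uv)
  define \<phi> where "\<phi> t = expectation (\<lambda>\<omega>. iexp (t * (v \<bullet> X \<omega>)))" for t
  define f where "f t \<omega> = iexp (t * (v \<bullet> X \<omega>)) - \<phi> t" for t \<omega>
  define G where "G B = real_cond_exp M ?F (\<lambda>\<omega>. indicator B (?V \<omega>))" for B
  have phi: "\<phi> t = iexp (t * (v \<bullet> mean)) * of_real (exp (- (t\<^sup>2 * v $ j) / 2))" for t
    using expectation_iexp_inner[of "t *\<^sub>R v"]
    by (simp add: \<phi>_def uv matrix_vector_mult_scaleR power2_eq_square mult.assoc del: of_real_mult)
  have int_iexp: "integrable M (\<lambda>\<omega>. iexp (g \<omega>))" if "g \<in> borel_measurable M" for g :: "'a \<Rightarrow> real"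
    using that by (intro integrable_const_bound[where B = 1]) auto
  have fm[measurable]: "f t \<in> borel_measurable M" for t unfolding f_def by measurable
  have fB: "norm (f t \<omega> * iexp x) \<le> 2" for t \<omega> x
  proof -
    have "norm (\<phi> t) \<le> 1" by (simp add: phi norm_mult vj less_imp_le)
    moreover have "norm (f t \<omega>) \<le> norm (iexp (t * (v \<bullet> X \<omega>))) + norm (\<phi> t)"
      unfolding f_def by (rule norm_triangle_ineq4)
    ultimately show ?thesis by (simp add: norm_mult)
  qed
  have fi: "integrable M (\<lambda>\<omega>. f t \<omega> * iexp (g \<omega>))" if "g \<in> borel_measurable M" for t g
    using that fB by (intro integrable_const_bound[where B = 2]) auto
  have f_iexp: "f t \<omega> * iexp (u \<bullet> X \<omega>) = iexp ((t *\<^sub>R v + u) \<bullet> X \<omega>) - \<phi> t * iexp (u \<bullet> X \<omega>)" for t \<omega> u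
    by (simp add: f_def inner_add_left iexp_add left_diff_distrib del: of_real_add)
  \<comment> \<open>As \<open>v \<bullet> X\<close> and \<open>u \<bullet> X\<close> are uncorrelated for \<open>u $ j = 0\<close>, their joint characteristic function factorises.\<close>
  have f0: "expectation (\<lambda>\<omega>. f t \<omega> * iexp (u \<bullet> X \<omega>)) = 0" if u: "u $ j = 0" for t u
  proof -
    have q: "(t *\<^sub>R v + u) \<bullet> (cov *v (t *\<^sub>R v + u)) = t\<^sup>2 * v $ j + u \<bullet> (cov *v u)"
      by (simp add: matrix_vector_right_distrib matrix_vector_mult_scaleR inner_add_left inner_add_right
          uv vu u power2_eq_square)
    have "expectation (\<lambda>\<omega>. f t \<omega> * iexp (u \<bullet> X \<omega>))
        = expectation (\<lambda>\<omega>. iexp ((t *\<^sub>R v + u) \<bullet> X \<omega>)) - \<phi> t * expectation (\<lambda>\<omega>. iexp (u \<bullet> X \<omega>))"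
      unfolding f_iexp using int_iexp[of "\<lambda>\<omega>. (t *\<^sub>R v + u) \<bullet> X \<omega>"] int_iexp[of "\<lambda>\<omega>. u \<bullet> X \<omega>"] by simp
    also have "\<dots> = 0"
      unfolding expectation_iexp_inner q phi
      by (simp add: inner_add_left exp_add[symmetric] exp_of_real[symmetric] diff_divide_distrib algebra_simps)
    finally show ?thesis .
  qed
  have anW: "annihilates_law M (\<lambda>\<omega>. f t \<omega> * iexp (u \<bullet> X \<omega>)) ?N ?W" if u: "u $ j = 0" for t u
  proof (rule annihilates_law_coords_if_char_zero)
    fix w :: "real ^ 'p" assume w: "\<forall>k\<in>- (- {j}). w $ k = 0"
    have "f t \<omega> * iexp (u \<bullet> X \<omega>) * iexp (w \<bullet> X \<omega>) = f t \<omega> * iexp ((u + w) \<bullet> X \<omega>)" for \<omega>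
      unfolding inner_add_left iexp_add by (simp only: mult.assoc)
    then show "expectation (\<lambda>\<omega>. f t \<omega> * iexp (u \<bullet> X \<omega>) * iexp (w \<bullet> X \<omega>)) = 0"
      using f0[of "u + w" t] u w by (simp only: vector_add_component) simp
  qed (use fi in auto)
  have GF: "G B \<in> borel_measurable ?F" for B by (simp add: G_def)
  have iG: "integrable M (G B)" if B: "B \<in> sets borel" for B
    using cond_indep_residual(2)[OF ci _ _ sets.top B, of "\<lambda>_. 0" 0] by (simp add: G_def)
  have fG: "(\<integral>\<omega>. (f t \<omega> * iexp (u \<bullet> X \<omega>)) * of_real (G B \<omega>) \<partial>M) = 0"
    if "u $ j = 0" "B \<in> sets borel" for t u B
    using that fi fB by (intro integral_mult_annihilated_weight[OF _ W anW GF iG, where B = 2]) auto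
  have Fm: "(\<lambda>\<omega>. u \<bullet> X \<omega>) \<in> borel_measurable ?F" if u: "u $ j = 0" for u
  proof -
    have "?W \<in> measurable ?F ?N"
      using measurable_space[OF W] by (intro measurable_vimage_algebra1) auto
    then have "(\<lambda>\<omega>. ?W \<omega> k) \<in> borel_measurable ?F" if "k \<in> - {j}" for k
      using that by (rule measurable_compose[OF _ measurable_component_singleton])
    then have "(\<lambda>\<omega>. \<Sum>k\<in>-{j}. u $ k * ?W \<omega> k) \<in> borel_measurable ?F"
      by (intro borel_measurable_sum borel_measurable_times borel_measurable_const)
    moreover have "(\<Sum>k\<in>-{j}. u $ k * ?W \<omega> k) = u \<bullet> X \<omega>" for \<omega>
    proof -
      have "u \<bullet> X \<omega> = (\<Sum>k\<in>UNIV. u $ k * X \<omega> $ k)" by (simp add: inner_vec_def)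
      also have "\<dots> = (\<Sum>k\<in>-{j}. u $ k * X \<omega> $ k)"
        using u by (intro sum.mono_neutral_right) auto
      finally show ?thesis by (simp add: coords_def)
    qed
    ultimately show ?thesis by simp
  qed
  have Vm[measurable]: "?V \<in> borel_measurable M" by measurable
  have iGc: "integrable M (\<lambda>\<omega>. iexp (u \<bullet> X \<omega>) * of_real (G B \<omega>))"
    "integrable M (\<lambda>\<omega>. iexp (u \<bullet> X \<omega>) * indicator B (?V \<omega>))" if B[measurable]: "B \<in> sets borel" for u B
  proof -
    have "integrable M (\<lambda>\<omega>. complex_of_real (G B \<omega>) * iexp (u \<bullet> X \<omega>))"
      using iG[OF B] by (intro integrable_mult_bounded[where B = 1] integrable_of_real) auto
    then show "integrable M (\<lambda>\<omega>. iexp (u \<bullet> X \<omega>) * of_real (G B \<omega>))" by (simp add: mult.commute)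
    show "integrable M (\<lambda>\<omega>. iexp (u \<bullet> X \<omega>) * indicator B (?V \<omega>))"
      by (intro integrable_const_bound[where B = 1]) (auto simp: norm_mult indicator_def)
  qed
  \<comment> \<open>By conditional independence, \<open>G B\<close> is also the conditional probability of \<open>B\<close> given the whole vector \<open>X\<close>.\<close>
  have res: "(\<integral>\<omega>. iexp (u \<bullet> X \<omega>) * (indicator B (?V \<omega>) - of_real (G B \<omega>)) \<partial>M) = 0"
    if B[measurable]: "B \<in> sets borel" for u B
  proof -
    define u' where "u' = u - (u $ j) *\<^sub>R axis j 1"
    have u': "u' $ j = 0" by (simp add: u'_def)
    have r: "integrable M (\<lambda>\<omega>. of_real (h \<omega> * (indicator B (?V \<omega>) - G B \<omega>)) * iexp (u $ j * X \<omega> $ j))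
        \<and> (\<integral>\<omega>. of_real (h \<omega> * (indicator B (?V \<omega>) - G B \<omega>)) * iexp (u $ j * X \<omega> $ j) \<partial>M) = 0"
      if h: "h \<in> borel_measurable ?F" and hC: "\<And>\<omega>. \<bar>h \<omega>\<bar> \<le> 1" for h :: "'a \<Rightarrow> real"
    proof -
      note c = cond_indep_residual[OF ci h hC _ B, folded G_def]
      have i: "integrable M (\<lambda>\<omega>. complex_of_real (h \<omega> * (indicator B (?V \<omega>) - G B \<omega>)))"
        using c(3)[OF sets.top] by (rule integrable_of_real)
      have "annihilates_law M (\<lambda>\<omega>. complex_of_real (h \<omega> * (indicator B (?V \<omega>) - G B \<omega>))) borel (\<lambda>\<omega>. X \<omega> $ j)"
        unfolding annihilates_law_def
      proof
        fix A :: "real set" assume A: "A \<in> sets borel"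
        have "(\<integral>\<omega>. complex_of_real (h \<omega> * (indicator B (?V \<omega>) - G B \<omega>)) * indicator A (X \<omega> $ j) \<partial>M)
          = (\<integral>\<omega>. complex_of_real (h \<omega> * (indicator B (?V \<omega>) - G B \<omega>) * indicator A (X \<omega> $ j)) \<partial>M)"
          by (simp add: indicator_def of_bool_def if_distrib cong: if_cong)
        also have "\<dots> = of_real (\<integral>\<omega>. h \<omega> * (indicator B (?V \<omega>) - G B \<omega>) * indicator A (X \<omega> $ j) \<partial>M)"
          by (rule integral_complex_of_real)
        finally show "(\<integral>\<omega>. complex_of_real (h \<omega> * (indicator B (?V \<omega>) - G B \<omega>)) * indicator A (X \<omega> $ j) \<partial>M) = 0"
          using c(1)[OF A] by simp
      qed
      from annihilates_law_integral[OF i _ this, of "\<lambda>x. iexp (u $ j * x)" 1]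
      have "(\<integral>\<omega>. complex_of_real (h \<omega> * (indicator B (?V \<omega>) - G B \<omega>)) * iexp (u $ j * X \<omega> $ j) \<partial>M) = 0"
        by simp
      moreover have "integrable M (\<lambda>\<omega>. of_real (h \<omega> * (indicator B (?V \<omega>) - G B \<omega>)) * iexp (u $ j * X \<omega> $ j))"
        by (rule integrable_mult_bounded[OF i, where B = 1]) auto
      ultimately show ?thesis by blast
    qed
    have c: "(\<lambda>\<omega>. cos (u' \<bullet> X \<omega>)) \<in> borel_measurable ?F" "(\<lambda>\<omega>. sin (u' \<bullet> X \<omega>)) \<in> borel_measurable ?F"
      using Fm[OF u'] by measurable
    note rc = r[OF c(1) abs_cos_le_one] and rs = r[OF c(2) abs_sin_le_one]
    have "iexp (u \<bullet> X \<omega>) = (of_real (cos (u' \<bullet> X \<omega>)) + \<i> * of_real (sin (u' \<bullet> X \<omega>))) * iexp (u $ j * X \<omega> $ j)" for \<omega>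
    proof -
      have "u \<bullet> X \<omega> = u' \<bullet> X \<omega> + u $ j * X \<omega> $ j"
        by (simp add: u'_def inner_diff_left inner_axis')
      then have "iexp (u \<bullet> X \<omega>) = iexp (u' \<bullet> X \<omega>) * iexp (u $ j * X \<omega> $ j)" by (simp only: iexp_add)
      then show ?thesis using cis_conv_exp[of "u' \<bullet> X \<omega>"] by (simp add: cis.code complex_eq_iff)
    qed
    then have "(\<integral>\<omega>. iexp (u \<bullet> X \<omega>) * (indicator B (?V \<omega>) - of_real (G B \<omega>)) \<partial>M)
      = (\<integral>\<omega>. of_real (cos (u' \<bullet> X \<omega>) * (indicator B (?V \<omega>) - G B \<omega>)) * iexp (u $ j * X \<omega> $ j)
           + \<i> * (of_real (sin (u' \<bullet> X \<omega>) * (indicator B (?V \<omega>) - G B \<omega>)) * iexp (u $ j * X \<omega> $ j)) \<partial>M)"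
      by (intro Bochner_Integration.integral_cong refl) (simp add: algebra_simps indicator_def)
    also have "\<dots> = 0" using rc rs by (subst Bochner_Integration.integral_add) auto
    finally show ?thesis .
  qed
  have swap: "(\<integral>\<omega>. iexp (u \<bullet> X \<omega>) * indicator B (?V \<omega>) \<partial>M) = (\<integral>\<omega>. iexp (u \<bullet> X \<omega>) * of_real (G B \<omega>) \<partial>M)"
    if "B \<in> sets borel" for u B
    using res[OF that, of u] iGc[OF that, of u] by (simp add: right_diff_distrib)
  have anV: "annihilates_law M (\<lambda>\<omega>. f t \<omega> * iexp (u \<bullet> X \<omega>)) borel ?V" if u: "u $ j = 0" for t u
    unfolding annihilates_law_def
  proof
    fix B :: "real set" assume B: "B \<in> sets borel"
    have "(\<integral>\<omega>. f t \<omega> * iexp (u \<bullet> X \<omega>) * indicator B (?V \<omega>) \<partial>M)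
      = (\<integral>\<omega>. iexp ((t *\<^sub>R v + u) \<bullet> X \<omega>) * indicator B (?V \<omega>) - \<phi> t * (iexp (u \<bullet> X \<omega>) * indicator B (?V \<omega>)) \<partial>M)"
      unfolding f_iexp by (simp only: left_diff_distrib mult.assoc)
    also have "\<dots> = (\<integral>\<omega>. iexp ((t *\<^sub>R v + u) \<bullet> X \<omega>) * indicator B (?V \<omega>) \<partial>M) - \<phi> t * (\<integral>\<omega>. iexp (u \<bullet> X \<omega>) * indicator B (?V \<omega>) \<partial>M)"
      using iGc(2)[OF B, of "t *\<^sub>R v + u"] iGc(2)[OF B, of u] by simp
    also have "\<dots> = (\<integral>\<omega>. iexp ((t *\<^sub>R v + u) \<bullet> X \<omega>) * of_real (G B \<omega>) \<partial>M) - \<phi> t * (\<integral>\<omega>. iexp (u \<bullet> X \<omega>) * of_real (G B \<omega>) \<partial>M)"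
      by (simp only: swap[OF B])
    also have "\<dots> = (\<integral>\<omega>. iexp ((t *\<^sub>R v + u) \<bullet> X \<omega>) * of_real (G B \<omega>) - \<phi> t * (iexp (u \<bullet> X \<omega>) * of_real (G B \<omega>)) \<partial>M)"
      using iGc(1)[OF B, of "t *\<^sub>R v + u"] iGc(1)[OF B, of u] by simp
    also have "\<dots> = (\<integral>\<omega>. f t \<omega> * iexp (u \<bullet> X \<omega>) * of_real (G B \<omega>) \<partial>M)"
      unfolding f_iexp by (simp only: left_diff_distrib mult.assoc)
    finally show "(\<integral>\<omega>. f t \<omega> * iexp (u \<bullet> X \<omega>) * indicator B (?V \<omega>) \<partial>M) = 0"
      using fG[OF u B] by simp
  qed
  \<comment> \<open>\<open>\<beta> - b v\<close> has \<open>j\<close>-th coordinate \<open>0\<close>, so the character \<open>iexp (u \<bullet> X)\<close> cancels the part of the response depending on the other covariates; what is left is \<open>b (v \<bullet> X) + \<epsilon>\<close>.\<close>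
  define b where "b = \<beta> $ j / v $ j"
  define u where "u = b *\<^sub>R v - \<beta>"
  have u: "u $ j = 0" using vj by (simp add: u_def b_def)
  have "(\<integral>\<omega>. f (- b) \<omega> * iexp (u \<bullet> X \<omega>) * iexp (?V \<omega>) \<partial>M) = 0"
    using fi by (intro annihilates_law_integral[OF _ Vm anV[OF u], where B = 1]) auto
  moreover have "f (- b) \<omega> * iexp (u \<bullet> X \<omega>) * iexp (?V \<omega>) = (1 - \<phi> (- b) * iexp (b * (v \<bullet> X \<omega>))) * iexp (\<epsilon> \<omega>)" for \<omega>
  proof -
    have "u \<bullet> X \<omega> + ?V \<omega> = b * (v \<bullet> X \<omega>) + \<epsilon> \<omega>"
      by (simp add: u_def inner_diff_left inner_commute[of "X \<omega>" \<beta>])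
    then have "iexp (u \<bullet> X \<omega>) * iexp (?V \<omega>) = iexp (b * (v \<bullet> X \<omega>)) * iexp (\<epsilon> \<omega>)"
      by (metis iexp_add)
    moreover have "iexp (- b * (v \<bullet> X \<omega>)) * iexp (b * (v \<bullet> X \<omega>)) = 1"
      by (simp add: exp_add[symmetric])
    ultimately show ?thesis
      by (simp only: f_def mult.assoc left_diff_distrib) (simp only: mult.assoc[symmetric] mult_1)
  qed
  ultimately have e0: "expectation (\<lambda>\<omega>. (1 - \<phi> (- b) * iexp (b * (v \<bullet> X \<omega>))) * iexp (\<epsilon> \<omega>)) = 0" by simp
  have "indep_var borel (\<lambda>\<omega>. 1 - \<phi> (- b) * iexp (b * (v \<bullet> X \<omega>))) borel (\<lambda>\<omega>. iexp (\<epsilon> \<omega>))"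
    by (rule indep_borel_indep_var[OF ind]) measurable
  then have "expectation (\<lambda>\<omega>. 1 - \<phi> (- b) * iexp (b * (v \<bullet> X \<omega>))) * expectation (\<lambda>\<omega>. iexp (\<epsilon> \<omega>)) = 0"
    using e0 int_iexp[of "\<lambda>\<omega>. b * (v \<bullet> X \<omega>)"] int_iexp[of \<epsilon>]
    by (subst indep_var_lebesgue_integral[symmetric]) auto
  moreover have "expectation (\<lambda>\<omega>. iexp (\<epsilon> \<omega>)) = of_real (exp (- \<sigma>\<^sup>2 / 2))"
    using char_normal_law[of 0 \<sigma> 1] unfolding law[symmetric] char_def
    by (subst (asm) integral_distr) auto
  moreover have "expectation (\<lambda>\<omega>. 1 - \<phi> (- b) * iexp (b * (v \<bullet> X \<omega>))) = 1 - \<phi> (- b) * \<phi> b"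
    using int_iexp[of "\<lambda>\<omega>. b * (v \<bullet> X \<omega>)"] prob_space by (simp add: \<phi>_def)
  ultimately have "(1 - \<phi> (- b) * \<phi> b) * complex_of_real (exp (- \<sigma>\<^sup>2 / 2)) = 0"
    by (simp only:)
  then have "\<phi> (- b) * \<phi> b = 1"
    using exp_not_eq_zero[of "- \<sigma>\<^sup>2 / 2"] by (simp only: mult_eq_0_iff of_real_eq_0_iff) simp
  moreover have "\<phi> (- b) * \<phi> b = of_real (exp (- (b\<^sup>2 * v $ j)))"
  proof -
    have "exp (- (b\<^sup>2 * v $ j) / 2) * exp (- (b\<^sup>2 * v $ j) / 2) = exp (- (b\<^sup>2 * v $ j))"
      by (simp add: exp_add[symmetric])
    moreover have "iexp (- b * (v \<bullet> mean)) * iexp (b * (v \<bullet> mean)) = 1" by (simp add: exp_add[symmetric])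
    moreover have "\<phi> (- b) * \<phi> b = (iexp (- b * (v \<bullet> mean)) * iexp (b * (v \<bullet> mean))) *
      of_real (exp (- (b\<^sup>2 * v $ j) / 2) * exp (- (b\<^sup>2 * v $ j) / 2))"
      unfolding phi by (simp only: of_real_mult power2_minus mult_ac)
    ultimately show ?thesis by simp
  qed
  ultimately have "exp (- (b\<^sup>2 * v $ j)) = 1" by (metis of_real_eq_1_iff)
  then have "b = 0" using vj by simp
  then show ?thesis using vj by (simp add: b_def)
qed

end

section \<open>Energy of a block of covariates\<close>

lemma inverse_antimono_ennreal: "x \<le> y \<Longrightarrow> inverse y \<le> inverse x" for x y :: ennreal
  by (cases rule: ennreal2_cases[of x y]; cases "x = 0") (auto simp: inverse_ennreal less_le top_unique intro!: ennreal_leI)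

text \<open>Directions are integrated over this annulus: it contains the ball of radius \<open>1/2\<close> around each unit
vector and keeps away from \<open>0\<close>.\<close>

definition annulus :: "(real ^ 'p) set" where
  "annulus = {v. 1/2 \<le> norm v \<and> norm v \<le> 3/2}"

text \<open>A negative power of the projection on \<open>v\<close> of \<open>x / (1 + |x|)\<close>. Shrinking \<open>x\<close> into the unit ball makes
the projection a \<open>1\<close>-Lipschitz function of \<open>v\<close>. The value is \<open>\<infinity>\<close> where \<open>x \<bullet> v = 0\<close>, which is why it is
an extended nonnegative real.\<close>

definition inv_proj :: "real ^ 'p \<Rightarrow> real ^ 'p \<Rightarrow> ennreal" where
  "inv_proj x v = inverse (ennreal ((\<bar>x \<bullet> v\<bar> / (1 + norm x)) powr (1/4)))"

text \<open>The energy of the block of vectors with indices in \<open>c\<close>. For \<open>4 (p + 4)\<close> vectors in dimension \<open>p\<close> the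
integrand is of degree \<open>-(p + 4)\<close> in the size of the projections.\<close>

definition energy :: "'i set \<Rightarrow> ('i \<Rightarrow> real ^ 'p::finite) \<Rightarrow> ennreal" where
  "energy c x = (\<integral>\<^sup>+v\<in>annulus. (\<Prod>l\<in>c. inv_proj (x l) v) \<partial>lborel)"

text \<open>The constant of \<open>energy_lower_bound\<close>; it depends on the dimension only.\<close>

definition energy_const :: "'p::finite itself \<Rightarrow> real" where
  "energy_const _ = 16 * unit_ball_vol (real CARD('p)) / 3 ^ (CARD('p) + 4)"

lemma energy_const_pos: "energy_const TYPE('p::finite) > 0"
  by (simp add: energy_const_def)

lemma ball_subset_annulus:
  assumes "norm v = 1" "r \<le> 1/2" shows "ball v r \<subseteq> annulus"
proof
  fix u assume "u \<in> ball v r"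
  then have "norm (v - u) < 1/2" using assms by (simp add: dist_norm)
  then have "\<bar>norm v - norm u\<bar> < 1/2" using norm_triangle_ineq3[of v u] by linarith
  then show "u \<in> annulus" unfolding annulus_def assms(1) mem_Collect_eq abs_less_iff by linarith
qed

text \<open>If all shrunk projections on the unit vector \<open>v\<close> are at most \<open>2 r\<close>, they are at most \<open>3 r\<close> on the ball
of radius \<open>r\<close> around \<open>v\<close>. This ball has volume of order \<open>r ^ p\<close> and the integrand is at least
\<open>(3 r) ^ -(p + 4)\<close> there, so the energy is at least of order \<open>r ^ -4\<close>.\<close>

lemma energy_lower_bound_radius:
  fixes x :: "'i \<Rightarrow> real ^ 'p::finite"
  assumes c: "finite c" "card c = 4 * (CARD('p) + 4)"
    and v: "norm v = 1" and r: "0 < r" "r \<le> 1/2"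
    and small: "\<And>l. l \<in> c \<Longrightarrow> \<bar>x l \<bullet> v\<bar> / (1 + norm (x l)) \<le> 2 * r"
    and w: "energy c x \<le> ennreal w" "0 \<le> w"
  shows "energy_const TYPE('p) \<le> 16 * w * r ^ 4"
proof -
  let ?p = "CARD('p)"
  have sm: "\<bar>x l \<bullet> u\<bar> / (1 + norm (x l)) \<le> 3 * r" if l: "l \<in> c" and u: "u \<in> ball v r" for l u
  proof -
    have "\<bar>x l \<bullet> (u - v)\<bar> \<le> norm (x l) * norm (u - v)" by (rule Cauchy_Schwarz_ineq2)
    also have "\<dots> \<le> (1 + norm (x l)) * r"
      using u r by (intro mult_mono) (auto simp: dist_norm norm_minus_commute)
    finally have "\<bar>x l \<bullet> (u - v)\<bar> / (1 + norm (x l)) \<le> r"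
      by (simp add: divide_le_eq add_pos_nonneg mult.commute)
    moreover have "\<bar>x l \<bullet> u\<bar> \<le> \<bar>x l \<bullet> (u - v)\<bar> + \<bar>x l \<bullet> v\<bar>" by (simp add: inner_diff_right)
    then have "\<bar>x l \<bullet> u\<bar> / (1 + norm (x l)) \<le> (\<bar>x l \<bullet> (u - v)\<bar> + \<bar>x l \<bullet> v\<bar>) / (1 + norm (x l))"
      by (intro divide_right_mono) auto
    ultimately show ?thesis using small[OF l] by (simp add: add_divide_distrib)
  qed
  define a where "a = (3 * r) powr (1/4)"
  have a: "a > 0" using r by (simp add: a_def)
  have "a ^ (4 * (?p + 4)) = (a ^ 4) ^ (?p + 4)" by (rule power_mult)
  also have "a ^ 4 = 3 * r" using r by (simp add: a_def powr_power)
  finally have apow: "a ^ (4 * (?p + 4)) = (3 * r) ^ (?p + 4)" .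
  have prod: "ennreal (1 / (3 * r) ^ (?p + 4)) \<le> (\<Prod>l\<in>c. inv_proj (x l) u)" if u: "u \<in> ball v r" for u
  proof -
    have "(\<Prod>l\<in>c. ennreal (inverse a)) = ennreal (inverse a) ^ card c" by (rule prod_constant)
    also have "\<dots> = ennreal (inverse a ^ card c)" using a by (intro ennreal_power) simp
    also have "inverse a ^ card c = inverse (a ^ (4 * (?p + 4)))"
      unfolding c(2) by (rule power_inverse)
    also have "\<dots> = 1 / (3 * r) ^ (?p + 4)"
      unfolding apow by (rule inverse_eq_divide)
    finally have "ennreal (1 / (3 * r) ^ (?p + 4)) = (\<Prod>l\<in>c. ennreal (inverse a))" by (rule sym)
    also have "\<dots> \<le> (\<Prod>l\<in>c. inv_proj (x l) u)"
    proof (rule prod_mono_ennreal)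
      fix l assume l: "l \<in> c"
      have "ennreal (inverse a) = inverse (ennreal a)" using a by (simp add: inverse_ennreal)
      also have "\<dots> \<le> inv_proj (x l) u"
        unfolding inv_proj_def a_def
        by (intro inverse_antimono_ennreal ennreal_leI powr_mono2 sm[OF l u]) (simp_all add: add_nonneg_nonneg)
      finally show "ennreal (inverse a) \<le> inv_proj (x l) u" .
    qed
    finally show ?thesis .
  qed
  have "ennreal (1 / (3 * r) ^ (?p + 4)) * emeasure lborel (ball v r)
      = (\<integral>\<^sup>+u\<in>ball v r. ennreal (1 / (3 * r) ^ (?p + 4)) \<partial>lborel)"
    by (simp add: nn_integral_cmult_indicator)
  also have "\<dots> \<le> energy c x"
    unfolding energy_def using prod ball_subset_annulus[OF v r(2)]
    by (intro nn_integral_mono) (auto split: split_indicator)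
  also note w(1)
  finally have "ennreal (1 / (3 * r) ^ (?p + 4)) * ennreal (unit_ball_vol (real ?p) * r ^ ?p) \<le> ennreal w"
    using r by (simp add: emeasure_ball)
  then have "1 / (3 * r) ^ (?p + 4) * (unit_ball_vol (real ?p) * r ^ ?p) \<le> w"
    using r w(2) by (simp add: ennreal_mult[symmetric])
  then have "unit_ball_vol (real ?p) / 3 ^ (?p + 4) / r ^ 4 \<le> w"
    using r by (simp add: power_mult_distrib power_add field_simps)
  then show ?thesis using r by (simp add: energy_const_def field_simps)
qed

text \<open>The quadratic form of a block with finite energy is bounded below on unit vectors, uniformly; in
particular it is positive definite.\<close>

lemma energy_lower_bound:
  fixes x :: "'i \<Rightarrow> real ^ 'p::finite"
  assumes c: "finite c" "card c = 4 * (CARD('p) + 4)"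
    and v: "norm v = 1" and w: "energy c x \<le> ennreal w" "0 \<le> w"
  shows "energy_const TYPE('p) \<le> w * (\<Sum>l\<in>c. (x l \<bullet> v)\<^sup>2)\<^sup>2"
proof -
  define s where "s = (\<Sum>l\<in>c. (x l \<bullet> v)\<^sup>2)"
  define q where "q = min (sqrt s) 1"
  have s0: "0 \<le> s" by (auto simp: s_def intro!: sum_nonneg)
  have q: "\<bar>x l \<bullet> v\<bar> / (1 + norm (x l)) \<le> q" if l: "l \<in> c" for l
  proof -
    have d: "0 < 1 + norm (x l)" by (simp add: add_pos_nonneg)
    have "(x l \<bullet> v)\<^sup>2 \<le> s" unfolding s_def using c(1) l by (intro member_le_sum) auto
    then have "\<bar>x l \<bullet> v\<bar> \<le> sqrt s" by (simp add: real_le_rsqrt)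
    then have "\<bar>x l \<bullet> v\<bar> \<le> sqrt s * (1 + norm (x l))"
      using s0 mult_left_mono[of 1 "1 + norm (x l)" "sqrt s"] by simp
    moreover have "\<bar>x l \<bullet> v\<bar> \<le> norm (x l)" using Cauchy_Schwarz_ineq2[of "x l" v] v by simp
    ultimately show ?thesis using d by (auto simp: q_def divide_le_eq)
  qed
  have q0: "0 \<le> q" "q \<le> 1" using s0 by (auto simp: q_def)
  note rad = energy_lower_bound_radius[OF c v _ _ _ w]
  show ?thesis
  proof (cases "q = 0")
    case True
    let ?\<kappa> = "energy_const TYPE('p)"
    \<comment> \<open>If all projections vanish, every radius is admissible; this one violates the bound.\<close>
    define r where "r = min (1/2) (?\<kappa> / (32 * (w + 1)))"
    have k: "?\<kappa> > 0" by (rule energy_const_pos)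
    have r: "0 < r" using k w(2) by (simp add: r_def)
    have r2: "r \<le> 1/2" unfolding r_def by (rule min.cobounded1)
    have r3: "r \<le> ?\<kappa> / (32 * (w + 1))" unfolding r_def by (rule min.cobounded2)
    note r = r r2 r3
    have "?\<kappa> \<le> 16 * w * r ^ 4" using q True r by (intro rad) (auto intro: order_trans[OF q])
    also have "\<dots> \<le> 16 * w * r ^ 1" using r w(2) by (intro mult_left_mono power_decreasing) auto
    also have "\<dots> \<le> 16 * w * (?\<kappa> / (32 * (w + 1)))" using r w(2) by (intro mult_left_mono) auto
    also have "\<dots> = ?\<kappa> * (w / (2 * (w + 1)))" using w(2) by (simp add: field_simps)
    also have "\<dots> < ?\<kappa> * 1" using k w(2) by (intro mult_strict_left_mono) (auto simp: divide_less_eq)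
    finally show ?thesis by simp
  next
    case False
    have "energy_const TYPE('p) \<le> 16 * w * (q / 2) ^ 4"
      using q q0 False by (intro rad) auto
    also have "\<dots> = w * q ^ 4" by (simp add: power_divide)
    also have "\<dots> \<le> w * sqrt s ^ 4"
      using q0 w(2) by (intro mult_left_mono power_mono) (auto simp: q_def)
    also have "sqrt s ^ 4 = s\<^sup>2"
      using s0 power_mult[of "sqrt s" 2 2] by simp
    finally show ?thesis by (simp add: s_def)
  qed
qed

lemma cube_card_le_square_sum_mult_sum_inverse_square:
  fixes s :: "'b \<Rightarrow> real"
  assumes B: "finite B" and s: "\<And>b. b \<in> B \<Longrightarrow> 0 < s b"
  shows "real (card B) ^ 3 \<le> (\<Sum>b\<in>B. s b)\<^sup>2 * (\<Sum>b\<in>B. 1 / (s b)\<^sup>2)"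
proof (cases "B = {}")
  case False
  define m where "m = real (card B)"
  define a where "a = (\<Sum>b\<in>B. s b) / m"
  have m: "m > 0" using B False by (simp add: m_def card_gt_0_iff)
  have S: "(\<Sum>b\<in>B. s b) > 0" using B False s by (intro sum_pos) auto
  have a: "a > 0" using m S by (simp add: a_def)
  have "m / a\<^sup>2 = (\<Sum>b\<in>B. 3 / a\<^sup>2 - 2 * s b / a ^ 3)"
  proof -
    have "(\<Sum>b\<in>B. 3 / a\<^sup>2 - 2 * s b / a ^ 3) = m * (3 / a\<^sup>2) - 2 * (\<Sum>b\<in>B. s b) / a ^ 3"
      by (simp add: sum_subtractf m_def sum_distrib_left sum_divide_distrib)
    also have "(\<Sum>b\<in>B. s b) = m * a" using m by (simp add: a_def)
    finally show ?thesis using a by (simp add: field_simps power2_eq_square power3_eq_cube)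
  qed
  also have "\<dots> \<le> (\<Sum>b\<in>B. 1 / (s b)\<^sup>2)"
  proof (rule sum_mono)
    fix b assume b: "b \<in> B"
    \<comment> \<open>the tangent to \<open>t \<mapsto> 1/t\<^sup>2\<close> at the mean \<open>a\<close>\<close>
    have "0 \<le> (s b - a)\<^sup>2 * (2 * s b + a)" using s[OF b] a by simp
    then have "3 * a * (s b)\<^sup>2 - 2 * (s b) ^ 3 \<le> a ^ 3"
      by (simp add: power2_eq_square power3_eq_cube algebra_simps)
    then show "3 / a\<^sup>2 - 2 * s b / a ^ 3 \<le> 1 / (s b)\<^sup>2"
      using s[OF b] a by (simp add: field_simps power2_eq_square power3_eq_cube)
  qed
  finally have "m / a\<^sup>2 \<le> (\<Sum>b\<in>B. 1 / (s b)\<^sup>2)" .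
  moreover have "m / a\<^sup>2 = m ^ 3 / (\<Sum>b\<in>B. s b)\<^sup>2"
    using m S by (simp add: a_def power2_eq_square power3_eq_cube field_simps)
  ultimately show ?thesis using S by (simp add: m_def pos_divide_le_eq mult.commute)
qed simp

text \<open>Adding up the lower bounds for disjoint blocks: the inverse square of the full quadratic form on unit
vectors is at most of order (sum of the energies) / (number of blocks)^3.\<close>

lemma design_quadratic_form_lower_bound:
  fixes x :: "nat \<Rightarrow> real ^ 'p::finite" and c :: "'b \<Rightarrow> nat set"
  assumes B: "finite B" and I: "finite I"
    and c: "\<And>b. b \<in> B \<Longrightarrow> c b \<subseteq> I" "\<And>b. b \<in> B \<Longrightarrow> card (c b) = 4 * (CARD('p) + 4)"
    and disj: "disjoint_family_on c B"
    and w: "\<And>b. b \<in> B \<Longrightarrow> energy (c b) x \<le> ennreal (w b)" "\<And>b. b \<in> B \<Longrightarrow> 0 \<le> w b"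
  shows "energy_const TYPE('p) * real (card B) ^ 3 * norm v ^ 4
    \<le> (\<Sum>b\<in>B. w b) * (\<Sum>i\<in>I. (x i \<bullet> v)\<^sup>2)\<^sup>2"
proof (cases "v = 0")
  case False
  let ?\<kappa> = "energy_const TYPE('p)"
  have k: "?\<kappa> > 0" by (rule energy_const_pos)
  define v1 where "v1 = v /\<^sub>R norm v"
  have v1: "norm v1 = 1" using False by (simp add: v1_def)
  define s where "s b = (\<Sum>i\<in>c b. (x i \<bullet> v1)\<^sup>2)" for b
  have fin: "finite (c b)" if "b \<in> B" for b using c(1)[OF that] I finite_subset by blast
  have k_le: "?\<kappa> \<le> w b * (s b)\<^sup>2" if "b \<in> B" for b
    unfolding s_def using that by (intro energy_lower_bound fin c v1 w)
  have s: "0 < s b" if "b \<in> B" for b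
  proof -
    have "s b \<noteq> 0" using k_le[OF that] k by auto
    moreover have "0 \<le> s b" by (auto simp: s_def intro!: sum_nonneg)
    ultimately show ?thesis by simp
  qed
  have "?\<kappa> * real (card B) ^ 3 \<le> ?\<kappa> * ((\<Sum>b\<in>B. s b)\<^sup>2 * (\<Sum>b\<in>B. 1 / (s b)\<^sup>2))"
    using k s B by (intro mult_left_mono cube_card_le_square_sum_mult_sum_inverse_square) auto
  also have "\<dots> = (\<Sum>b\<in>B. s b)\<^sup>2 * (\<Sum>b\<in>B. ?\<kappa> / (s b)\<^sup>2)"
    by (simp add: sum_distrib_left mult_ac)
  also have "\<dots> \<le> (\<Sum>i\<in>I. (x i \<bullet> v1)\<^sup>2)\<^sup>2 * (\<Sum>b\<in>B. w b)"
  proof (rule mult_mono)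
    have "(\<Sum>b\<in>B. s b) = (\<Sum>i\<in>(\<Union>b\<in>B. c b). (x i \<bullet> v1)\<^sup>2)"
      unfolding s_def using B fin disj by (subst sum.UNION_disjoint_family) auto
    also have "\<dots> \<le> (\<Sum>i\<in>I. (x i \<bullet> v1)\<^sup>2)"
      using I c(1) by (intro sum_mono2) auto
    finally show "(\<Sum>b\<in>B. s b)\<^sup>2 \<le> (\<Sum>i\<in>I. (x i \<bullet> v1)\<^sup>2)\<^sup>2"
      using s by (intro power_mono sum_nonneg) (auto intro: less_imp_le)
    show "(\<Sum>b\<in>B. ?\<kappa> / (s b)\<^sup>2) \<le> (\<Sum>b\<in>B. w b)"
    proof (rule sum_mono)
      fix b assume "b \<in> B"
      with k_le[of b] s[of b] show "?\<kappa> / (s b)\<^sup>2 \<le> w b" by (simp add: pos_divide_le_eq)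
    qed
  qed (use k in \<open>auto intro!: sum_nonneg\<close>)
  finally have main: "?\<kappa> * real (card B) ^ 3 \<le> (\<Sum>i\<in>I. (x i \<bullet> v1)\<^sup>2)\<^sup>2 * (\<Sum>b\<in>B. w b)" .
  have "(\<Sum>i\<in>I. (x i \<bullet> v)\<^sup>2) = (norm v)\<^sup>2 * (\<Sum>i\<in>I. (x i \<bullet> v1)\<^sup>2)"
  proof -
    have "x i \<bullet> v = norm v * (x i \<bullet> v1)" for i using False by (simp add: v1_def)
    then show ?thesis by (simp add: power_mult_distrib sum_distrib_left)
  qed
  then have "(\<Sum>b\<in>B. w b) * (\<Sum>i\<in>I. (x i \<bullet> v)\<^sup>2)\<^sup>2
      = ((\<Sum>i\<in>I. (x i \<bullet> v1)\<^sup>2)\<^sup>2 * (\<Sum>b\<in>B. w b)) * norm v ^ 4"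
    by (simp add: power_mult_distrib mult_ac flip: power_mult)
  moreover have "?\<kappa> * real (card B) ^ 3 * norm v ^ 4
      \<le> ((\<Sum>i\<in>I. (x i \<bullet> v1)\<^sup>2)\<^sup>2 * (\<Sum>b\<in>B. w b)) * norm v ^ 4"
    using main by (rule mult_right_mono) simp
  ultimately show ?thesis by (simp only:)
next
  case True
  then show ?thesis using w(2) by (auto intro!: sum_nonneg)
qed

text \<open>The deterministic error bound: \<open>d\<close> is the estimation error, \<open>e\<close> the noise, and \<open>min\<close> compares the
residuals of the fit with those of the true coefficients.\<close>

lemma least_squares_error_bound:
  fixes x :: "nat \<Rightarrow> real ^ 'p::finite" and c :: "'b \<Rightarrow> nat set" and e :: "nat \<Rightarrow> real"
  assumes B: "finite B" and I: "finite I"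
    and c: "\<And>b. b \<in> B \<Longrightarrow> c b \<subseteq> I" "\<And>b. b \<in> B \<Longrightarrow> card (c b) = 4 * (CARD('p) + 4)"
    and disj: "disjoint_family_on c B"
    and w: "\<And>b. b \<in> B \<Longrightarrow> energy (c b) x \<le> ennreal (w b)" "\<And>b. b \<in> B \<Longrightarrow> 0 \<le> w b"
    and min: "(\<Sum>i\<in>I. (e i - x i \<bullet> d)\<^sup>2) \<le> (\<Sum>i\<in>I. (e i)\<^sup>2)"
  shows "energy_const TYPE('p) * real (card B) ^ 3 * (norm d)\<^sup>2
    \<le> 4 * (\<Sum>b\<in>B. w b) * (norm (\<Sum>i\<in>I. e i *\<^sub>R x i))\<^sup>2"
proof (cases "d = 0")
  case False
  let ?Z = "\<Sum>i\<in>I. e i *\<^sub>R x i"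
  let ?\<kappa> = "energy_const TYPE('p)"
  have "(\<Sum>i\<in>I. (e i - x i \<bullet> d)\<^sup>2) = (\<Sum>i\<in>I. (e i)\<^sup>2) - 2 * (?Z \<bullet> d) + (\<Sum>i\<in>I. (x i \<bullet> d)\<^sup>2)"
    by (simp add: power2_diff sum.distrib sum_subtractf inner_sum_left sum_distrib_left mult.assoc)
  with min have "(\<Sum>i\<in>I. (x i \<bullet> d)\<^sup>2) \<le> 2 * (?Z \<bullet> d)" by simp
  also have "?Z \<bullet> d \<le> norm ?Z * norm d" by (rule norm_cauchy_schwarz)
  finally have G: "(\<Sum>i\<in>I. (x i \<bullet> d)\<^sup>2) \<le> 2 * (norm ?Z * norm d)" by simp
  have W: "0 \<le> (\<Sum>b\<in>B. w b)" using w(2) by (auto intro!: sum_nonneg)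
  have "?\<kappa> * real (card B) ^ 3 * norm d ^ 4 \<le> (\<Sum>b\<in>B. w b) * (\<Sum>i\<in>I. (x i \<bullet> d)\<^sup>2)\<^sup>2"
    by (rule design_quadratic_form_lower_bound[OF B I c disj w])
  also have "\<dots> \<le> (\<Sum>b\<in>B. w b) * (2 * (norm ?Z * norm d))\<^sup>2"
    using W G by (intro mult_left_mono power_mono) (auto intro!: sum_nonneg)
  finally have "(?\<kappa> * real (card B) ^ 3 * (norm d)\<^sup>2) * (norm d)\<^sup>2
      \<le> (4 * (\<Sum>b\<in>B. w b) * (norm ?Z)\<^sup>2) * (norm d)\<^sup>2"
    by (simp add: power_mult_distrib power2_eq_square mult_ac numeral_eq_Suc)
  then show ?thesis using False by (simp add: mult_le_cancel_right)
next
  case True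
  then show ?thesis using w(2) by (auto intro!: sum_nonneg mult_nonneg_nonneg)
qed

section \<open>Negative moments of Gaussian projections\<close>

lemma nn_integral_inverse_sqrt_finite:
  "(\<integral>\<^sup>+y\<in>{-1..1}. inverse (ennreal (\<bar>y\<bar> powr (1/2))) \<partial>lborel) < \<infinity>"
proof -
  define h where "h y = indicator {-1..1} y * \<bar>y\<bar> powr (- 1/2)" for y :: real
  have hm: "h \<in> borel_measurable borel" unfolding h_def by measurable
  have h0: "0 \<le> h y" for y unfolding h_def by (intro mult_nonneg_nonneg indicator_pos_le powr_ge_zero)
  have "((\<lambda>y. y powr (- 1/2)) has_integral 2) {0..1::real}"
    using has_integral_powr_from_0[of "-1/2" 1] by simp
  then have p: "((\<lambda>y. \<bar>y\<bar> powr (- 1/2)) has_integral 2) {0..1::real}"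
    by (rule has_integral_eq[rotated]) simp
  have "((\<lambda>y. \<bar>- y\<bar> powr (- 1/2)) has_integral 2) {- 1..- 0::real}"
    by (rule iffD2[OF has_integral_reflect_real p])
  then have n: "((\<lambda>y. \<bar>y\<bar> powr (- 1/2)) has_integral 2) {-1..0::real}"
    by (simp only: abs_minus minus_zero)
  have "((\<lambda>y. \<bar>y\<bar> powr (- 1/2)) has_integral (2 + 2)) {-1..1::real}"
    by (rule has_integral_combine[OF _ _ n p]) auto
  then have "((\<lambda>y. if y \<in> {-1..1} then \<bar>y\<bar> powr (- 1/2) else 0) has_integral (2 + 2)) (UNIV :: real set)"
    by (rule iffD2[OF has_integral_restrict_UNIV])
  then have "(h has_integral (2 + 2)) UNIV"
    by (rule has_integral_eq[rotated]) (simp add: h_def)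
  then have "(\<integral>\<^sup>+y. ennreal (h y) \<partial>lborel) = ennreal (2 + 2)"
    by (rule nn_integral_has_integral_lborel[OF hm h0])
  moreover have "(\<integral>\<^sup>+y\<in>{-1..1}. inverse (ennreal (\<bar>y\<bar> powr (1/2))) \<partial>lborel) = (\<integral>\<^sup>+y. ennreal (h y) \<partial>lborel)"
  proof (rule nn_integral_cong_AE)
    have "AE y in lborel. y \<noteq> (0::real)" by (rule AE_lborel_singleton)
    then show "AE y in lborel. inverse (ennreal (\<bar>y\<bar> powr (1/2))) * indicator {-1..1} y = ennreal (h y)"
      by eventually_elim (auto simp: h_def inverse_ennreal powr_minus split: split_indicator)
  qed
  ultimately show ?thesis by simp
qed

text \<open>A negative moment of a normal law, bounded uniformly in the mean and in standard deviations bounded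
away from \<open>0\<close>: the density is bounded near the singularity, and elsewhere the integrand is at most \<open>1\<close>.\<close>

lemma normal_law_inverse_sqrt_bound:
  assumes "0 < \<tau>" "\<tau> \<le> \<sigma>"
  shows "(\<integral>\<^sup>+y. inverse (ennreal (\<bar>y\<bar> powr (1/2))) \<partial>normal_law \<mu> \<sigma>)
    \<le> 1 + ennreal (1 / \<tau>) * (\<integral>\<^sup>+y\<in>{-1..1}. inverse (ennreal (\<bar>y\<bar> powr (1/2))) \<partial>lborel)"
proof -
  have \<sigma>: "0 < \<sigma>" using assms by simp
  have d: "normal_density \<mu> \<sigma> y \<le> 1 / \<tau>" for y
  proof -
    have "normal_density \<mu> \<sigma> y \<le> 1 / sqrt (2 * pi * \<sigma>\<^sup>2) * 1"
      unfolding normal_density_def by (intro mult_left_mono) auto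
    also have "\<dots> \<le> 1 / \<tau>"
    proof -
      have "\<tau> = sqrt (\<tau>\<^sup>2)" using assms by simp
      also have "\<dots> \<le> sqrt (2 * pi * \<sigma>\<^sup>2)"
      proof (rule real_sqrt_le_mono)
        have "1 * \<tau>\<^sup>2 \<le> (2 * pi) * \<sigma>\<^sup>2" using assms pi_ge_two by (intro mult_mono power_mono) auto
        then show "\<tau>\<^sup>2 \<le> 2 * pi * \<sigma>\<^sup>2" by simp
      qed
      finally show ?thesis using assms by (simp add: frac_le)
    qed
    finally show ?thesis .
  qed
  have p1: "(\<integral>\<^sup>+y. ennreal (normal_density \<mu> \<sigma> y) \<partial>lborel) = 1"
    using prob_space.emeasure_space_1[OF prob_space_normal_density[OF \<sigma>, of \<mu>]]
    by (simp add: emeasure_density)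
  have "(\<integral>\<^sup>+y. inverse (ennreal (\<bar>y\<bar> powr (1/2))) \<partial>normal_law \<mu> \<sigma>)
      = (\<integral>\<^sup>+y. ennreal (normal_density \<mu> \<sigma> y) * inverse (ennreal (\<bar>y\<bar> powr (1/2))) \<partial>lborel)"
    using \<sigma> by (simp add: normal_law_def nn_integral_density)
  also have "\<dots> \<le> (\<integral>\<^sup>+y. ennreal (normal_density \<mu> \<sigma> y)
      + ennreal (1 / \<tau>) * (inverse (ennreal (\<bar>y\<bar> powr (1/2))) * indicator {-1..1} y) \<partial>lborel)"
  proof (rule nn_integral_mono)
    fix y :: real
    show "ennreal (normal_density \<mu> \<sigma> y) * inverse (ennreal (\<bar>y\<bar> powr (1/2)))
        \<le> ennreal (normal_density \<mu> \<sigma> y) + ennreal (1 / \<tau>) * (inverse (ennreal (\<bar>y\<bar> powr (1/2))) * indicator {-1..1} y)"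
    proof (cases "y \<in> {-1..1}")
      case True
      have "ennreal (normal_density \<mu> \<sigma> y) * inverse (ennreal (\<bar>y\<bar> powr (1/2)))
        \<le> ennreal (1 / \<tau>) * inverse (ennreal (\<bar>y\<bar> powr (1/2)))"
        using d by (intro mult_right_mono ennreal_leI) auto
      also have "\<dots> \<le> ennreal (normal_density \<mu> \<sigma> y) + ennreal (1 / \<tau>) * inverse (ennreal (\<bar>y\<bar> powr (1/2)))"
        by (rule add_increasing) auto
      finally show ?thesis using True by simp
    next
      case False
      then have "1 \<le> \<bar>y\<bar>" by auto
      then have "1 \<le> ennreal (\<bar>y\<bar> powr (1/2))" using ge_one_powr_ge_zero[of "\<bar>y\<bar>" "1/2"] by simp
      from inverse_antimono_ennreal[OF this] have "inverse (ennreal (\<bar>y\<bar> powr (1/2))) \<le> 1" by simp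
      from mult_left_mono[OF this, of "ennreal (normal_density \<mu> \<sigma> y)"] False show ?thesis by simp
    qed
  qed
  also have "\<dots> = 1 + ennreal (1 / \<tau>) * (\<integral>\<^sup>+y\<in>{-1..1}. inverse (ennreal (\<bar>y\<bar> powr (1/2))) \<partial>lborel)"
    using p1 by (subst nn_integral_add) (auto simp: nn_integral_cmult)
  finally show ?thesis .
qed

lemma ennreal_mult_le_sum_squares: "a * b \<le> a * a + b * b" for a b :: ennreal
proof (cases "a \<le> b")
  case True
  then have "a * b \<le> b * b" by (intro mult_right_mono) auto
  then show ?thesis by (simp add: add_increasing)
next
  case False
  then have "a * b \<le> a * a" by (intro mult_left_mono) auto
  then show ?thesis by (simp add: add_increasing2)
qed

context gaussian_design
begin

text \<open>By compactness of the annulus.\<close>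

lemma variance_lower_bound:
  obtains \<tau> where "0 < \<tau>" "\<And>v. v \<in> annulus \<Longrightarrow> \<tau> \<le> sqrt (v \<bullet> (cov *v v))"
proof -
  have "compact (annulus :: (real ^ 'p) set)"
  proof -
    have "annulus = cball (0 :: real ^ 'p) (3/2) - ball 0 (1/2)"
      by (auto simp: annulus_def dist_norm)
    moreover have "compact (cball (0 :: real ^ 'p) (3/2) - ball 0 (1/2))"
      by (intro compact_diff) auto
    ultimately show ?thesis by (simp only:)
  qed
  note cpt = this
  have "axis undefined 1 \<in> (annulus :: (real ^ 'p) set)" by (simp add: annulus_def)
  then have ne: "(annulus :: (real ^ 'p) set) \<noteq> {}" by blast
  have "continuous_on annulus (\<lambda>v. v \<bullet> (cov *v v))"
    by (intro continuous_intros linear_continuous_on linear_conv_bounded_linear[THEN iffD1] matrix_vector_mul_linear)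
  from continuous_attains_inf[OF cpt ne this]
  obtain w where w: "w \<in> annulus" "\<And>v. v \<in> annulus \<Longrightarrow> w \<bullet> (cov *v w) \<le> v \<bullet> (cov *v v)"
    by (auto simp only: Ball_def Bex_def)
  have "w \<noteq> 0" using w(1) by (auto simp: annulus_def)
  then have "0 < sqrt (w \<bullet> (cov *v w))" using cov_pos by simp
  moreover have "sqrt (w \<bullet> (cov *v w)) \<le> sqrt (v \<bullet> (cov *v v))" if "v \<in> annulus" for v
    using w(2)[OF that] by simp
  ultimately show ?thesis using that by blast
qed

lemma integrable_one_plus_norm_square_cube: "integrable M (\<lambda>\<omega>. (1 + (norm (X \<omega>))\<^sup>2) ^ 3)"
proof (rule Bochner_Integration.integrable_bound)
  let ?p = "real CARD('p)"
  show "integrable M (\<lambda>\<omega>. 4 + 4 * (?p ^ 3 * (\<Sum>k\<in>UNIV. (X \<omega> $ k) ^ 6)))"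
    using integrable_component_power by simp
  show "AE \<omega> in M. norm ((1 + (norm (X \<omega>))\<^sup>2) ^ 3) \<le> norm (4 + 4 * (?p ^ 3 * (\<Sum>k\<in>UNIV. (X \<omega> $ k) ^ 6)))"
  proof (intro AE_I2)
    fix \<omega>
    have cube: "(1 + t) ^ 3 \<le> 4 + 4 * t ^ 3" if "0 \<le> t" for t :: real
    proof -
      have "0 \<le> 3 * (1 + t) * (1 - t)\<^sup>2" using that by simp
      then show ?thesis by (simp add: power2_eq_square power3_eq_cube algebra_simps)
    qed
    have n2: "(norm (X \<omega>))\<^sup>2 = (\<Sum>k\<in>UNIV. (X \<omega> $ k)\<^sup>2)"
      by (simp add: norm_vec_def L2_set_def sum_nonneg)
    have "(norm (X \<omega>))\<^sup>2 ^ 3 \<le> ?p ^ 3 * (\<Sum>k\<in>UNIV. (X \<omega> $ k) ^ 6)"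
    proof -
      obtain l where l: "\<And>k. (X \<omega> $ k)\<^sup>2 \<le> (X \<omega> $ l)\<^sup>2"
      proof -
        have "finite (range (\<lambda>k. (X \<omega> $ k)\<^sup>2))" by simp
        then have "Max (range (\<lambda>k. (X \<omega> $ k)\<^sup>2)) \<in> range (\<lambda>k. (X \<omega> $ k)\<^sup>2)" by (intro Max_in) auto
        then obtain l where "Max (range (\<lambda>k. (X \<omega> $ k)\<^sup>2)) = (X \<omega> $ l)\<^sup>2" by (rule rangeE)
        then show ?thesis using that by (metis Max_ge finite finite_imageI rangeI)
      qed
      have "(\<Sum>k\<in>UNIV. (X \<omega> $ k)\<^sup>2) \<le> ?p * (X \<omega> $ l)\<^sup>2"
        using l by (intro sum_bounded_above) auto
      then have "(\<Sum>k\<in>UNIV. (X \<omega> $ k)\<^sup>2) ^ 3 \<le> (?p * (X \<omega> $ l)\<^sup>2) ^ 3"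
        by (intro power_mono sum_nonneg) auto
      also have "\<dots> = ?p ^ 3 * (X \<omega> $ l) ^ 6" by (simp add: power_mult_distrib flip: power_mult)
      also have "(X \<omega> $ l) ^ 6 \<le> (\<Sum>k\<in>UNIV. (X \<omega> $ k) ^ 6)"
        by (rule member_le_sum) auto
      finally have "(\<Sum>k\<in>UNIV. (X \<omega> $ k)\<^sup>2) ^ 3 \<le> ?p ^ 3 * (\<Sum>k\<in>UNIV. (X \<omega> $ k) ^ 6)"
        by (simp add: mult_left_mono)
      then show ?thesis by (simp add: n2 flip: power_mult)
    qed
    then have "(1 + (norm (X \<omega>))\<^sup>2) ^ 3 \<le> 4 + 4 * (?p ^ 3 * (\<Sum>k\<in>UNIV. (X \<omega> $ k) ^ 6))"
      using cube[of "(norm (X \<omega>))\<^sup>2"] by simp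
    then show "norm ((1 + (norm (X \<omega>))\<^sup>2) ^ 3) \<le> norm (4 + 4 * (?p ^ 3 * (\<Sum>k\<in>UNIV. (X \<omega> $ k) ^ 6)))"
      by simp
  qed
qed simp

lemma measurable_inv_proj [measurable (raw)]:
  assumes "f \<in> borel_measurable N" "g \<in> borel_measurable N"
  shows "(\<lambda>\<omega>. inv_proj (f \<omega>) (g \<omega>)) \<in> borel_measurable N"
  using assms unfolding inv_proj_def by measurable

text \<open>The weight \<open>1 + |x|\<^sup>2\<close> accounts for the second moments that multiply the energies in the error bound.
Undoing the shrinking costs a power of \<open>1 + |x|\<close>, which is separated from the negative power of
\<open>x \<bullet> v\<close> by \<open>a b \<le> a\<^sup>2 + b\<^sup>2\<close>; sixth moments of \<open>X\<close> and the exponent \<open>-1/2\<close> of the projection suffice.\<close>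

lemma inv_proj_moment_bound:
  obtains C :: ennreal where "1 \<le> C" "C < \<infinity>"
    and "(\<integral>\<^sup>+\<omega>. ennreal (1 + (norm (X \<omega>))\<^sup>2) \<partial>M) \<le> C"
    and "\<And>v. v \<in> annulus \<Longrightarrow> (\<integral>\<^sup>+\<omega>. ennreal (1 + (norm (X \<omega>))\<^sup>2) * inv_proj (X \<omega>) v \<partial>M) \<le> C"
proof -
  obtain \<tau> where \<tau>: "0 < \<tau>" "\<And>v. v \<in> annulus \<Longrightarrow> \<tau> \<le> sqrt (v \<bullet> (cov *v v))"
    using variance_lower_bound by blast
  define D where "D = (\<integral>\<^sup>+y\<in>{-1..1}. inverse (ennreal (\<bar>y\<bar> powr (1/2))) \<partial>lborel)"
  define E where "E = (\<integral>\<^sup>+\<omega>. ennreal (2 * (1 + (norm (X \<omega>))\<^sup>2) ^ 3) \<partial>M)"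
  have D: "D < \<infinity>" unfolding D_def by (rule nn_integral_inverse_sqrt_finite)
  have "integrable M (\<lambda>\<omega>. 2 * (1 + (norm (X \<omega>))\<^sup>2) ^ 3)" using integrable_one_plus_norm_square_cube by simp
  from nn_integral_eq_integral[OF this] have E: "E < \<infinity>" by (simp add: E_def)
  define C where "C = E + (1 + ennreal (1 / \<tau>) * D)"
  have "C < \<infinity>" using D E by (simp add: C_def ennreal_mult_less_top)
  moreover have C1: "1 \<le> C"
    by (simp add: C_def add.left_commute[of E] add_increasing2)
  moreover have "(\<integral>\<^sup>+\<omega>. ennreal (1 + (norm (X \<omega>))\<^sup>2) \<partial>M) \<le> C"
  proof -
    have "(\<integral>\<^sup>+\<omega>. ennreal (1 + (norm (X \<omega>))\<^sup>2) \<partial>M) \<le> E"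
      unfolding E_def
    proof (intro nn_integral_mono ennreal_leI)
      fix \<omega>
      have "1 + (norm (X \<omega>))\<^sup>2 \<le> (1 + (norm (X \<omega>))\<^sup>2) ^ 3"
        by (rule self_le_power) auto
      moreover have "0 \<le> (1 + (norm (X \<omega>))\<^sup>2) ^ 3" by simp
      ultimately show "1 + (norm (X \<omega>))\<^sup>2 \<le> 2 * (1 + (norm (X \<omega>))\<^sup>2) ^ 3" by linarith
    qed
    then show ?thesis by (simp add: C_def add_increasing2)
  qed
  moreover have "(\<integral>\<^sup>+\<omega>. ennreal (1 + (norm (X \<omega>))\<^sup>2) * inv_proj (X \<omega>) v \<partial>M) \<le> C" if v: "v \<in> annulus" for v
  proof -
    define a where "a \<omega> = (1 + (norm (X \<omega>))\<^sup>2) * (1 + norm (X \<omega>)) powr (1/4)" for \<omega>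
    define b where "b \<omega> = inverse (ennreal (\<bar>v \<bullet> X \<omega>\<bar> powr (1/4)))" for \<omega>
    have ab: "ennreal (1 + (norm (X \<omega>))\<^sup>2) * inv_proj (X \<omega>) v = ennreal (a \<omega>) * b \<omega>" for \<omega>
    proof (cases "v \<bullet> X \<omega> = 0")
      case True
      have "1 + norm (X \<omega>) \<noteq> 0" by (simp add: add_nonneg_eq_0_iff)
      moreover have "1 + (norm (X \<omega>))\<^sup>2 > 0" by (simp add: add_pos_nonneg)
      ultimately show ?thesis using True
        by (simp add: a_def b_def inv_proj_def inner_commute ennreal_mult_top ennreal_eq_0_iff not_le zero_less_mult_iff add_pos_nonneg)
    next
      case False
      have n: "1 + norm (X \<omega>) > 0" by (simp add: add_pos_nonneg)
      have "inv_proj (X \<omega>) v = ennreal (inverse ((\<bar>v \<bullet> X \<omega>\<bar> / (1 + norm (X \<omega>))) powr (1/4)))"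
        using False n by (simp add: inv_proj_def inner_commute inverse_ennreal)
      also have "inverse ((\<bar>v \<bullet> X \<omega>\<bar> / (1 + norm (X \<omega>))) powr (1/4))
          = (1 + norm (X \<omega>)) powr (1/4) * inverse (\<bar>v \<bullet> X \<omega>\<bar> powr (1/4))"
        using n by (simp add: powr_divide field_simps)
      finally show ?thesis using False
        by (simp add: a_def b_def inverse_ennreal ennreal_mult mult.assoc)
    qed
    have a2: "ennreal (a \<omega>) * ennreal (a \<omega>) \<le> ennreal (2 * (1 + (norm (X \<omega>))\<^sup>2) ^ 3)" for \<omega>
    proof -
      define n where "n = norm (X \<omega>)"
      have n: "0 \<le> n" by (simp add: n_def)
      have "a \<omega> \<le> (1 + n\<^sup>2) * (1 + n)"
      proof -
        have "(1 + n) powr (1/4) \<le> (1 + n) powr 1" using n by (intro powr_mono) auto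
        then show ?thesis using n by (auto simp: a_def n_def intro!: mult_left_mono)
      qed
      moreover have "0 \<le> a \<omega>" by (simp add: a_def)
      ultimately have "a \<omega> * a \<omega> \<le> ((1 + n\<^sup>2) * (1 + n)) * ((1 + n\<^sup>2) * (1 + n))"
        by (intro mult_mono) (use n in auto)
      also have "\<dots> = (1 + n\<^sup>2)\<^sup>2 * (1 + n)\<^sup>2" by (simp add: power2_eq_square mult_ac)
      also have "\<dots> \<le> (1 + n\<^sup>2)\<^sup>2 * (2 * (1 + n\<^sup>2))"
      proof (rule mult_left_mono)
        have "0 \<le> (1 - n)\<^sup>2" by simp
        then show "(1 + n)\<^sup>2 \<le> 2 * (1 + n\<^sup>2)" by (simp add: power2_eq_square algebra_simps)
      qed simp
      also have "\<dots> = 2 * (1 + n\<^sup>2) ^ 3" by (simp add: power2_eq_square power3_eq_cube)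
      finally show ?thesis using \<open>0 \<le> a \<omega>\<close> by (simp add: n_def ennreal_mult[symmetric] ennreal_leI)
    qed
    have b2: "b \<omega> * b \<omega> = inverse (ennreal (\<bar>v \<bullet> X \<omega>\<bar> powr (1/2)))" for \<omega>
    proof (cases "v \<bullet> X \<omega> = 0")
      case True
      then show ?thesis by (simp add: b_def ennreal_mult_top)
    next
      case False
      then show ?thesis
        by (simp add: b_def inverse_ennreal ennreal_mult[symmetric] inverse_mult_distrib[symmetric] powr_add[symmetric]
            del: inverse_mult_distrib)
    qed
    have "(\<integral>\<^sup>+\<omega>. ennreal (1 + (norm (X \<omega>))\<^sup>2) * inv_proj (X \<omega>) v \<partial>M)
        \<le> (\<integral>\<^sup>+\<omega>. ennreal (2 * (1 + (norm (X \<omega>))\<^sup>2) ^ 3) + inverse (ennreal (\<bar>v \<bullet> X \<omega>\<bar> powr (1/2))) \<partial>M)"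
      unfolding ab
    proof (rule nn_integral_mono)
      fix \<omega>
      have "ennreal (a \<omega>) * b \<omega> \<le> ennreal (a \<omega>) * ennreal (a \<omega>) + b \<omega> * b \<omega>"
        by (rule ennreal_mult_le_sum_squares)
      also have "\<dots> \<le> ennreal (2 * (1 + (norm (X \<omega>))\<^sup>2) ^ 3) + inverse (ennreal (\<bar>v \<bullet> X \<omega>\<bar> powr (1/2)))"
        unfolding b2 by (intro add_right_mono a2)
      finally show "ennreal (a \<omega>) * b \<omega> \<le> ennreal (2 * (1 + (norm (X \<omega>))\<^sup>2) ^ 3) + inverse (ennreal (\<bar>v \<bullet> X \<omega>\<bar> powr (1/2)))" .
    qed
    also have "\<dots> = E + (\<integral>\<^sup>+\<omega>. inverse (ennreal (\<bar>v \<bullet> X \<omega>\<bar> powr (1/2))) \<partial>M)"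
      unfolding E_def by (rule nn_integral_add) measurable
    also have "(\<integral>\<^sup>+\<omega>. inverse (ennreal (\<bar>v \<bullet> X \<omega>\<bar> powr (1/2))) \<partial>M)
        = (\<integral>\<^sup>+y. inverse (ennreal (\<bar>y\<bar> powr (1/2))) \<partial>distr M borel (\<lambda>\<omega>. v \<bullet> X \<omega>))"
      by (subst nn_integral_distr) auto
    also have "\<dots> \<le> 1 + ennreal (1 / \<tau>) * D"
      unfolding distr_inner D_def using \<tau>(1) \<tau>(2)[OF v] by (rule normal_law_inverse_sqrt_bound)
    finally show ?thesis by (simp add: C_def add_left_mono)
  qed
  ultimately show ?thesis using that by blast
qed

end

section \<open>The sample and the sign symmetry of the noise\<close>

lemma borel_measurable_fst_prod [measurable (raw)]:
  fixes f :: "'a \<Rightarrow> 'b::second_countable_topology \<times> 'c::second_countable_topology"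
  assumes "f \<in> borel_measurable M" shows "(\<lambda>\<omega>. fst (f \<omega>)) \<in> borel_measurable M"
  using assms by (rule borel_measurable_continuous_on[OF continuous_on_fst[OF continuous_on_id]])

lemma borel_measurable_snd_prod [measurable (raw)]:
  fixes f :: "'a \<Rightarrow> 'b::second_countable_topology \<times> 'c::second_countable_topology"
  assumes "f \<in> borel_measurable M" shows "(\<lambda>\<omega>. snd (f \<omega>)) \<in> borel_measurable M"
  using assms by (rule borel_measurable_continuous_on[OF continuous_on_snd[OF continuous_on_id]])

lemma (in prob_space) indep_borel_distr_pair:
  fixes U :: "'a \<Rightarrow> 'b::second_countable_topology" and V :: "'a \<Rightarrow> 'c::second_countable_topology"
  assumes ind: "indep_borel M U V"
  shows "distr M borel (\<lambda>\<omega>. (U \<omega>, V \<omega>)) = distr M borel U \<Otimes>\<^sub>M distr M borel V"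
proof (rule pair_measure_eqI[symmetric])
  have [measurable]: "U \<in> borel_measurable M" "V \<in> borel_measurable M" using ind by (auto simp: indep_borel_def)
  interpret U: prob_space "distr M borel U" by (rule prob_space_distr) simp
  interpret V: prob_space "distr M borel V" by (rule prob_space_distr) simp
  show "sigma_finite_measure (distr M borel U)" "sigma_finite_measure (distr M borel V)" by unfold_locales
  have p: "sets (borel \<Otimes>\<^sub>M borel :: ('b \<times> 'c) measure) = sets borel" by (simp only: borel_prod)
  show "sets (distr M borel U \<Otimes>\<^sub>M distr M borel V) = sets (distr M borel (\<lambda>\<omega>. (U \<omega>, V \<omega>)))"
    using p by (simp cong: sets_pair_measure_cong)
  fix A B assume "A \<in> sets (distr M borel U)" "B \<in> sets (distr M borel V)"
  then have A[measurable]: "A \<in> sets borel" and B[measurable]: "B \<in> sets borel" by auto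
  have "A \<times> B \<in> sets (borel \<Otimes>\<^sub>M borel)" using A B by (rule pair_measureI)
  then have AB: "A \<times> B \<in> sets borel" using p by simp
  have "prob ((U -` A \<inter> space M) \<inter> (V -` B \<inter> space M)) = prob (U -` A \<inter> space M) * prob (V -` B \<inter> space M)"
    using ind A B by (intro indep_setD) (auto simp: indep_borel_def)
  moreover have "(\<lambda>\<omega>. (U \<omega>, V \<omega>)) -` (A \<times> B) \<inter> space M = (U -` A \<inter> space M) \<inter> (V -` B \<inter> space M)" by auto
  ultimately show "emeasure (distr M borel U) A * emeasure (distr M borel V) B
      = emeasure (distr M borel (\<lambda>\<omega>. (U \<omega>, V \<omega>))) (A \<times> B)"
    using AB by (simp add: emeasure_distr emeasure_eq_measure ennreal_mult[symmetric])
qed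

lemma (in prob_space) indep_borel_uminus:
  fixes V :: "'a \<Rightarrow> 'c::real_normed_vector"
  assumes ind: "indep_borel M U V"
  shows "indep_borel M U (\<lambda>\<omega>. - V \<omega>)"
  unfolding indep_borel_def
proof (intro conjI)
  have V[measurable]: "V \<in> borel_measurable M" using ind by (simp add: indep_borel_def)
  show "U \<in> borel_measurable M" using ind by (simp add: indep_borel_def)
  show "(\<lambda>\<omega>. - V \<omega>) \<in> borel_measurable M"
    using V by (rule borel_measurable_continuous_on[OF continuous_on_minus[OF continuous_on_id]])
  have um: "uminus -` B \<in> sets borel" if "B \<in> sets borel" for B :: "'c set"
    using that by (intro measurable_sets_borel[OF borel_measurable_continuous_onI]) (auto intro: continuous_intros)
  have "{(\<lambda>\<omega>. - V \<omega>) -` B \<inter> space M | B. B \<in> sets borel} \<subseteq> {V -` B \<inter> space M | B. B \<in> sets borel}"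
  proof safe
    fix B :: "'c set" assume "B \<in> sets borel"
    then show "\<exists>B'. (\<lambda>\<omega>. - V \<omega>) -` B \<inter> space M = V -` B' \<inter> space M \<and> B' \<in> sets borel"
      using um by (intro exI[of _ "uminus -` B"]) auto
  qed
  then show "indep_set {U -` A \<inter> space M | A. A \<in> sets borel} {(\<lambda>\<omega>. - V \<omega>) -` B \<inter> space M | B. B \<in> sets borel}"
  proof -
    assume sub: "{(\<lambda>\<omega>. - V \<omega>) -` B \<inter> space M | B. B \<in> sets borel} \<subseteq> {V -` B \<inter> space M | B. B \<in> sets borel}"
    have i: "indep_set {U -` A \<inter> space M | A. A \<in> sets borel} {V -` B \<inter> space M | B. B \<in> sets borel}"
      using ind by (simp add: indep_borel_def)
    show ?thesis
      unfolding indep_set_def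
      by (rule indep_sets_mono_sets[OF i[unfolded indep_set_def]]) (use sub in \<open>simp split: bool.split\<close>)
  qed
qed

text \<open>An i.i.d. sample of pairs of covariates and noise. The indices \<open>Inl i\<close> are the training observations
and \<open>Inr i\<close> the test observations. Working with the noise instead of the response makes the
independence of its two components available.\<close>

locale gaussian_regression = gaussian_design M X for M :: "'a measure" and X :: "'a \<Rightarrow> real ^ 'p::finite" +
  fixes \<epsilon> :: "'a \<Rightarrow> real" and \<sigma> :: real and N :: "nat + nat \<Rightarrow> 'a \<Rightarrow> (real ^ 'p) \<times> real"
  assumes noise_measurable [measurable]: "\<epsilon> \<in> borel_measurable M"
    and noise_law: "distr M borel \<epsilon> = normal_law 0 \<sigma>"
    and noise_indep: "indep_borel M X \<epsilon>"
    and sample_indep: "indep_vars (\<lambda>_. borel) N UNIV"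
    and sample_law: "\<And>l. distr M borel (N l) = distr M borel (\<lambda>\<omega>. (X \<omega>, \<epsilon> \<omega>))"
begin

abbreviation samples :: "(nat + nat \<Rightarrow> (real ^ 'p) \<times> real) measure" where
  "samples \<equiv> Pi\<^sub>M UNIV (\<lambda>_. borel)"

lemma sample_measurable [measurable]: "N l \<in> borel_measurable M"
  using sample_indep by (simp add: indep_vars_def)

lemma family_measurable [measurable]: "(\<lambda>\<omega> l. N l \<omega>) \<in> measurable M samples"
  by (rule measurable_PiM_single') (auto simp: space_PiM)

lemma component_measurable [measurable]: "(\<lambda>d. d l) \<in> measurable samples borel"
  by (rule measurable_component_singleton) simp

lemma nn_integral_sample:
  assumes g[measurable]: "g \<in> borel_measurable borel"
  shows "(\<integral>\<^sup>+\<omega>. g (N l \<omega>) \<partial>M) = (\<integral>\<^sup>+\<omega>. g (X \<omega>, \<epsilon> \<omega>) \<partial>M)"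
proof -
  have "(\<integral>\<^sup>+\<omega>. g (N l \<omega>) \<partial>M) = (\<integral>\<^sup>+z. g z \<partial>distr M borel (N l))"
    by (subst nn_integral_distr) auto
  also have "\<dots> = (\<integral>\<^sup>+\<omega>. g (X \<omega>, \<epsilon> \<omega>) \<partial>M)"
    unfolding sample_law by (subst nn_integral_distr) auto
  finally show ?thesis .
qed

lemma nn_integral_design_noise:
  fixes f :: "real ^ 'p \<Rightarrow> ennreal" and g :: "real \<Rightarrow> ennreal"
  assumes f[measurable]: "f \<in> borel_measurable borel" and g[measurable]: "g \<in> borel_measurable borel"
  shows "(\<integral>\<^sup>+\<omega>. f (X \<omega>) * g (\<epsilon> \<omega>) \<partial>M) = (\<integral>\<^sup>+\<omega>. f (X \<omega>) \<partial>M) * (\<integral>\<^sup>+\<omega>. g (\<epsilon> \<omega>) \<partial>M)"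
proof -
  interpret PX: prob_space "distr M borel X" by (rule prob_space_distr) simp
  interpret Pe: prob_space "distr M borel \<epsilon>" by (rule prob_space_distr) simp
  interpret P: pair_sigma_finite "distr M borel X" "distr M borel \<epsilon>" by unfold_locales
  have [measurable]: "f \<in> borel_measurable (distr M borel X)" "g \<in> borel_measurable (distr M borel \<epsilon>)" by simp_all
  have m: "(\<lambda>z. f (fst z) * g (snd z)) \<in> borel_measurable borel"
    by measurable
  have "(\<integral>\<^sup>+\<omega>. f (X \<omega>) * g (\<epsilon> \<omega>) \<partial>M) = (\<integral>\<^sup>+z. f (fst z) * g (snd z) \<partial>distr M borel (\<lambda>\<omega>. (X \<omega>, \<epsilon> \<omega>)))"
    using m by (subst nn_integral_distr) auto
  also have "\<dots> = (\<integral>\<^sup>+x. \<integral>\<^sup>+e. f x * g e \<partial>distr M borel \<epsilon> \<partial>distr M borel X)"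
    unfolding indep_borel_distr_pair[OF noise_indep]
    by (subst Pe.nn_integral_fst[symmetric]) (auto simp: split_beta')
  also have "\<dots> = (\<integral>\<^sup>+x. f x * (\<integral>\<^sup>+e. g e \<partial>distr M borel \<epsilon>) \<partial>distr M borel X)"
    by (simp add: nn_integral_cmult)
  also have "\<dots> = (\<integral>\<^sup>+x. f x \<partial>distr M borel X) * (\<integral>\<^sup>+e. g e \<partial>distr M borel \<epsilon>)"
    by (simp add: nn_integral_multc)
  finally show ?thesis by (simp add: nn_integral_distr)
qed

text \<open>Change of the sign of the noise of the observation \<open>l0\<close>.\<close>

definition flip :: "nat + nat \<Rightarrow> (nat + nat \<Rightarrow> (real ^ 'p) \<times> real) \<Rightarrow> nat + nat \<Rightarrow> (real ^ 'p) \<times> real" where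
  "flip l0 d l = (if l = l0 then (fst (d l), - snd (d l)) else d l)"

text \<open>The centred normal noise is symmetric and independent of the covariates, so the sign change
preserves the law of the sample.\<close>

lemma nn_integral_flip:
  assumes F[measurable]: "F \<in> borel_measurable samples"
  shows "(\<integral>\<^sup>+\<omega>. F (flip l0 (\<lambda>l. N l \<omega>)) \<partial>M) = (\<integral>\<^sup>+\<omega>. F (\<lambda>l. N l \<omega>) \<partial>M)"
proof -
  define g :: "nat + nat \<Rightarrow> (real ^ 'p) \<times> real \<Rightarrow> (real ^ 'p) \<times> real"
    where "g l z = (if l = l0 then (fst z, - snd z) else z)" for l z
  have g[measurable]: "g l \<in> borel_measurable borel" for l
  proof (cases "l = l0")
    case True
    have "(\<lambda>z :: (real ^ 'p) \<times> real. (fst z, - snd z)) \<in> borel_measurable borel" by measurable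
    then show ?thesis using True by (simp add: g_def[abs_def])
  qed (simp add: g_def[abs_def])
  have law: "distr M borel (\<lambda>\<omega>. g l (N l \<omega>)) = distr M borel (N l)" for l
  proof (cases "l = l0")
    case True
    have "distr M borel (\<lambda>\<omega>. g l (N l \<omega>)) = distr (distr M borel (N l)) borel (g l)"
      by (subst distr_distr) (auto simp: comp_def)
    also have "\<dots> = distr M borel (\<lambda>\<omega>. (X \<omega>, - \<epsilon> \<omega>))"
      unfolding sample_law by (subst distr_distr) (auto simp: comp_def g_def True)
    also have "\<dots> = distr M borel X \<Otimes>\<^sub>M distr M borel (\<lambda>\<omega>. - \<epsilon> \<omega>)"
      by (rule indep_borel_distr_pair[OF indep_borel_uminus[OF noise_indep]])
    also have "distr M borel (\<lambda>\<omega>. - \<epsilon> \<omega>) = distr (distr M borel \<epsilon>) borel uminus"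
      by (subst distr_distr) (auto simp: comp_def)
    also have "\<dots> = distr M borel \<epsilon>" by (simp add: noise_law normal_law_reflect)
    also have "distr M borel X \<Otimes>\<^sub>M distr M borel \<epsilon> = distr M borel (N l)"
      unfolding sample_law by (rule indep_borel_distr_pair[OF noise_indep, symmetric])
    finally show ?thesis .
  qed (simp add: g_def)
  have "indep_vars (\<lambda>_. borel) (\<lambda>l \<omega>. g l (N l \<omega>)) UNIV"
    by (rule indep_vars_compose2[OF sample_indep]) measurable
  then have "distr M samples (\<lambda>\<omega>. \<lambda>l\<in>UNIV. g l (N l \<omega>)) = (\<Pi>\<^sub>M l\<in>UNIV. distr M borel (\<lambda>\<omega>. g l (N l \<omega>)))"
    by (subst (asm) indep_vars_iff_distr_eq_PiM) auto
  also have "\<dots> = (\<Pi>\<^sub>M l\<in>UNIV. distr M borel (N l))" by (simp only: law)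
  also have "\<dots> = distr M samples (\<lambda>\<omega>. \<lambda>l\<in>UNIV. N l \<omega>)"
    using sample_indep by (subst (asm) indep_vars_iff_distr_eq_PiM) auto
  finally have eq: "distr M samples (\<lambda>\<omega> l. g l (N l \<omega>)) = distr M samples (\<lambda>\<omega> l. N l \<omega>)"
    by (simp only: restrict_UNIV)
  have gm: "(\<lambda>\<omega> l. g l (N l \<omega>)) \<in> measurable M samples"
    by (rule measurable_PiM_single') (auto simp: space_PiM)
  have "(\<integral>\<^sup>+\<omega>. F (flip l0 (\<lambda>l. N l \<omega>)) \<partial>M) = (\<integral>\<^sup>+\<omega>. F (\<lambda>l. g l (N l \<omega>)) \<partial>M)"
    by (simp add: flip_def[abs_def] g_def[abs_def])
  also have "\<dots> = (\<integral>\<^sup>+d. F d \<partial>distr M samples (\<lambda>\<omega> l. g l (N l \<omega>)))"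
    by (rule nn_integral_distr[symmetric, OF gm]) simp
  also have "\<dots> = (\<integral>\<^sup>+\<omega>. F (\<lambda>l. N l \<omega>) \<partial>M)"
    unfolding eq by (rule nn_integral_distr[OF family_measurable]) simp
  finally show ?thesis .
qed

text \<open>Symmetry removes the cross term of \<open>|A + B|\<^sup>2\<close> when \<open>B\<close> is odd in one of the noise variables. By the
parallelogram law this needs no integrability.\<close>

lemma nn_integral_flip_parallelogram:
  fixes A B :: "(nat + nat \<Rightarrow> (real ^ 'p) \<times> real) \<Rightarrow> 'e::euclidean_space"
  assumes W[measurable]: "W \<in> borel_measurable samples"
    and A[measurable]: "A \<in> borel_measurable samples" and B[measurable]: "B \<in> borel_measurable samples"
    and fW: "\<And>d. W (flip l d) = W d" and fA: "\<And>d. A (flip l d) = A d" and fB: "\<And>d. B (flip l d) = - B d"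
  defines "n \<equiv> \<lambda>\<omega> l. N l \<omega>"
  shows "(\<integral>\<^sup>+\<omega>. W (n \<omega>) * ennreal ((norm (A (n \<omega>) + B (n \<omega>)))\<^sup>2) \<partial>M)
    = (\<integral>\<^sup>+\<omega>. W (n \<omega>) * ennreal ((norm (A (n \<omega>)))\<^sup>2) \<partial>M)
    + (\<integral>\<^sup>+\<omega>. W (n \<omega>) * ennreal ((norm (B (n \<omega>)))\<^sup>2) \<partial>M)" (is "?L = ?A + ?B")
proof -
  have [measurable]: "n \<in> measurable M samples" unfolding n_def by measurable
  have "?L = (\<integral>\<^sup>+\<omega>. W (n \<omega>) * ennreal ((norm (A (n \<omega>) - B (n \<omega>)))\<^sup>2) \<partial>M)"
    using nn_integral_flip[of "\<lambda>d. W d * ennreal ((norm (A d + B d))\<^sup>2)" l] by (simp add: fW fA fB n_def)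
  then have "?L + ?L = (\<integral>\<^sup>+\<omega>. W (n \<omega>) * ennreal ((norm (A (n \<omega>) + B (n \<omega>)))\<^sup>2)
      + W (n \<omega>) * ennreal ((norm (A (n \<omega>) - B (n \<omega>)))\<^sup>2) \<partial>M)"
    by (subst nn_integral_add) auto
  also have "\<dots> = (\<integral>\<^sup>+\<omega>. 2 * (W (n \<omega>) * ennreal ((norm (A (n \<omega>)))\<^sup>2)) + 2 * (W (n \<omega>) * ennreal ((norm (B (n \<omega>)))\<^sup>2)) \<partial>M)"
  proof (rule nn_integral_cong)
    fix \<omega>
    let ?a = "A (n \<omega>)" and ?b = "B (n \<omega>)"
    have "ennreal ((norm (?a + ?b))\<^sup>2) + ennreal ((norm (?a - ?b))\<^sup>2) = ennreal (2 * (norm ?a)\<^sup>2 + 2 * (norm ?b)\<^sup>2)"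
    proof -
      have "(norm (?a + ?b))\<^sup>2 + (norm (?a - ?b))\<^sup>2 = 2 * (norm ?a)\<^sup>2 + 2 * (norm ?b)\<^sup>2"
        unfolding power2_norm_eq_inner by (simp add: inner_add_left inner_add_right inner_diff_left inner_diff_right)
      then show ?thesis by (simp only: ennreal_plus[symmetric] zero_le_power2)
    qed
    also have "\<dots> = 2 * ennreal ((norm ?a)\<^sup>2) + 2 * ennreal ((norm ?b)\<^sup>2)"
      by (simp add: ennreal_plus ennreal_mult)
    finally show "W (n \<omega>) * ennreal ((norm (?a + ?b))\<^sup>2) + W (n \<omega>) * ennreal ((norm (?a - ?b))\<^sup>2)
      = 2 * (W (n \<omega>) * ennreal ((norm ?a)\<^sup>2)) + 2 * (W (n \<omega>) * ennreal ((norm ?b)\<^sup>2))"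
      by (simp only: distrib_left[symmetric] mult.left_commute)
  qed
  also have "\<dots> = 2 * ?A + 2 * ?B"
    by (subst nn_integral_add) (auto simp: nn_integral_cmult)
  finally have "2 * ?L = 2 * (?A + ?B)" by (simp only: mult_2[symmetric] distrib_left)
  then show ?thesis by (subst (asm) ennreal_mult_cancel_left) simp
qed

end

section \<open>Expected energy\<close>

context gaussian_regression
begin

lemma noise_second_moment_finite: "(\<integral>\<^sup>+\<omega>. ennreal (1 + (\<epsilon> \<omega>)\<^sup>2) \<partial>M) < \<infinity>"
proof -
  have "integrable (distr M borel \<epsilon>) (\<lambda>z. z ^ 2)"
    unfolding noise_law by (rule integrable_normal_law_power)
  then have "integrable M (\<lambda>\<omega>. 1 + (\<epsilon> \<omega>)\<^sup>2)" by (subst (asm) integrable_distr_eq) auto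
  from nn_integral_eq_integral[OF this] show ?thesis by simp
qed

lemma nn_integral_sample_prod:
  assumes D: "finite D" and h[measurable]: "\<And>l. h l \<in> borel_measurable borel"
  shows "(\<integral>\<^sup>+\<omega>. (\<Prod>l\<in>D. h l (N l \<omega>)) \<partial>M) = (\<Prod>l\<in>D. \<integral>\<^sup>+\<omega>. h l (N l \<omega>) \<partial>M)"
proof -
  have "indep_vars (\<lambda>_. borel) (\<lambda>l \<omega>. h l (N l \<omega>)) D"
    by (rule indep_vars_subset[OF indep_vars_compose2[OF sample_indep]]) auto
  then show ?thesis using D by (intro indep_vars_nn_integral) auto
qed

text \<open>A common upper bound, at least \<open>1\<close> everywhere, for \<open>|x|\<^sup>2\<close> and \<open>|e x|\<^sup>2\<close> at an observation \<open>(x, e)\<close>.\<close>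

definition sample_weight :: "(real ^ 'p) \<times> real \<Rightarrow> ennreal" where
  "sample_weight z = ennreal ((1 + (norm (fst z))\<^sup>2) * (1 + (snd z)\<^sup>2))"

lemma sample_weight_measurable [measurable (raw)]:
  "f \<in> borel_measurable L \<Longrightarrow> (\<lambda>\<omega>. sample_weight (f \<omega>)) \<in> borel_measurable L"
proof -
  assume f: "f \<in> borel_measurable L"
  note [measurable] = borel_measurable_fst_prod[OF f] borel_measurable_snd_prod[OF f]
  show ?thesis unfolding sample_weight_def by measurable
qed

lemma sample_weight_ge_1: "1 \<le> sample_weight z"
proof -
  have "1 * 1 \<le> (1 + (norm (fst z))\<^sup>2) * (1 + (snd z)\<^sup>2)" by (rule mult_mono) auto
  then show ?thesis by (simp add: sample_weight_def)
qed

text \<open>The training index \<open>i\<close> may or may not belong to the block \<open>c\<close>; both cases are covered because the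
moment bound for a single factor includes the weight.\<close>

lemma weighted_inv_proj_prod_bound:
  obtains C :: ennreal where "1 \<le> C" "C < \<infinity>"
    and "\<And>c i t v. finite c \<Longrightarrow> v \<in> annulus \<Longrightarrow>
      (\<integral>\<^sup>+\<omega>. sample_weight (N (Inr t) \<omega>) * sample_weight (N (Inl i) \<omega>) *
         (\<Prod>l\<in>c. inv_proj (fst (N (Inl l) \<omega>)) v) \<partial>M) \<le> C ^ (card c + 2)"
proof -
  obtain C0 where C0: "1 \<le> C0" "C0 < \<infinity>"
    "(\<integral>\<^sup>+\<omega>. ennreal (1 + (norm (X \<omega>))\<^sup>2) \<partial>M) \<le> C0"
    "\<And>v. v \<in> annulus \<Longrightarrow> (\<integral>\<^sup>+\<omega>. ennreal (1 + (norm (X \<omega>))\<^sup>2) * inv_proj (X \<omega>) v \<partial>M) \<le> C0"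
    using inv_proj_moment_bound by blast
  define s where "s = (\<integral>\<^sup>+\<omega>. ennreal (1 + (\<epsilon> \<omega>)\<^sup>2) \<partial>M)"
  define C where "C = C0 * s"
  have s1: "1 \<le> s"
  proof -
    have "(\<integral>\<^sup>+\<omega>. 1 \<partial>M) \<le> s" unfolding s_def by (rule nn_integral_mono) simp
    then show ?thesis by (simp add: emeasure_space_1)
  qed
  have "C < \<infinity>"
    using C0(2) noise_second_moment_finite by (simp add: C_def s_def ennreal_mult_less_top)
  moreover have C1: "1 \<le> C"
    using mult_mono[OF C0(1) s1] by (simp add: C_def)
  moreover have "(\<integral>\<^sup>+\<omega>. sample_weight (N (Inr t) \<omega>) * sample_weight (N (Inl i) \<omega>) *
         (\<Prod>l\<in>c. inv_proj (fst (N (Inl l) \<omega>)) v) \<partial>M) \<le> C ^ (card c + 2)"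
    if c: "finite c" and v: "v \<in> annulus" for c i t v
  proof -
    define D :: "(nat + nat) set" where "D = insert (Inr t) (Inl ` insert i c)"
    define r :: "nat + nat \<Rightarrow> (real ^ 'p) \<times> real \<Rightarrow> ennreal"
      where "r l z = (if l \<in> Inl ` c then inv_proj (fst z) v else 1)" for l z
    have D: "finite D" "card D \<le> card c + 2"
    proof -
      show "finite D" using c by (simp add: D_def)
      have "card D \<le> Suc (card (Inl ` insert i c :: (nat + nat) set))" using c by (simp add: D_def card_insert_if)
      also have "card (Inl ` insert i c :: (nat + nat) set) \<le> card (insert i c)" using c by (intro card_image_le) simp
      also have "card (insert i c) \<le> Suc (card c)" using c by (simp add: card_insert_if)
      finally show "card D \<le> card c + 2" by simp
    qed
    have rm[measurable]: "r l \<in> borel_measurable borel" for l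
      unfolding r_def[abs_def] by (cases "l \<in> Inl ` c") simp_all
    have "(\<integral>\<^sup>+\<omega>. sample_weight (N (Inr t) \<omega>) * sample_weight (N (Inl i) \<omega>) *
         (\<Prod>l\<in>c. inv_proj (fst (N (Inl l) \<omega>)) v) \<partial>M)
      \<le> (\<integral>\<^sup>+\<omega>. (\<Prod>l\<in>D. sample_weight (N l \<omega>) * r l (N l \<omega>)) \<partial>M)"
    proof (rule nn_integral_mono)
      fix \<omega>
      have "sample_weight (N (Inr t) \<omega>) * sample_weight (N (Inl i) \<omega>) = (\<Prod>l\<in>{Inr t, Inl i}. sample_weight (N l \<omega>))"
        by simp
      also have "\<dots> \<le> (\<Prod>l\<in>D. sample_weight (N l \<omega>))"
      proof -
        let ?R = "D - {Inr t, Inl i}"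
        have "(\<Prod>l\<in>?R. 1) \<le> (\<Prod>l\<in>?R. sample_weight (N l \<omega>))"
          by (rule prod_mono_ennreal) (rule sample_weight_ge_1)
        then have "1 * (\<Prod>l\<in>{Inr t, Inl i}. sample_weight (N l \<omega>))
            \<le> (\<Prod>l\<in>?R. sample_weight (N l \<omega>)) * (\<Prod>l\<in>{Inr t, Inl i}. sample_weight (N l \<omega>))"
          by (intro mult_right_mono) simp_all
        moreover have "{Inr t, Inl i} \<subseteq> D" by (auto simp: D_def)
        ultimately show ?thesis using D(1) by (simp only: prod.subset_diff mult_1)
      qed
      finally have 1: "sample_weight (N (Inr t) \<omega>) * sample_weight (N (Inl i) \<omega>) \<le> (\<Prod>l\<in>D. sample_weight (N l \<omega>))" .
      have "(\<Prod>l\<in>D. r l (N l \<omega>)) = (\<Prod>l\<in>Inl ` c. r l (N l \<omega>))"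
        using D(1) by (intro prod.mono_neutral_right) (auto simp: D_def r_def)
      also have "\<dots> = (\<Prod>l\<in>c. inv_proj (fst (N (Inl l) \<omega>)) v)"
        by (subst prod.reindex) (auto simp: r_def)
      finally have 2: "(\<Prod>l\<in>D. r l (N l \<omega>)) = (\<Prod>l\<in>c. inv_proj (fst (N (Inl l) \<omega>)) v)" .
      show "sample_weight (N (Inr t) \<omega>) * sample_weight (N (Inl i) \<omega>) * (\<Prod>l\<in>c. inv_proj (fst (N (Inl l) \<omega>)) v)
        \<le> (\<Prod>l\<in>D. sample_weight (N l \<omega>) * r l (N l \<omega>))"
        unfolding prod.distrib 2 using 1 by (intro mult_right_mono) auto
    qed
    also have "\<dots> = (\<Prod>l\<in>D. \<integral>\<^sup>+\<omega>. sample_weight (N l \<omega>) * r l (N l \<omega>) \<partial>M)"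
      using D(1) by (intro nn_integral_sample_prod) measurable
    also have "\<dots> \<le> (\<Prod>l\<in>D. C)"
    proof (rule prod_mono_ennreal)
      fix l :: "nat + nat"
      define g where "g x = ennreal (1 + (norm x)\<^sup>2) * (if l \<in> Inl ` c then inv_proj x v else 1)" for x
      have gm: "g \<in> borel_measurable borel"
        unfolding g_def[abs_def] by (cases "l \<in> Inl ` c") simp_all
      have "(\<integral>\<^sup>+\<omega>. sample_weight (N l \<omega>) * r l (N l \<omega>) \<partial>M) = (\<integral>\<^sup>+\<omega>. sample_weight (X \<omega>, \<epsilon> \<omega>) * r l (X \<omega>, \<epsilon> \<omega>) \<partial>M)"
        by (rule nn_integral_sample[of "\<lambda>z. sample_weight z * r l z"]) measurable
      also have "\<dots> = (\<integral>\<^sup>+\<omega>. g (X \<omega>) * ennreal (1 + (\<epsilon> \<omega>)\<^sup>2) \<partial>M)"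
        by (rule nn_integral_cong) (simp add: sample_weight_def r_def g_def ennreal_mult mult_ac)
      also have "\<dots> = (\<integral>\<^sup>+\<omega>. g (X \<omega>) \<partial>M) * s"
        unfolding s_def by (rule nn_integral_design_noise[OF gm]) measurable
      also have "(\<integral>\<^sup>+\<omega>. g (X \<omega>) \<partial>M) \<le> C0"
        using C0(3) C0(4)[OF v] by (cases "l \<in> Inl ` c") (simp_all add: g_def)
      finally show "(\<integral>\<^sup>+\<omega>. sample_weight (N l \<omega>) * r l (N l \<omega>) \<partial>M) \<le> C"
        unfolding C_def by (simp add: mult_right_mono)
    qed
    also have "\<dots> = C ^ card D" by (rule prod_constant)
    also have "\<dots> \<le> C ^ (card c + 2)" using C1 D(2) by (rule power_increasing[rotated])
    finally show ?thesis .
  qed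
  ultimately show ?thesis using that by blast
qed

abbreviation design :: "'a \<Rightarrow> nat \<Rightarrow> real ^ 'p" where
  "design \<omega> \<equiv> \<lambda>l. fst (N (Inl l) \<omega>)"

lemma annulus_measurable [measurable]: "annulus \<in> sets (borel :: (real ^ 'p) measure)"
  unfolding annulus_def by measurable

lemma emeasure_annulus_finite: "emeasure lborel (annulus :: (real ^ 'p) set) < \<infinity>"
proof -
  have "bounded (annulus :: (real ^ 'p) set)"
    by (rule boundedI[of _ "3/2"]) (simp add: annulus_def)
  then show ?thesis by (rule emeasure_bounded_finite)
qed

lemma energy_measurable [measurable]:
  assumes c: "finite c" and x[measurable]: "\<And>l. x l \<in> borel_measurable L"
  shows "(\<lambda>\<omega>. energy c (\<lambda>l. x l \<omega> :: real ^ 'p)) \<in> borel_measurable L"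
proof -
  have [measurable]: "(\<lambda>z. x l (fst z)) \<in> borel_measurable (L \<Otimes>\<^sub>M lborel)" for l
    by (rule measurable_compose[OF measurable_fst x])
  have "(\<lambda>(\<omega>, v). (\<Prod>l\<in>c. inv_proj (x l \<omega>) v) * indicator annulus v) \<in> borel_measurable (L \<Otimes>\<^sub>M lborel)"
    unfolding split_beta' by measurable
  then show ?thesis
    unfolding energy_def by (intro lborel.borel_measurable_nn_integral) simp
qed

text \<open>The bound depends neither on the position of the block nor on the weighted observations.\<close>

lemma weighted_energy_bound:
  obtains C :: ennreal where "C < \<infinity>"
    and "\<And>c i t. finite c \<Longrightarrow> card c = 4 * (CARD('p) + 4) \<Longrightarrow>
      (\<integral>\<^sup>+\<omega>. sample_weight (N (Inr t) \<omega>) * sample_weight (N (Inl i) \<omega>) * energy c (design \<omega>) \<partial>M) \<le> C"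
proof -
  obtain C where C: "1 \<le> C" "C < \<infinity>"
    "\<And>c i t v. finite c \<Longrightarrow> v \<in> annulus \<Longrightarrow>
      (\<integral>\<^sup>+\<omega>. sample_weight (N (Inr t) \<omega>) * sample_weight (N (Inl i) \<omega>) *
         (\<Prod>l\<in>c. inv_proj (fst (N (Inl l) \<omega>)) v) \<partial>M) \<le> C ^ (card c + 2)"
    using weighted_inv_proj_prod_bound by blast
  let ?V = "emeasure lborel (annulus :: (real ^ 'p) set)"
  have "C ^ (4 * (CARD('p) + 4) + 2) * ?V < \<infinity>"
    using C(2) emeasure_annulus_finite by (simp add: ennreal_mult_less_top power_less_top_ennreal)
  moreover have "(\<integral>\<^sup>+\<omega>. sample_weight (N (Inr t) \<omega>) * sample_weight (N (Inl i) \<omega>) * energy c (design \<omega>) \<partial>M)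
      \<le> C ^ (4 * (CARD('p) + 4) + 2) * ?V" if c: "finite c" "card c = 4 * (CARD('p) + 4)" for c i t
  proof -
    define A where "A \<omega> = sample_weight (N (Inr t) \<omega>) * sample_weight (N (Inl i) \<omega>)" for \<omega>
    define P where "P \<omega> v = (\<Prod>l\<in>c. inv_proj (fst (N (Inl l) \<omega>)) v)" for \<omega> v
    have A[measurable]: "A \<in> borel_measurable M" unfolding A_def by measurable
    have Nf[measurable]: "(\<lambda>z. N l (fst z)) \<in> borel_measurable (M \<Otimes>\<^sub>M lborel)" for l
      by (rule measurable_compose[OF measurable_fst sample_measurable])
    have P2: "(\<lambda>(\<omega>, v). P \<omega> v) \<in> borel_measurable (M \<Otimes>\<^sub>M lborel)"
      unfolding split_beta' P_def by measurable
    have Pv: "P \<omega> \<in> borel_measurable borel" for \<omega> unfolding P_def[abs_def] by measurable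
    have m: "(\<lambda>(\<omega>, v). A \<omega> * (P \<omega> v * indicator annulus v)) \<in> borel_measurable (M \<Otimes>\<^sub>M lborel)"
      using P2 unfolding split_beta' by measurable
    interpret MV: pair_sigma_finite M "lborel :: (real ^ 'p) measure" by unfold_locales
    have "(\<integral>\<^sup>+\<omega>. A \<omega> * energy c (design \<omega>) \<partial>M) = (\<integral>\<^sup>+\<omega>. \<integral>\<^sup>+v. A \<omega> * (P \<omega> v * indicator annulus v) \<partial>lborel \<partial>M)"
      using Pv by (intro nn_integral_cong) (simp add: energy_def P_def[symmetric] nn_integral_cmult)
    also have "\<dots> = (\<integral>\<^sup>+v. \<integral>\<^sup>+\<omega>. A \<omega> * (P \<omega> v * indicator annulus v) \<partial>M \<partial>lborel)"
      using MV.Fubini'[OF m] by simp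
    also have "\<dots> \<le> (\<integral>\<^sup>+v. C ^ (4 * (CARD('p) + 4) + 2) * indicator (annulus :: (real ^ 'p) set) v \<partial>lborel)"
    proof (rule nn_integral_mono)
      fix v :: "real ^ 'p"
      show "(\<integral>\<^sup>+\<omega>. A \<omega> * (P \<omega> v * indicator annulus v) \<partial>M) \<le> C ^ (4 * (CARD('p) + 4) + 2) * indicator annulus v"
      proof (cases "v \<in> annulus")
        case True
        from C(3)[OF c(1) this, of t i] have "(\<integral>\<^sup>+\<omega>. A \<omega> * P \<omega> v \<partial>M) \<le> C ^ (card c + 2)"
          by (simp only: A_def P_def)
        with True c(2) show ?thesis by (simp only: indicator_simps mult_1_right)
      qed simp
    qed
    also have "\<dots> = C ^ (4 * (CARD('p) + 4) + 2) * ?V" by (simp add: nn_integral_cmult_indicator)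
    finally show ?thesis by (simp only: A_def)
  qed
  ultimately show ?thesis using that by blast
qed

lemma AE_energy_finite:
  assumes c: "finite c" "card c = 4 * (CARD('p) + 4)"
  shows "AE \<omega> in M. energy c (design \<omega>) < \<infinity>"
proof -
  obtain C where C: "C < \<infinity>"
    "\<And>c i t. finite c \<Longrightarrow> card c = 4 * (CARD('p) + 4) \<Longrightarrow>
      (\<integral>\<^sup>+\<omega>. sample_weight (N (Inr t) \<omega>) * sample_weight (N (Inl i) \<omega>) * energy c (design \<omega>) \<partial>M) \<le> C"
    using weighted_energy_bound by blast
  have [measurable]: "(\<lambda>\<omega>. energy c (design \<omega>)) \<in> borel_measurable M"
    using c(1) by (rule energy_measurable) measurable
  have "(\<integral>\<^sup>+\<omega>. energy c (design \<omega>) \<partial>M)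
      \<le> (\<integral>\<^sup>+\<omega>. sample_weight (N (Inr 0) \<omega>) * sample_weight (N (Inl 0) \<omega>) * energy c (design \<omega>) \<partial>M)"
  proof (rule nn_integral_mono)
    fix \<omega>
    have "1 * 1 * energy c (design \<omega>) \<le> sample_weight (N (Inr 0) \<omega>) * sample_weight (N (Inl 0) \<omega>) * energy c (design \<omega>)"
      by (intro mult_mono sample_weight_ge_1) auto
    then show "energy c (design \<omega>) \<le> sample_weight (N (Inr 0) \<omega>) * sample_weight (N (Inl 0) \<omega>) * energy c (design \<omega>)"
      by simp
  qed
  also have "\<dots> \<le> C" by (rule C(2)[OF c])
  also note C(1)
  finally have "(\<integral>\<^sup>+\<omega>. energy c (design \<omega>) \<partial>M) \<noteq> \<infinity>" by simp
  then show ?thesis by (rule AE_mp[OF nn_integral_PInf_AE[rotated]]) (auto simp: less_top)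
qed

end

section \<open>Estimation error of least squares\<close>

text \<open>The estimated minus the true coefficients, the coefficients outside \<open>S\<close> being estimated by \<open>0\<close>. The
argument \<open>d\<close> consists of covariates and noise, from which the responses are rebuilt.\<close>

definition estimation_error ::
  "'p set \<Rightarrow> nat \<Rightarrow> ((nat \<Rightarrow> ('p \<Rightarrow> real) \<times> real) \<Rightarrow> 'p \<Rightarrow> real) \<Rightarrow> real ^ 'p \<Rightarrow>
   (nat + nat \<Rightarrow> (real ^ 'p) \<times> real) \<Rightarrow> real ^ 'p" where
  "estimation_error S n fit \<beta> d =
     (\<chi> k. if k \<in> S
       then fit (\<lambda>i\<in>{..<n}. (coords S (fst (d (Inl i))), fst (d (Inl i)) \<bullet> \<beta> + snd (d (Inl i)))) k
       else 0) - \<beta>"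

lemma linear_predictor_coords:
  fixes x :: "real ^ 'p::finite"
  shows "linear_predictor S b (coords S x) = x \<bullet> (\<chi> k. if k \<in> S then b k else 0)"
proof -
  have "x \<bullet> (\<chi> k. if k \<in> S then b k else 0) = (\<Sum>k\<in>UNIV. if k \<in> S then x $ k * b k else 0)"
    unfolding inner_vec_def by (rule sum.cong) auto
  also have "\<dots> = (\<Sum>k\<in>S. x $ k * b k)" by (simp add: sum.If_cases)
  finally show ?thesis by (simp add: linear_predictor_def coords_def mult.commute)
qed

lemma predictor_eq_estimation_error:
  fixes x :: "real ^ 'p::finite"
  shows "linear_predictor S (fit (\<lambda>i\<in>{..<n}. (coords S (fst (d (Inl i))), fst (d (Inl i)) \<bullet> \<beta> + snd (d (Inl i)))))
      (coords S x) = x \<bullet> \<beta> + x \<bullet> estimation_error S n fit \<beta> d"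
  unfolding linear_predictor_coords estimation_error_def by (simp add: inner_diff_right)

lemma estimation_error_minimal:
  fixes \<beta> :: "real ^ 'p::finite"
  assumes fit: "least_squares_fit S n fit" and \<beta>: "\<And>k. k \<notin> S \<Longrightarrow> \<beta> $ k = 0"
  shows "(\<Sum>i<n. (snd (d (Inl i)) - fst (d (Inl i)) \<bullet> estimation_error S n fit \<beta> d)\<^sup>2)
    \<le> (\<Sum>i<n. (snd (d (Inl i)))\<^sup>2)"
proof -
  define D where "D = (\<lambda>i\<in>{..<n}. (coords S (fst (d (Inl i))), fst (d (Inl i)) \<bullet> \<beta> + snd (d (Inl i))))"
  let ?f = "\<lambda>b. \<Sum>i<n. (snd (D i) - linear_predictor S b (fst (D i)))\<^sup>2"
  have "D \<in> space (Pi\<^sub>M {..<n} (\<lambda>_. Pi\<^sub>M S (\<lambda>_. borel) \<Otimes>\<^sub>M borel))"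
    by (simp add: D_def space_PiM space_pair_measure coords_def)
  then have am: "is_arg_min ?f (\<lambda>b. b \<in> S \<rightarrow>\<^sub>E UNIV) (fit D)"
    using fit by (simp add: least_squares_fit_def Let_def)
  have "restrict (\<lambda>k. \<beta> $ k) S \<in> S \<rightarrow>\<^sub>E UNIV" by simp
  with am have "?f (fit D) \<le> ?f (restrict (\<lambda>k. \<beta> $ k) S)"
    unfolding is_arg_min_def by (meson not_le)
  moreover have "snd (D i) - linear_predictor S (fit D) (fst (D i))
      = snd (d (Inl i)) - fst (d (Inl i)) \<bullet> estimation_error S n fit \<beta> d" if "i < n" for i
  proof -
    have "linear_predictor S (fit D) (fst (D i)) = fst (d (Inl i)) \<bullet> \<beta> + fst (d (Inl i)) \<bullet> estimation_error S n fit \<beta> d"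
      using predictor_eq_estimation_error[where x = "fst (d (Inl i))" and S = S and fit = fit and n = n and d = d and \<beta> = \<beta>] that by (simp add: D_def)
    then show ?thesis using that by (simp add: D_def)
  qed
  moreover have "snd (D i) - linear_predictor S (restrict (\<lambda>k. \<beta> $ k) S) (fst (D i)) = snd (d (Inl i))" if "i < n" for i
  proof -
    have "(\<chi> k. if k \<in> S then restrict (\<lambda>k. \<beta> $ k) S k else 0) = \<beta>"
      using \<beta> by (auto simp: vec_eq_iff)
    then show ?thesis using that by (simp add: D_def linear_predictor_coords)
  qed
  ultimately show ?thesis by simp
qed

context gaussian_regression
begin

lemma measurable_sample_parts [measurable]:
  "(\<lambda>d. fst (d l)) \<in> borel_measurable samples" "(\<lambda>d. snd (d l)) \<in> borel_measurable samples"
  "(\<lambda>\<omega>. fst (N l \<omega>)) \<in> borel_measurable M" "(\<lambda>\<omega>. snd (N l \<omega>)) \<in> borel_measurable M"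
  by (rule borel_measurable_fst_prod[OF component_measurable] borel_measurable_snd_prod[OF component_measurable]
      borel_measurable_fst_prod[OF sample_measurable] borel_measurable_snd_prod[OF sample_measurable])+

lemma estimation_error_measurable:
  assumes fit: "least_squares_fit S n fit"
  shows "estimation_error S n fit \<beta> \<in> borel_measurable samples"
proof -
  let ?D = "\<lambda>d :: nat + nat \<Rightarrow> (real ^ 'p) \<times> real.
    \<lambda>i\<in>{..<n}. (coords S (fst (d (Inl i))), fst (d (Inl i)) \<bullet> \<beta> + snd (d (Inl i)))"
  have c: "(\<lambda>d. coords S (fst (d l))) \<in> measurable samples (Pi\<^sub>M S (\<lambda>_. borel))" for l
    unfolding coords_def by measurable
  have "?D \<in> measurable samples (Pi\<^sub>M {..<n} (\<lambda>_. Pi\<^sub>M S (\<lambda>_. borel) \<Otimes>\<^sub>M borel))"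
    by (intro measurable_restrict measurable_Pair c borel_measurable_add borel_measurable_inner
        borel_measurable_const measurable_sample_parts)
  moreover have "fit \<in> measurable (Pi\<^sub>M {..<n} (\<lambda>_. Pi\<^sub>M S (\<lambda>_. borel) \<Otimes>\<^sub>M borel)) (Pi\<^sub>M S (\<lambda>_. borel))"
    using fit by (simp add: least_squares_fit_def Let_def)
  ultimately have "(\<lambda>d. fit (?D d)) \<in> measurable samples (Pi\<^sub>M S (\<lambda>_. borel))"
    by (rule measurable_compose)
  then have k: "(\<lambda>d. fit (?D d) k) \<in> borel_measurable samples" if "k \<in> S" for k
    using that by (rule measurable_compose[OF _ measurable_component_singleton])
  have "(\<lambda>d. (\<chi> k. if k \<in> S then fit (?D d) k else 0)) \<in> borel_measurable samples"
  proof (rule borel_measurable_euclidean_space[THEN iffD2], safe)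
    fix b :: "real ^ 'p" assume "b \<in> Basis"
    then obtain l where b: "b = axis l 1" by (auto simp: Basis_vec_def)
    show "(\<lambda>d. (\<chi> k. if k \<in> S then fit (?D d) k else 0) \<bullet> b) \<in> borel_measurable samples"
      using k[of l] by (cases "l \<in> S") (simp_all add: b inner_axis)
  qed
  then show ?thesis
    unfolding estimation_error_def[abs_def] by (intro borel_measurable_diff) auto
qed

text \<open>The noise variables are orthogonal even after weighting by a function that ignores their signs.\<close>

lemma nn_integral_norm_noise_sum:
  assumes W[measurable]: "W \<in> borel_measurable samples" and fW: "\<And>l d. W (flip l d) = W d"
  shows "(\<integral>\<^sup>+\<omega>. W (\<lambda>l. N l \<omega>) * ennreal ((norm (\<Sum>i<k. snd (N (Inl i) \<omega>) *\<^sub>R fst (N (Inl i) \<omega>)))\<^sup>2) \<partial>M)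
    = (\<Sum>i<k. \<integral>\<^sup>+\<omega>. W (\<lambda>l. N l \<omega>) * ennreal ((norm (snd (N (Inl i) \<omega>) *\<^sub>R fst (N (Inl i) \<omega>)))\<^sup>2) \<partial>M)"
proof (induction k)
  case (Suc k)
  let ?A = "\<lambda>d :: nat + nat \<Rightarrow> (real ^ 'p) \<times> real. \<Sum>i<k. snd (d (Inl i)) *\<^sub>R fst (d (Inl i))"
  let ?B = "\<lambda>d :: nat + nat \<Rightarrow> (real ^ 'p) \<times> real. snd (d (Inl k)) *\<^sub>R fst (d (Inl k))"
  have A: "?A \<in> borel_measurable samples"
    by (intro borel_measurable_sum borel_measurable_scaleR measurable_sample_parts)
  have B: "?B \<in> borel_measurable samples"
    by (intro borel_measurable_scaleR measurable_sample_parts)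
  have fA: "?A (flip (Inl k) d) = ?A d" for d
    by (intro sum.cong) (auto simp: flip_def)
  have fB: "?B (flip (Inl k) d) = - ?B d" for d
    by (simp add: flip_def)
  show ?case
    using nn_integral_flip_parallelogram[where W = W and A = ?A and B = ?B and l = "Inl k", OF W A B fW fA fB] Suc.IH by simp
qed simp

text \<open>The excess risk on a test point, uniformly over the fitting rules and over the sets \<open>S\<close> that contain
the support of the coefficients.\<close>

lemma prediction_error_rate:
  obtains C :: real where "0 \<le> C"
    and "\<And>S n fit \<beta> t. least_squares_fit S n fit \<Longrightarrow> (\<And>k. k \<notin> S \<Longrightarrow> \<beta> $ k = 0) \<Longrightarrow> 4 * (CARD('p) + 4) \<le> n \<Longrightarrow>
      (\<integral>\<^sup>+\<omega>. ennreal ((fst (N (Inr t) \<omega>) \<bullet> estimation_error S n fit \<beta> (\<lambda>l. N l \<omega>))\<^sup>2) \<partial>M) \<le> ennreal (C / n)"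
proof -
  define K where "K = 4 * (CARD('p) + 4)"
  have K: "K > 0" by (simp add: K_def)
  obtain C1 where C1: "C1 < \<infinity>"
    "\<And>c i t. finite c \<Longrightarrow> card c = K \<Longrightarrow>
      (\<integral>\<^sup>+\<omega>. sample_weight (N (Inr t) \<omega>) * sample_weight (N (Inl i) \<omega>) * energy c (design \<omega>) \<partial>M) \<le> C1"
    using weighted_energy_bound unfolding K_def by blast
  define a where "a = enn2real C1"
  have a: "C1 = ennreal a" "0 \<le> a" using C1(1) by (simp_all add: a_def)
  let ?\<kappa> = "energy_const TYPE('p)"
  have k: "?\<kappa> > 0" by (rule energy_const_pos)
  define C where "C = 16 * (real K)\<^sup>2 * a / ?\<kappa>"
  have "0 \<le> C" using a k by (simp add: C_def)
  moreover have "(\<integral>\<^sup>+\<omega>. ennreal ((fst (N (Inr t) \<omega>) \<bullet> estimation_error S n fit \<beta> (\<lambda>l. N l \<omega>))\<^sup>2) \<partial>M) \<le> ennreal (C / n)"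
    if fit: "least_squares_fit S n fit" and \<beta>: "\<And>k. k \<notin> S \<Longrightarrow> \<beta> $ k = 0" and n: "K \<le> n" for S n fit \<beta> t
  proof -
    \<comment> \<open>\<open>m\<close> disjoint consecutive blocks of \<open>K\<close> observations; the at most \<open>K - 1\<close> remaining ones are dropped from the lower bound.\<close>
    define m where "m = n div K"
    define c where "c b = {b * K..<b * K + K}" for b
    have m: "m > 0" using n K by (simp add: m_def div_greater_zero_iff)
    have cI: "c b \<subseteq> {..<n}" if "b \<in> {..<m}" for b
    proof -
      have "b * K + K = Suc b * K" by simp
      also have "\<dots> \<le> m * K" using that by (intro mult_le_mono1) simp
      also have "\<dots> \<le> n" unfolding m_def by (rule div_times_less_eq_dividend)
      finally show ?thesis by (auto simp: c_def)
    qed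
    have cc: "finite (c b)" "card (c b) = K" for b by (simp_all add: c_def)
    have disj: "disjoint_family_on c {..<m}"
    proof -
      have "l div K = b" if "l \<in> c b" for l b
      proof -
        have "b * K \<le> l" "l < (b + 1) * K" using that by (simp_all add: c_def algebra_simps)
        then show ?thesis by (intro div_nat_eqI) (simp_all add: mult.commute)
      qed
      then show ?thesis unfolding disjoint_family_on_def by blast
    qed
    define Z where "Z \<omega> = (\<Sum>i<n. snd (N (Inl i) \<omega>) *\<^sub>R fst (N (Inl i) \<omega>))" for \<omega>
    define W where "W b d = sample_weight (d (Inr t)) * energy (c b) (\<lambda>l. fst (d (Inl l)))" for b and d :: "nat + nat \<Rightarrow> (real ^ 'p) \<times> real"
    define \<delta> where "\<delta> \<omega> = estimation_error S n fit \<beta> (\<lambda>l. N l \<omega>)" for \<omega>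
    have W[measurable]: "W b \<in> borel_measurable samples" for b
    proof -
      have "(\<lambda>d. energy (c b) (\<lambda>l. fst (d (Inl l)))) \<in> borel_measurable samples"
        by (rule energy_measurable[OF cc(1) measurable_sample_parts(1)])
      moreover have "(\<lambda>d. sample_weight (d (Inr t))) \<in> borel_measurable samples"
        by (rule sample_weight_measurable[OF component_measurable])
      ultimately show ?thesis unfolding W_def[abs_def] by (rule borel_measurable_times_ennreal[rotated])
    qed
    have fW: "W b (flip l d) = W b d" for b l d
    proof -
      have "fst (flip l d i) = fst (d i)" "sample_weight (flip l d i) = sample_weight (d i)" for i
        by (simp_all add: flip_def sample_weight_def)
      then show ?thesis by (simp add: W_def)
    qed
    have Zm[measurable]: "Z \<in> borel_measurable M"
      unfolding Z_def[abs_def] by (intro borel_measurable_sum borel_measurable_scaleR measurable_sample_parts)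
    have WN[measurable]: "(\<lambda>\<omega>. W b (\<lambda>l. N l \<omega>)) \<in> borel_measurable M" for b
      by (rule measurable_compose[OF family_measurable W])
    define r where "r = 4 / (?\<kappa> * real m ^ 3)"
    have r: "0 \<le> r" using k by (simp add: r_def)
    have fin: "AE \<omega> in M. \<forall>b\<in>{..<m}. energy (c b) (design \<omega>) < \<infinity>"
      using AE_energy_finite[OF cc(1)] cc(2) unfolding K_def by (intro AE_finite_allI) auto
    have ae: "AE \<omega> in M. ennreal ((fst (N (Inr t) \<omega>) \<bullet> \<delta> \<omega>)\<^sup>2)
        \<le> ennreal r * (\<Sum>b<m. W b (\<lambda>l. N l \<omega>) * ennreal ((norm (Z \<omega>))\<^sup>2))"
      using fin
    proof eventually_elim
      case (elim \<omega>)
      define x where "x = design \<omega>"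
      define e where "e i = snd (N (Inl i) \<omega>)" for i
      define w where "w b = enn2real (energy (c b) x)" for b
      have w: "energy (c b) x = ennreal (w b)" "0 \<le> w b" if "b \<in> {..<m}" for b
        using elim that by (simp_all add: w_def x_def)
      have min: "(\<Sum>i<n. (e i - x i \<bullet> \<delta> \<omega>)\<^sup>2) \<le> (\<Sum>i<n. (e i)\<^sup>2)"
        using estimation_error_minimal[OF fit \<beta>, of "\<lambda>l. N l \<omega>"] by (simp add: e_def x_def \<delta>_def)
      have "?\<kappa> * real (card {..<m}) ^ 3 * (norm (\<delta> \<omega>))\<^sup>2 \<le> 4 * (\<Sum>b<m. w b) * (norm (\<Sum>i<n. e i *\<^sub>R x i))\<^sup>2"
        by (rule least_squares_error_bound[OF finite_lessThan finite_lessThan cI _ disj _ w(2) min])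
          (use cc w in \<open>auto simp: K_def\<close>)
      then have d2: "(norm (\<delta> \<omega>))\<^sup>2 \<le> r * ((\<Sum>b<m. w b) * (norm (Z \<omega>))\<^sup>2)"
        using k m by (simp add: r_def Z_def e_def x_def field_simps)
      have "(fst (N (Inr t) \<omega>) \<bullet> \<delta> \<omega>)\<^sup>2 \<le> (norm (fst (N (Inr t) \<omega>)))\<^sup>2 * (norm (\<delta> \<omega>))\<^sup>2"
        unfolding power2_norm_eq_inner by (rule Cauchy_Schwarz_ineq)
      also have "\<dots> \<le> (norm (fst (N (Inr t) \<omega>)))\<^sup>2 * (r * ((\<Sum>b<m. w b) * (norm (Z \<omega>))\<^sup>2))"
        using d2 by (rule mult_left_mono) simp
      finally have "(fst (N (Inr t) \<omega>) \<bullet> \<delta> \<omega>)\<^sup>2 \<le> (norm (fst (N (Inr t) \<omega>)))\<^sup>2 * (r * ((\<Sum>b<m. w b) * (norm (Z \<omega>))\<^sup>2))" .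
      then have "ennreal ((fst (N (Inr t) \<omega>) \<bullet> \<delta> \<omega>)\<^sup>2)
          \<le> ennreal ((norm (fst (N (Inr t) \<omega>)))\<^sup>2) * (ennreal r * (ennreal (\<Sum>b<m. w b) * ennreal ((norm (Z \<omega>))\<^sup>2)))"
      proof -
        assume le: "(fst (N (Inr t) \<omega>) \<bullet> \<delta> \<omega>)\<^sup>2 \<le> (norm (fst (N (Inr t) \<omega>)))\<^sup>2 * (r * ((\<Sum>b<m. w b) * (norm (Z \<omega>))\<^sup>2))"
        have sw: "0 \<le> (\<Sum>b<m. w b)" by (rule sum_nonneg) (rule w(2))
        show ?thesis
          using ennreal_leI[OF le] by (simp only: ennreal_mult r sw zero_le_power2 mult_nonneg_nonneg)
      qed
      also have "\<dots> \<le> sample_weight (N (Inr t) \<omega>) * (ennreal r * (ennreal (\<Sum>b<m. w b) * ennreal ((norm (Z \<omega>))\<^sup>2)))"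
      proof (intro mult_right_mono)
        let ?z = "N (Inr t) \<omega>"
        have "(norm (fst ?z))\<^sup>2 * 1 \<le> (1 + (norm (fst ?z))\<^sup>2) * (1 + (snd ?z)\<^sup>2)" by (rule mult_mono) auto
        then show "ennreal ((norm (fst ?z))\<^sup>2) \<le> sample_weight ?z" by (simp add: sample_weight_def ennreal_leI)
      qed simp
      also have "ennreal (\<Sum>b<m. w b) = (\<Sum>b<m. energy (c b) (design \<omega>))"
      proof -
        have "(\<Sum>b<m. energy (c b) (design \<omega>)) = (\<Sum>b<m. ennreal (w b))"
          by (rule sum.cong[OF refl]) (rule w(1)[unfolded x_def])
        also have "\<dots> = ennreal (\<Sum>b<m. w b)" by (rule sum_ennreal) (rule w(2))
        finally show ?thesis by (rule sym)
      qed
      also have "sample_weight (N (Inr t) \<omega>) * (ennreal r * ((\<Sum>b<m. energy (c b) (design \<omega>)) * ennreal ((norm (Z \<omega>))\<^sup>2)))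
          = ennreal r * (\<Sum>b<m. W b (\<lambda>l. N l \<omega>) * ennreal ((norm (Z \<omega>))\<^sup>2))"
        unfolding W_def sum_distrib_right[symmetric] sum_distrib_left[symmetric] by (simp only: mult_ac)
      finally show ?case .
    qed
    have "(\<integral>\<^sup>+\<omega>. ennreal ((fst (N (Inr t) \<omega>) \<bullet> \<delta> \<omega>)\<^sup>2) \<partial>M)
        \<le> (\<integral>\<^sup>+\<omega>. ennreal r * (\<Sum>b<m. W b (\<lambda>l. N l \<omega>) * ennreal ((norm (Z \<omega>))\<^sup>2)) \<partial>M)"
      using ae by (rule nn_integral_mono_AE)
    also have "\<dots> = ennreal r * (\<Sum>b<m. \<integral>\<^sup>+\<omega>. W b (\<lambda>l. N l \<omega>) * ennreal ((norm (Z \<omega>))\<^sup>2) \<partial>M)"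
      by (subst nn_integral_cmult, measurable) (subst nn_integral_sum, auto)
    also have "\<dots> \<le> ennreal r * (\<Sum>b<m. of_nat n * C1)"
    proof (intro mult_left_mono sum_mono)
      fix b
      have "(\<integral>\<^sup>+\<omega>. W b (\<lambda>l. N l \<omega>) * ennreal ((norm (Z \<omega>))\<^sup>2) \<partial>M)
          = (\<Sum>i<n. \<integral>\<^sup>+\<omega>. W b (\<lambda>l. N l \<omega>) * ennreal ((norm (snd (N (Inl i) \<omega>) *\<^sub>R fst (N (Inl i) \<omega>)))\<^sup>2) \<partial>M)"
        unfolding Z_def by (rule nn_integral_norm_noise_sum[OF W fW])
      also have "\<dots> \<le> (\<Sum>i<n. C1)"
      proof (rule sum_mono)
        fix i
        have "(\<integral>\<^sup>+\<omega>. W b (\<lambda>l. N l \<omega>) * ennreal ((norm (snd (N (Inl i) \<omega>) *\<^sub>R fst (N (Inl i) \<omega>)))\<^sup>2) \<partial>M)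
            \<le> (\<integral>\<^sup>+\<omega>. sample_weight (N (Inr t) \<omega>) * sample_weight (N (Inl i) \<omega>) * energy (c b) (design \<omega>) \<partial>M)"
        proof (rule nn_integral_mono)
          fix \<omega>
          let ?z = "N (Inl i) \<omega>"
          have "(norm (fst ?z))\<^sup>2 * (snd ?z)\<^sup>2 \<le> (1 + (norm (fst ?z))\<^sup>2) * (1 + (snd ?z)\<^sup>2)" by (rule mult_mono) auto
          then have "ennreal ((norm (snd ?z *\<^sub>R fst ?z))\<^sup>2) \<le> sample_weight ?z"
            by (simp add: sample_weight_def ennreal_leI power_mult_distrib mult.commute)
          then have "W b (\<lambda>l. N l \<omega>) * ennreal ((norm (snd ?z *\<^sub>R fst ?z))\<^sup>2) \<le> W b (\<lambda>l. N l \<omega>) * sample_weight ?z"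
            by (rule mult_left_mono) simp
          also have "\<dots> = sample_weight (N (Inr t) \<omega>) * sample_weight ?z * energy (c b) (design \<omega>)"
            unfolding W_def by (simp only: mult_ac)
          finally show "W b (\<lambda>l. N l \<omega>) * ennreal ((norm (snd ?z *\<^sub>R fst ?z))\<^sup>2)
            \<le> sample_weight (N (Inr t) \<omega>) * sample_weight ?z * energy (c b) (design \<omega>)" .
        qed
        also have "\<dots> \<le> C1" by (rule C1(2)[OF cc])
        finally show "(\<integral>\<^sup>+\<omega>. W b (\<lambda>l. N l \<omega>) * ennreal ((norm (snd (N (Inl i) \<omega>) *\<^sub>R fst (N (Inl i) \<omega>)))\<^sup>2) \<partial>M) \<le> C1" .
      qed
      finally show "(\<integral>\<^sup>+\<omega>. W b (\<lambda>l. N l \<omega>) * ennreal ((norm (Z \<omega>))\<^sup>2) \<partial>M) \<le> of_nat n * C1" by simp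
    qed simp
    also have "\<dots> = ennreal (r * (real m * (real n * a)))"
      using r a(2) by (simp add: a(1) ennreal_mult ennreal_of_nat_eq_real_of_nat)
    also have "\<dots> \<le> ennreal (C / n)"
    proof (rule ennreal_leI)
      have "n < (m + 1) * K" using K unfolding m_def by (simp add: dividend_less_div_times add.commute)
      also have "\<dots> \<le> (2 * m) * K" using m by (intro mult_le_mono1) simp
      finally have "real n \<le> 2 * real m * real K" by (metis less_imp_le of_nat_le_iff of_nat_mult of_nat_numeral)
      then have nn: "(real n)\<^sup>2 \<le> (2 * real m * real K)\<^sup>2" by (intro power_mono) auto
      have n0: "real n > 0" using n K by simp
      have "r * (real m * (real n * a)) = 4 * a * real n / (?\<kappa> * (real m)\<^sup>2)"
        using m k by (simp add: r_def power3_eq_cube power2_eq_square field_simps)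
      also have "\<dots> = 4 * a / ?\<kappa> * ((real n)\<^sup>2 / (real m)\<^sup>2) / real n"
        using n0 by (simp add: power2_eq_square field_simps)
      also have "\<dots> \<le> 4 * a / ?\<kappa> * (4 * (real K)\<^sup>2) / real n"
        using nn m a(2) k n0 by (intro divide_right_mono mult_left_mono) (simp_all add: pos_divide_le_eq power_mult_distrib mult_ac)
      also have "\<dots> = C / real n" by (simp add: C_def)
      finally show "r * (real m * (real n * a)) \<le> C / real n" .
    qed
    finally show ?thesis by (simp only: \<delta>_def)
  qed
  ultimately show ?thesis using that unfolding K_def by blast
qed

end

section \<open>The importance score\<close>

context gaussian_regression
begin

text \<open>The noise of a test observation is independent of its covariates and of the training sample; again the
cross term vanishes by symmetry.\<close>

lemma test_error_decomposition:
  assumes fit: "least_squares_fit S n fit"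
  shows "(\<integral>\<^sup>+\<omega>. ennreal ((fst (N (Inr t) \<omega>) \<bullet> estimation_error S n fit \<beta> (\<lambda>l. N l \<omega>) - snd (N (Inr t) \<omega>))\<^sup>2) \<partial>M)
    = (\<integral>\<^sup>+\<omega>. ennreal ((fst (N (Inr t) \<omega>) \<bullet> estimation_error S n fit \<beta> (\<lambda>l. N l \<omega>))\<^sup>2) \<partial>M)
    + (\<integral>\<^sup>+\<omega>. ennreal ((\<epsilon> \<omega>)\<^sup>2) \<partial>M)"
proof -
  let ?A = "\<lambda>d. fst (d (Inr t)) \<bullet> estimation_error S n fit \<beta> d"
  let ?B = "\<lambda>d :: nat + nat \<Rightarrow> (real ^ 'p) \<times> real. - snd (d (Inr t))"
  have A: "?A \<in> borel_measurable samples"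
    by (intro borel_measurable_inner measurable_sample_parts estimation_error_measurable[OF fit])
  have B: "?B \<in> borel_measurable samples"
    by (intro borel_measurable_uminus measurable_sample_parts)
  have fA: "?A (flip (Inr t) d) = ?A d" for d
  proof -
    have "flip (Inr t) d (Inl i) = d (Inl i)" for i by (simp add: flip_def)
    moreover have "fst (flip (Inr t) d (Inr t)) = fst (d (Inr t))" by (simp add: flip_def)
    ultimately show ?thesis unfolding estimation_error_def by (simp only:)
  qed
  have fB: "?B (flip (Inr t) d) = - ?B d" for d by (simp add: flip_def)
  have "(\<integral>\<^sup>+\<omega>. ennreal ((?A (\<lambda>l. N l \<omega>) + ?B (\<lambda>l. N l \<omega>))\<^sup>2) \<partial>M)
    = (\<integral>\<^sup>+\<omega>. ennreal ((?A (\<lambda>l. N l \<omega>))\<^sup>2) \<partial>M) + (\<integral>\<^sup>+\<omega>. ennreal ((?B (\<lambda>l. N l \<omega>))\<^sup>2) \<partial>M)"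
    using nn_integral_flip_parallelogram[where W = "\<lambda>_. 1" and A = ?A and B = ?B and l = "Inr t",
        OF borel_measurable_const A B refl fA fB]
    by (simp only: mult_1 real_norm_def power2_abs)
  moreover have "(\<integral>\<^sup>+\<omega>. ennreal ((?B (\<lambda>l. N l \<omega>))\<^sup>2) \<partial>M) = (\<integral>\<^sup>+\<omega>. ennreal ((\<epsilon> \<omega>)\<^sup>2) \<partial>M)"
  proof -
    have m: "(\<lambda>z :: (real ^ 'p) \<times> real. ennreal ((snd z)\<^sup>2)) \<in> borel_measurable borel" by measurable
    show ?thesis using nn_integral_sample[OF m, of "Inr t"] by simp
  qed
  ultimately show ?thesis by simp
qed

lemma test_error_rate:
  obtains C s :: real where "0 \<le> C"
    and "\<And>S n fit \<beta> t. least_squares_fit S n fit \<Longrightarrow> (\<And>k. k \<notin> S \<Longrightarrow> \<beta> $ k = 0) \<Longrightarrow> 4 * (CARD('p) + 4) \<le> n \<Longrightarrow>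
      \<exists>a. 0 \<le> a \<and> a \<le> C / n \<and>
        has_bochner_integral M
          (\<lambda>\<omega>. (fst (N (Inr t) \<omega>) \<bullet> estimation_error S n fit \<beta> (\<lambda>l. N l \<omega>) - snd (N (Inr t) \<omega>))\<^sup>2) (a + s)"
proof -
  obtain C where C: "0 \<le> C"
    "\<And>S n fit \<beta> t. least_squares_fit S n fit \<Longrightarrow> (\<And>k. k \<notin> S \<Longrightarrow> \<beta> $ k = 0) \<Longrightarrow> 4 * (CARD('p) + 4) \<le> n \<Longrightarrow>
      (\<integral>\<^sup>+\<omega>. ennreal ((fst (N (Inr t) \<omega>) \<bullet> estimation_error S n fit \<beta> (\<lambda>l. N l \<omega>))\<^sup>2) \<partial>M) \<le> ennreal (C / n)"
    using prediction_error_rate by blast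
  define s where "s = enn2real (\<integral>\<^sup>+\<omega>. ennreal ((\<epsilon> \<omega>)\<^sup>2) \<partial>M)"
  have "(\<integral>\<^sup>+\<omega>. ennreal ((\<epsilon> \<omega>)\<^sup>2) \<partial>M) \<le> (\<integral>\<^sup>+\<omega>. ennreal (1 + (\<epsilon> \<omega>)\<^sup>2) \<partial>M)"
    by (intro nn_integral_mono ennreal_leI) simp
  then have "(\<integral>\<^sup>+\<omega>. ennreal ((\<epsilon> \<omega>)\<^sup>2) \<partial>M) < \<infinity>" using noise_second_moment_finite by (rule le_less_trans)
  then have s: "(\<integral>\<^sup>+\<omega>. ennreal ((\<epsilon> \<omega>)\<^sup>2) \<partial>M) = ennreal s" "0 \<le> s" by (simp_all add: s_def)
  have "\<exists>a. 0 \<le> a \<and> a \<le> C / n \<and>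
        has_bochner_integral M
          (\<lambda>\<omega>. (fst (N (Inr t) \<omega>) \<bullet> estimation_error S n fit \<beta> (\<lambda>l. N l \<omega>) - snd (N (Inr t) \<omega>))\<^sup>2) (a + s)"
    if fit: "least_squares_fit S n fit" and \<beta>: "\<And>k. k \<notin> S \<Longrightarrow> \<beta> $ k = 0" and n: "4 * (CARD('p) + 4) \<le> n"
    for S n fit \<beta> t
  proof -
    let ?r = "\<integral>\<^sup>+\<omega>. ennreal ((fst (N (Inr t) \<omega>) \<bullet> estimation_error S n fit \<beta> (\<lambda>l. N l \<omega>))\<^sup>2) \<partial>M"
    have r: "?r \<le> ennreal (C / n)" by (rule C(2)[OF fit \<beta> n])
    define a where "a = enn2real ?r"
    have "?r < \<infinity>" using r by (rule le_less_trans) simp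
    then have a: "?r = ennreal a" "0 \<le> a" by (simp_all add: a_def)
    have "a \<le> C / n" using r a C(1) by (simp add: ennreal_le_iff)
    moreover have "has_bochner_integral M
          (\<lambda>\<omega>. (fst (N (Inr t) \<omega>) \<bullet> estimation_error S n fit \<beta> (\<lambda>l. N l \<omega>) - snd (N (Inr t) \<omega>))\<^sup>2) (a + s)"
    proof (rule has_bochner_integral_nn_integral)
      have "(\<lambda>\<omega>. estimation_error S n fit \<beta> (\<lambda>l. N l \<omega>)) \<in> borel_measurable M"
        by (rule measurable_compose[OF family_measurable estimation_error_measurable[OF fit]])
      then show "(\<lambda>\<omega>. (fst (N (Inr t) \<omega>) \<bullet> estimation_error S n fit \<beta> (\<lambda>l. N l \<omega>) - snd (N (Inr t) \<omega>))\<^sup>2) \<in> borel_measurable M"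
        by (intro borel_measurable_power borel_measurable_diff borel_measurable_inner measurable_sample_parts)
      show "(\<integral>\<^sup>+\<omega>. ennreal ((fst (N (Inr t) \<omega>) \<bullet> estimation_error S n fit \<beta> (\<lambda>l. N l \<omega>) - snd (N (Inr t) \<omega>))\<^sup>2) \<partial>M)
          = ennreal (a + s)"
        unfolding test_error_decomposition[OF fit] a(1) s(1) using a(2) s(2) by (simp add: ennreal_plus)
    qed (use a s in auto)
    ultimately show ?thesis using a(2) by blast
  qed
  with C(1) show ?thesis using that by blast
qed

text \<open>Both expected losses lie within \<open>C / n\<close> above the noise level \<open>s\<close>.\<close>

lemma loco_expectation_bound:
  fixes \<beta> :: "real ^ 'p" and j :: 'p
  assumes \<beta>: "\<beta> $ j = 0"
  defines "obs \<equiv> \<lambda>l \<omega>. (fst (N l \<omega>), fst (N l \<omega>) \<bullet> \<beta> + snd (N l \<omega>))"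
  obtains C :: real where
    "\<And>n n_test fit fit_j. least_squares_fit UNIV n fit \<Longrightarrow> least_squares_fit (- {j}) n fit_j \<Longrightarrow>
      4 * (CARD('p) + 4) \<le> n \<Longrightarrow> 0 < n_test \<Longrightarrow>
      \<exists>a. \<bar>a\<bar> \<le> C / n \<and> has_bochner_integral M
        (\<lambda>\<omega>. loco j (trained_predictor UNIV n fit (\<lambda>i. obs (Inl i) \<omega>))
               (trained_predictor (- {j}) n fit_j (\<lambda>i. obs (Inl i) \<omega>))
               n_test (\<lambda>i. obs (Inr i) \<omega>)) a"
proof -
  obtain C s where C: "0 \<le> C"
    "\<And>S n fit \<beta> t. least_squares_fit S n fit \<Longrightarrow> (\<And>k. k \<notin> S \<Longrightarrow> \<beta> $ k = 0) \<Longrightarrow> 4 * (CARD('p) + 4) \<le> n \<Longrightarrow>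
      \<exists>a. 0 \<le> a \<and> a \<le> C / n \<and>
        has_bochner_integral M
          (\<lambda>\<omega>. (fst (N (Inr t) \<omega>) \<bullet> estimation_error S n fit \<beta> (\<lambda>l. N l \<omega>) - snd (N (Inr t) \<omega>))\<^sup>2) (a + s)"
    using test_error_rate by blast
  have "\<exists>a. \<bar>a\<bar> \<le> C / n \<and> has_bochner_integral M
        (\<lambda>\<omega>. loco j (trained_predictor UNIV n fit (\<lambda>i. obs (Inl i) \<omega>))
               (trained_predictor (- {j}) n fit_j (\<lambda>i. obs (Inl i) \<omega>))
               n_test (\<lambda>i. obs (Inr i) \<omega>)) a"
    if fit: "least_squares_fit UNIV n fit" and fit_j: "least_squares_fit (- {j}) n fit_j"
      and n: "4 * (CARD('p) + 4) \<le> n" and nt: "0 < n_test" for n n_test fit fit_j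
  proof -
    define q where "q S f t \<omega> = (fst (N (Inr t) \<omega>) \<bullet> estimation_error S n f \<beta> (\<lambda>l. N l \<omega>) - snd (N (Inr t) \<omega>))\<^sup>2"
      for S f t \<omega>
    have "\<exists>a. 0 \<le> a \<and> a \<le> C / n \<and> has_bochner_integral M (q UNIV fit t) (a + s)" for t
      unfolding q_def[abs_def] using n by (intro C(2)[OF fit]) auto
    then obtain a where a: "\<And>t. 0 \<le> a t" "\<And>t. a t \<le> C / n" "\<And>t. has_bochner_integral M (q UNIV fit t) (a t + s)"
      by metis
    have "\<exists>a. 0 \<le> a \<and> a \<le> C / n \<and> has_bochner_integral M (q (- {j}) fit_j t) (a + s)" for t
      unfolding q_def[abs_def] using n \<beta> by (intro C(2)[OF fit_j]) auto
    then obtain b where b: "\<And>t. 0 \<le> b t" "\<And>t. b t \<le> C / n" "\<And>t. has_bochner_integral M (q (- {j}) fit_j t) (b t + s)"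
      by metis
    have q: "(trained_predictor S n f (\<lambda>i. obs (Inl i) \<omega>) (coords S (fst (obs (Inr t) \<omega>))) - snd (obs (Inr t) \<omega>))\<^sup>2
        = q S f t \<omega>" for S f t \<omega>
    proof -
      have "trained_predictor S n f (\<lambda>i. obs (Inl i) \<omega>) (coords S (fst (obs (Inr t) \<omega>)))
          = fst (N (Inr t) \<omega>) \<bullet> \<beta> + fst (N (Inr t) \<omega>) \<bullet> estimation_error S n f \<beta> (\<lambda>l. N l \<omega>)"
        unfolding trained_predictor_def obs_def fst_conv snd_conv
        by (rule predictor_eq_estimation_error[where d = "\<lambda>l. N l \<omega>"])
      then show ?thesis by (simp add: q_def obs_def)
    qed
    have L: "loco j (trained_predictor UNIV n fit (\<lambda>i. obs (Inl i) \<omega>))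
               (trained_predictor (- {j}) n fit_j (\<lambda>i. obs (Inl i) \<omega>))
               n_test (\<lambda>i. obs (Inr i) \<omega>) = 1 / real n_test * (\<Sum>t<n_test. q (- {j}) fit_j t \<omega> - q UNIV fit t \<omega>)" for \<omega>
      unfolding loco_def q ..
    let ?a = "1 / real n_test * (\<Sum>t<n_test. (b t + s) - (a t + s))"
    have "has_bochner_integral M (\<lambda>\<omega>. 1 / real n_test * (\<Sum>t<n_test. q (- {j}) fit_j t \<omega> - q UNIV fit t \<omega>)) ?a"
      using a(3) b(3)
      by (intro has_bochner_integral_mult_right has_bochner_integral_sum has_bochner_integral_diff)
    moreover have "\<bar>?a\<bar> \<le> C / n"
    proof -
      have "\<bar>\<Sum>t<n_test. (b t + s) - (a t + s)\<bar> \<le> (\<Sum>t<n_test. C / n)"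
      proof (rule order_trans[OF sum_abs], rule sum_mono)
        fix t show "\<bar>(b t + s) - (a t + s)\<bar> \<le> C / n" using a(1,2)[of t] b(1,2)[of t] by linarith
      qed
      also have "\<dots> = real n_test * (C / n)" by simp
      finally show ?thesis using nt by (simp add: abs_mult divide_le_eq mult.commute)
    qed
    ultimately show ?thesis unfolding L by blast
  qed
  then show ?thesis using that by blast
qed

end

theorem lemma3p11:
  fixes M :: "'a measure"
    and X :: "'a \<Rightarrow> real ^ 'p::finite" and y \<epsilon> :: "'a \<Rightarrow> real"
    and \<beta> :: "real ^ 'p" and \<sigma> :: real and j :: 'p
    and train test :: "nat \<Rightarrow> 'a \<Rightarrow> (real ^ 'p) \<times> real"
    and n_test :: "nat \<Rightarrow> nat"
    and fit fit_j :: "nat \<Rightarrow> (nat \<Rightarrow> ('p \<Rightarrow> real) \<times> real) \<Rightarrow> 'p \<Rightarrow> real"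
    and \<psi> :: "nat \<Rightarrow> 'a \<Rightarrow> real"
  assumes "prob_space M"
    and "gaussian_vector M X"
    and "invertible (covariance_matrix M X)"
    and "\<epsilon> \<in> borel_measurable M" and "distr M borel \<epsilon> = normal_law 0 \<sigma>"
    and "indep_borel M X \<epsilon>"
    and "y = (\<lambda>\<omega>. X \<omega> \<bullet> \<beta> + \<epsilon> \<omega>)"
    and "cond_indep M (\<lambda>\<omega>. X \<omega> $ j) y (Pi\<^sub>M (- {j}) (\<lambda>_. borel)) (\<lambda>\<omega>. coords (- {j}) (X \<omega>))"
    and "prob_space.indep_vars M (\<lambda>_. borel) (case_sum train test) UNIV"
    and "\<And>i. distr M borel (train i) = distr M borel (\<lambda>\<omega>. (X \<omega>, y \<omega>))"
    and "\<And>i. distr M borel (test i) = distr M borel (\<lambda>\<omega>. (X \<omega>, y \<omega>))"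
    and "\<And>n. n_test n > 0"
    and "\<And>n. least_squares_fit UNIV n (fit n)"
    and "\<And>n. least_squares_fit (- {j}) n (fit_j n)"
    and "\<psi> = (\<lambda>n \<omega>. loco j
               (trained_predictor UNIV n (fit n) (\<lambda>i. train i \<omega>))
               (trained_predictor (- {j}) n (fit_j n) (\<lambda>i. train i \<omega>))
               (n_test n) (\<lambda>i. test i \<omega>))"
  shows "(\<forall>\<^sub>F n in sequentially. integrable M (\<psi> n)) \<and>
         (\<lambda>n. \<integral>\<omega>. \<psi> n \<omega> \<partial>M) \<in> O(\<lambda>n. 1 / real n)"
proof -
  interpret gaussian_design M X
    using assms(1-3) by (simp add: gaussian_design_def gaussian_design_axioms_def)
  note [measurable] = assms(4)
  define T where "T = case_sum train test"
  define N where "N l \<omega> = (fst (T l \<omega>), snd (T l \<omega>) - fst (T l \<omega>) \<bullet> \<beta>)" for l \<omega>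
  have Tm: "T l \<in> borel_measurable M" for l
    using assms(9) by (simp add: T_def indep_vars_def)
  have ym: "(\<lambda>\<omega>. (X \<omega>, y \<omega>)) \<in> borel_measurable M" unfolding assms(7) by measurable
  have \<Phi>: "(\<lambda>z :: (real ^ 'p) \<times> real. (fst z, snd z - fst z \<bullet> \<beta>)) \<in> borel_measurable borel" (is "?\<Phi> \<in> _")
    by (intro borel_measurable_Pair borel_measurable_diff borel_measurable_inner borel_measurable_const
        borel_measurable_fst_prod borel_measurable_snd_prod measurable_ident_sets refl)
  have "indep_vars (\<lambda>_. borel) N UNIV"
    unfolding N_def[abs_def]
    using assms(9)[folded T_def] \<Phi> by (rule indep_vars_compose2)
  moreover have "distr M borel (N l) = distr M borel (\<lambda>\<omega>. (X \<omega>, \<epsilon> \<omega>))" for l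
  proof -
    have Tl: "distr M borel (T l) = distr M borel (\<lambda>\<omega>. (X \<omega>, y \<omega>))"
      unfolding T_def using assms(10,11) by (cases l) simp_all
    have "distr M borel (N l) = distr (distr M borel (T l)) borel ?\<Phi>"
      by (subst distr_distr[OF \<Phi> Tm]) (simp add: comp_def N_def[abs_def])
    also have "\<dots> = distr M borel (\<lambda>\<omega>. (X \<omega>, \<epsilon> \<omega>))"
      unfolding Tl by (subst distr_distr[OF \<Phi> ym]) (simp add: comp_def assms(7))
    finally show ?thesis .
  qed
  ultimately interpret gaussian_regression M X \<epsilon> \<sigma> N
    using assms(4-6) by unfold_locales
  have \<beta>: "\<beta> $ j = 0"
    using assms(4-6) assms(8)[unfolded assms(7)] by (rule coefficient_zero_if_cond_indep)
  have obs: "(fst (N l \<omega>), fst (N l \<omega>) \<bullet> \<beta> + snd (N l \<omega>)) = T l \<omega>" for l \<omega>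
    by (simp add: N_def)
  obtain C where C: "\<And>n n_test fit fit_j. least_squares_fit UNIV n fit \<Longrightarrow> least_squares_fit (- {j}) n fit_j \<Longrightarrow>
      4 * (CARD('p) + 4) \<le> n \<Longrightarrow> 0 < n_test \<Longrightarrow>
      \<exists>a. \<bar>a\<bar> \<le> C / n \<and> has_bochner_integral M
        (\<lambda>\<omega>. loco j (trained_predictor UNIV n fit (\<lambda>i. train i \<omega>))
               (trained_predictor (- {j}) n fit_j (\<lambda>i. train i \<omega>)) n_test (\<lambda>i. test i \<omega>)) a"
    using loco_expectation_bound[OF \<beta>] unfolding obs by (simp only: T_def sum.case) blast
  have main: "\<exists>a. \<bar>a\<bar> \<le> C / n \<and> has_bochner_integral M (\<psi> n) a" if "4 * (CARD('p) + 4) \<le> n" for n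
    unfolding assms(15) by (rule C[OF assms(13,14) that assms(12)])
  have ev: "\<forall>\<^sub>F n in sequentially. 4 * (CARD('p) + 4) \<le> n" by (rule eventually_ge_at_top)
  show ?thesis
  proof
    show "\<forall>\<^sub>F n in sequentially. integrable M (\<psi> n)"
      using ev by (rule eventually_mono) (use main in \<open>blast intro: integrable.intros\<close>)
    show "(\<lambda>n. \<integral>\<omega>. \<psi> n \<omega> \<partial>M) \<in> O(\<lambda>n. 1 / real n)"
    proof (rule bigoI[where c = C])
      show "\<forall>\<^sub>F n in sequentially. norm (\<integral>\<omega>. \<psi> n \<omega> \<partial>M) \<le> C * norm (1 / real n)"
        using ev
      proof eventually_elim
        case (elim n)
        then obtain a where "\<bar>a\<bar> \<le> C / n" "has_bochner_integral M (\<psi> n) a" using main by blast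
        then show ?case by (simp add: has_bochner_integral_integral_eq)
      qed
    qed
  qed
qed

end
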